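(* Let $P$ be a simple polytope with $m$ facets $F_1,\dots,F_m$, and let $\mathcal{Z}_{\mathbb{R}}(P)$ be the associated real moment-angle complex. For $\alpha\subset[m]=\{1,\dots,m\}$ let $P_\alpha=\bigcup_{i\in\alpha}F_i\subset P$. There is an isomorphism of graded rings $$H^{*}(\mathcal{Z}_{\mathbb{R}}(P))\cong\bigoplus_{\alpha\subset[m]}H^{*}(P,P_\alpha),$$ where the multiplication on the right-hand side is given by the cup products $$H^{*}(P,P_\alpha)\otimes H^{*}(P,P_\beta)\xrightarrow{\ \cup\ }H^{*}(P,P_{\alpha\cup\beta})$$ for all $\alpha,\beta\subset[m]$.
   Context: Cohomology is singular cohomology with integral coefficients. For a simple polytope $P$ with facets $F_1,\dots,F_m$, let $\Sigma$ be the boundary complex of the dual simplicial polytope, i.e. the simplicial complex on $[m]$ with $\sigma\in\Sigma$ if and only if $\sigma=\emptyset$ or $\bigcap_{i\in\sigma}F_i\ne\emptyset$. Then $\mathcal{Z}_{\mathbb{R}}(P)$ denotes the real moment-angle complex $$\mathcal{Z}_{\mathbb{R}}(\Sigma)=\bigcup_{\sigma\in\Sigma}\{(z_1,\dots,z_m)\in(D^1)^m : z_i\in S^0\text{ if } i\notin\sigma\}\subset(D^1)^m,$$ where $D^1=[-1,1]$ and $S^0=\{-1,1\}$. Here $P_\emptyset=\emptyset$. *)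

theory Defs
  imports "HOL-Analysis.Analysis" "HOL-Homology.Homology" "HOL-Algebra.QuotRing"
begin

section \<open>Singular cohomology with integral coefficients\<close>

text \<open>
  For a family \<open>\<A>\<close> of subsets of a space \<open>X\<close>, the cochains below are the homomorphisms
  \<open>C\<^sub>p(X) \<rightarrow> \<int>\<close> that vanish on \<open>C\<^sub>p(S)\<close> for every \<open>S \<in> \<A>\<close>, hence on the subgroup
  of \<open>C\<^sub>p(X)\<close> generated by the chains of the members of \<open>\<A>\<close>.  So \<open>\<A> = {A}\<close> gives the
  cochains of the pair \<open>(X,A)\<close>, \<open>\<A> = {{}}\<close> all cochains of \<open>X\<close>, and \<open>\<A> = {A,B}\<close> the
  cochains vanishing on \<open>C\<^sub>p(A) + C\<^sub>p(B)\<close>, which is where the cup product of relative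
  cochains takes its values.
\<close>

definition cochains :: "nat \<Rightarrow> 'a topology \<Rightarrow> 'a set set \<Rightarrow> ('a chain \<Rightarrow> int) set" where
  "cochains p X \<A> =
     {\<phi> \<in> hom (chain_group p X) integer_group \<inter> extensional (singular_chain_set p X).
        \<forall>S\<in>\<A>. \<forall>c. singular_chain p (subtopology X S) c \<longrightarrow> \<phi> c = 0}"

definition cochain_group :: "nat \<Rightarrow> 'a topology \<Rightarrow> 'a set set \<Rightarrow> ('a chain \<Rightarrow> int) monoid" where
  "cochain_group p X \<A> =
     \<lparr>carrier = cochains p X \<A>,
      monoid.mult = (\<lambda>\<phi> \<psi>. \<lambda>c\<in>singular_chain_set p X. \<phi> c + \<psi> c),
      one = (\<lambda>c\<in>singular_chain_set p X. 0)\<rparr>"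

definition coboundary :: "nat \<Rightarrow> 'a topology \<Rightarrow> ('a chain \<Rightarrow> int) \<Rightarrow> 'a chain \<Rightarrow> int" where
  "coboundary p X \<phi> = (\<lambda>c\<in>singular_chain_set (Suc p) X. \<phi> (chain_boundary (Suc p) c))"

definition cocycles :: "nat \<Rightarrow> 'a topology \<Rightarrow> 'a set set \<Rightarrow> ('a chain \<Rightarrow> int) set" where
  "cocycles p X \<A> =
     {\<phi> \<in> cochains p X \<A>. coboundary p X \<phi> = \<one>\<^bsub>cochain_group (Suc p) X \<A>\<^esub>}"

fun coboundaries :: "nat \<Rightarrow> 'a topology \<Rightarrow> 'a set set \<Rightarrow> ('a chain \<Rightarrow> int) set" where
  "coboundaries 0 X \<A> = {\<one>\<^bsub>cochain_group 0 X \<A>\<^esub>}"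
| "coboundaries (Suc p) X \<A> = coboundary p X ` cochains p X \<A>"

definition cohomology_group ::
    "nat \<Rightarrow> 'a topology \<Rightarrow> 'a set set \<Rightarrow> ('a chain \<Rightarrow> int) set monoid" where
  "cohomology_group p X \<A> =
     (cochain_group p X \<A>)\<lparr>carrier := cocycles p X \<A>\<rparr> Mod coboundaries p X \<A>"

abbreviation relative_cohomology_group ::
    "nat \<Rightarrow> 'a topology \<Rightarrow> 'a set \<Rightarrow> ('a chain \<Rightarrow> int) set monoid" where
  "relative_cohomology_group p X A \<equiv> cohomology_group p X {A}"


section \<open>Cup products\<close>

definition front_face :: "nat \<Rightarrow> ((nat \<Rightarrow> real) \<Rightarrow> 'a) \<Rightarrow> (nat \<Rightarrow> real) \<Rightarrow> 'a" where
  "front_face p \<sigma> = restrict \<sigma> (standard_simplex p)"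

definition back_face :: "nat \<Rightarrow> nat \<Rightarrow> ((nat \<Rightarrow> real) \<Rightarrow> 'a) \<Rightarrow> (nat \<Rightarrow> real) \<Rightarrow> 'a" where
  "back_face p q \<sigma> = (\<lambda>x\<in>standard_simplex q. \<sigma> (\<lambda>i. if i < p then 0 else x (i - p)))"

definition cup_cochain ::
    "nat \<Rightarrow> nat \<Rightarrow> 'a topology \<Rightarrow> ('a chain \<Rightarrow> int) \<Rightarrow> ('a chain \<Rightarrow> int) \<Rightarrow> 'a chain \<Rightarrow> int" where
  "cup_cochain p q X \<phi> \<psi> =
     (\<lambda>c\<in>singular_chain_set (p + q) X.
        \<Sum>\<sigma>\<in>Poly_Mapping.keys c. Poly_Mapping.lookup c \<sigma> *
          (\<phi> (frag_of (front_face p \<sigma>)) * \<psi> (frag_of (back_face p q \<sigma>))))"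

text \<open>
  The product \<open>H\<^sup>p(X,A) \<otimes> H\<^sup>q(X,B) \<rightarrow> H\<^sup>p\<^sup>+\<^sup>q(X,A\<union>B)\<close>.  For \<open>\<phi>\<close> in \<open>a\<close> and
  \<open>\<psi>\<close> in \<open>b\<close>, the cochain \<open>\<phi>\<union>\<psi>\<close> only vanishes on \<open>C(A) + C(B)\<close>; the class \<open>a\<union>b\<close> is
  the preimage of \<open>[\<phi>\<union>\<psi>]\<close> under the map induced by the inclusion of the cochains that
  vanish on \<open>C(A\<union>B)\<close> into those that vanish on \<open>C(A) + C(B)\<close>.  That map is bijective when
  \<open>{A,B}\<close> is an excisive couple, e.g. when \<open>A\<close> and \<open>B\<close> are unions of faces of a polytope.
\<close>

definition cup_product ::
    "nat \<Rightarrow> nat \<Rightarrow> 'a topology \<Rightarrow> 'a set \<Rightarrow> 'a set \<Rightarrow>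
     ('a chain \<Rightarrow> int) set \<Rightarrow> ('a chain \<Rightarrow> int) set \<Rightarrow> ('a chain \<Rightarrow> int) set" where
  "cup_product p q X A B a b =
     (THE c. c \<in> carrier (relative_cohomology_group (p + q) X (A \<union> B)) \<and>
        (\<forall>\<phi>\<in>a. \<forall>\<psi>\<in>b. \<forall>\<xi>\<in>c.
           \<xi> \<in> coboundaries (p + q) X {A, B} #>\<^bsub>cochain_group (p + q) X {A, B}\<^esub>
                 cup_cochain p q X \<phi> \<psi>))"

definition cohomology_unit :: "'a topology \<Rightarrow> ('a chain \<Rightarrow> int) set" where
  "cohomology_unit X =
     coboundaries 0 X {{}} #>\<^bsub>cochain_group 0 X {{}}\<^esub>
       (\<lambda>c\<in>singular_chain_set 0 X. \<Sum>\<sigma>\<in>Poly_Mapping.keys c. Poly_Mapping.lookup c \<sigma>)"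


section \<open>Graded rings\<close>

text \<open>
  The ring \<open>\<Oplus>\<^sub>n G n\<close> for abelian groups \<open>G n\<close> (written multiplicatively, as groups are in
  the library), products \<open>\<mu> p q : G p \<times> G q \<rightarrow> G (p+q)\<close> and a unit \<open>e\<close> in \<open>G 0\<close>.
\<close>

definition graded_sum_ring ::
    "(nat \<Rightarrow> 'c monoid) \<Rightarrow> (nat \<Rightarrow> nat \<Rightarrow> 'c \<Rightarrow> 'c \<Rightarrow> 'c) \<Rightarrow> 'c \<Rightarrow> (nat \<Rightarrow> 'c) ring" where
  "graded_sum_ring G \<mu> e =
     \<lparr>carrier = carrier (sum_group UNIV G),
      monoid.mult = (\<lambda>x y n. finprod (G n) (\<lambda>p. \<mu> p (n - p) (x p) (y (n - p))) {..n}),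
      one = (\<lambda>n. if n = 0 then e else \<one>\<^bsub>G n\<^esub>),
      zero = \<one>\<^bsub>sum_group UNIV G\<^esub>,
      add = monoid.mult (sum_group UNIV G)\<rparr>"

definition homogeneous :: "(nat \<Rightarrow> 'c) ring \<Rightarrow> nat \<Rightarrow> (nat \<Rightarrow> 'c) set" where
  "homogeneous R n = {x \<in> carrier R. \<forall>k. k \<noteq> n \<longrightarrow> x k = \<zero>\<^bsub>R\<^esub> k}"

definition graded_ring_isomorphic :: "(nat \<Rightarrow> 'c) ring \<Rightarrow> (nat \<Rightarrow> 'd) ring \<Rightarrow> bool" where
  "graded_ring_isomorphic R S \<longleftrightarrow>
     ring R \<and> ring S \<and>
     (\<exists>h \<in> ring_iso R S. \<forall>n. h ` homogeneous R n = homogeneous S n)"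

definition cohomology_ring :: "'a topology \<Rightarrow> (nat \<Rightarrow> ('a chain \<Rightarrow> int) set) ring" where
  "cohomology_ring X =
     graded_sum_ring (\<lambda>p. relative_cohomology_group p X {})
       (\<lambda>p q. cup_product p q X {} {}) (cohomology_unit X)"


section \<open>Simple polytopes and real moment-angle complexes\<close>

definition simple_polytope :: "'a::euclidean_space set \<Rightarrow> bool" where
  "simple_polytope P \<longleftrightarrow>
     polytope P \<and> P \<noteq> {} \<and>
     (\<forall>v. v extreme_point_of P \<longrightarrow> int (card {F. F facet_of P \<and> v \<in> F}) = aff_dim P)"

definition dual_boundary_complex :: "nat \<Rightarrow> (nat \<Rightarrow> 'a set) \<Rightarrow> nat set set" where
  "dual_boundary_complex m F = {\<sigma>. \<sigma> \<subseteq> {1..m} \<and> (\<sigma> = {} \<or> (\<Inter>i\<in>\<sigma>. F i) \<noteq> {})}"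

definition real_moment_angle_set :: "nat \<Rightarrow> nat set set \<Rightarrow> (nat \<Rightarrow> real) set" where
  "real_moment_angle_set m \<Sigma> =
     (\<Union>\<sigma>\<in>\<Sigma>. {z \<in> {1..m} \<rightarrow>\<^sub>E {-1..1}. \<forall>i\<in>{1..m}. i \<notin> \<sigma> \<longrightarrow> z i \<in> {-1, 1}})"

definition real_moment_angle_complex :: "nat \<Rightarrow> nat set set \<Rightarrow> (nat \<Rightarrow> real) topology" where
  "real_moment_angle_complex m \<Sigma> =
     subtopology (product_topology (\<lambda>_. top_of_set {-1..1}) {1..m}) (real_moment_angle_set m \<Sigma>)"

definition facet_union :: "(nat \<Rightarrow> 'a set) \<Rightarrow> nat set \<Rightarrow> 'a set" where
  "facet_union F \<alpha> = (\<Union>i\<in>\<alpha>. F i)"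

text \<open>
  The graded ring \<open>\<Oplus>\<^sub>\<alpha> H\<^sup>*(P,P\<^sub>\<alpha>)\<close>: its part of degree \<open>p\<close> is \<open>\<Oplus>\<^sub>\<alpha> H\<^sup>p(P,P\<^sub>\<alpha>)\<close>, and
  the product is the biadditive extension of the cup products into \<open>H\<^sup>*(P,P\<^sub>\<alpha>\<^sub>\<union>\<^sub>\<beta>)\<close>.
\<close>

definition facet_sum_group ::
    "'a::euclidean_space set \<Rightarrow> nat \<Rightarrow> (nat \<Rightarrow> 'a set) \<Rightarrow> nat \<Rightarrow>
     (nat set \<Rightarrow> ('a chain \<Rightarrow> int) set) monoid" where
  "facet_sum_group P m F p =
     sum_group (Pow {1..m}) (\<lambda>\<alpha>. relative_cohomology_group p (top_of_set P) (facet_union F \<alpha>))"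

definition facet_sum_product ::
    "'a::euclidean_space set \<Rightarrow> nat \<Rightarrow> (nat \<Rightarrow> 'a set) \<Rightarrow> nat \<Rightarrow> nat \<Rightarrow>
     (nat set \<Rightarrow> ('a chain \<Rightarrow> int) set) \<Rightarrow> (nat set \<Rightarrow> ('a chain \<Rightarrow> int) set) \<Rightarrow>
     nat set \<Rightarrow> ('a chain \<Rightarrow> int) set" where
  "facet_sum_product P m F p q x y =
     (\<lambda>\<gamma>\<in>Pow {1..m}.
        finprod (relative_cohomology_group (p + q) (top_of_set P) (facet_union F \<gamma>))
          (\<lambda>(\<alpha>, \<beta>). cup_product p q (top_of_set P) (facet_union F \<alpha>) (facet_union F \<beta>) (x \<alpha>) (y \<beta>))
          {(\<alpha>, \<beta>). \<alpha> \<subseteq> {1..m} \<and> \<beta> \<subseteq> {1..m} \<and> \<alpha> \<union> \<beta> = \<gamma>})"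

definition facet_sum_unit ::
    "'a::euclidean_space set \<Rightarrow> nat \<Rightarrow> (nat \<Rightarrow> 'a set) \<Rightarrow> nat set \<Rightarrow> ('a chain \<Rightarrow> int) set" where
  "facet_sum_unit P m F =
     (\<lambda>\<alpha>\<in>Pow {1..m}. if \<alpha> = {} then cohomology_unit (top_of_set P)
        else \<one>\<^bsub>relative_cohomology_group 0 (top_of_set P) (facet_union F \<alpha>)\<^esub>)"

definition facet_sum_ring ::
    "'a::euclidean_space set \<Rightarrow> nat \<Rightarrow> (nat \<Rightarrow> 'a set) \<Rightarrow>
     (nat \<Rightarrow> nat set \<Rightarrow> ('a chain \<Rightarrow> int) set) ring" where
  "facet_sum_ring P m F =
     graded_sum_ring (facet_sum_group P m F) (facet_sum_product P m F) (facet_sum_unit P m F)"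

end

theory Submission
  imports Defs "HOL-Library.Function_Algebras"
begin

text \<open>
  The map \<open>z \<mapsto> (\<bar>z\<^sub>1\<bar>, \<dots>, \<bar>z\<^sub>m\<bar>)\<close> folds the real moment-angle complex onto its part \<open>Q\<close> in the
  nonnegative orthant, which is homotopy equivalent to \<open>P\<close> by maps and homotopies that carry the face
  \<open>{z\<^sub>i = 0}\<close> to \<open>F\<^sub>i\<close> and back.  A cochain on the simplices that lie in a single orthant is determined by its
  restrictions to the orthants, all of which are copies of \<open>Q\<close>; Moebius inversion over the sets of
  signs turns it into a family of cochains of \<open>Q\<close>, one for each \<open>\<alpha> \<subseteq> [m]\<close>, vanishing on the faces
  \<open>{z\<^sub>i = 0}\<close> with \<open>i \<in> \<alpha>\<close>.  This correspondence is multiplicative on the cochain level, because a product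
  of the terms for \<open>\<alpha>\<close> and \<open>\<beta>\<close> is extended by zero from where the coordinates in \<open>\<alpha> \<union> \<beta>\<close> are
  nonnegative.  Excision replaces small cochains by all cochains, and cochains vanishing on each \<open>F\<^sub>i\<close>
  with \<open>i \<in> \<alpha>\<close> by those vanishing on \<open>P\<^sub>\<alpha>\<close>.
\<close>

section \<open>Cochains as functions on simplices\<close>

text \<open>No cochain map used here leads directly from one side to the other. A singular simplex
  of the complex may cross coordinate hyperplanes, so splitting by orthants reaches only cochains on
  simplices inside one orthant; a product of cochains vanishing on \<open>A\<close> and on
  \<open>B\<close> need not vanish on the simplices of \<open>A \<union> B\<close>; and
  \<open>P\<close> matches \<open>Q\<close> only up to homotopy. The comparison is a zigzag of maps
  invertible in cohomology, carried as a relation between classes. Folding onto \<open>Q\<close> is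
  kept apart from the passage to \<open>P\<close> because only folding has exact inverses, orthant
  by orthant, which makes Moebius inversion an identity of cochains. The covers to be excised are
  closed, whereas subdivision makes simplices small for open covers; deformations pulling a
  neighbourhood of each piece into that piece bridge the gap. Cochains are integer functions on
  simplices, 0 off the simplices under consideration, so that they can be corrected simplex by
  simplex.\<close>

definition pairing :: "('b \<Rightarrow> int) \<Rightarrow> ('b \<Rightarrow>\<^sub>0 int) \<Rightarrow> int" where
  "pairing u c = (\<Sum>\<sigma>\<in>Poly_Mapping.keys c. Poly_Mapping.lookup c \<sigma> * u \<sigma>)"

lemma pairing_superset:
  assumes "finite S" "Poly_Mapping.keys c \<subseteq> S"
  shows "pairing u c = (\<Sum>\<sigma>\<in>S. Poly_Mapping.lookup c \<sigma> * u \<sigma>)"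
  unfolding pairing_def using assms
  by (intro sum.mono_neutral_left) (auto simp: in_keys_iff)

lemma pairing_0 [simp]: "pairing u 0 = 0"
  by (simp add: pairing_def)

lemma pairing_of [simp]: "pairing u (frag_of \<sigma>) = u \<sigma>"
  by (simp add: pairing_def)

lemma pairing_add: "pairing u (a + b) = pairing u a + pairing u b"
proof -
  let ?S = "Poly_Mapping.keys a \<union> Poly_Mapping.keys b"
  have "pairing u (a + b) = (\<Sum>\<sigma>\<in>?S. Poly_Mapping.lookup (a + b) \<sigma> * u \<sigma>)"
    by (rule pairing_superset) (use keys_add[of a b] in auto)
  also have "\<dots> = (\<Sum>\<sigma>\<in>?S. Poly_Mapping.lookup a \<sigma> * u \<sigma>) + (\<Sum>\<sigma>\<in>?S. Poly_Mapping.lookup b \<sigma> * u \<sigma>)"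
    by (simp add: lookup_add distrib_right sum.distrib)
  also have "\<dots> = pairing u a + pairing u b"
    using pairing_superset[of ?S a u] pairing_superset[of ?S b u] by simp
  finally show ?thesis .
qed

lemma pairing_diff: "pairing u (a - b) = pairing u a - pairing u b"
  using pairing_add[of u "a - b" b] by simp

lemma pairing_cmul: "pairing u (frag_cmul k c) = k * pairing u c"
proof -
  have "pairing u (frag_cmul k c) = (\<Sum>\<sigma>\<in>Poly_Mapping.keys c. Poly_Mapping.lookup (frag_cmul k c) \<sigma> * u \<sigma>)"
    by (rule pairing_superset) (auto simp: keys_cmul)
  then show ?thesis
    by (simp add: pairing_def sum_distrib_left mult.assoc)
qed

lemma pairing_sum: "pairing u (sum f I) = (\<Sum>i\<in>I. pairing u (f i))"
  by (induction I rule: infinite_finite_induct) (simp_all add: pairing_add)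

lemma pairing_plus_left [simp]: "pairing (u + v) c = pairing u c + pairing v c"
  by (simp add: pairing_def distrib_left sum.distrib)

lemma pairing_minus_left [simp]: "pairing (- u) c = - pairing u c"
  by (simp add: pairing_def sum_negf)

lemma pairing_diff_left [simp]: "pairing (u - v) c = pairing u c - pairing v c"
  by (simp add: pairing_def right_diff_distrib sum_subtractf)

lemma pairing_0_left [simp]: "pairing 0 c = 0"
  by (simp add: pairing_def)

lemma pairing_cong:
  "(\<And>\<sigma>. \<sigma> \<in> Poly_Mapping.keys c \<Longrightarrow> u \<sigma> = v \<sigma>) \<Longrightarrow> pairing u c = pairing v c"
  by (simp add: pairing_def)

lemma pairing_eq_0:
  "(\<And>\<sigma>. \<sigma> \<in> Poly_Mapping.keys c \<Longrightarrow> u \<sigma> = 0) \<Longrightarrow> pairing u c = 0"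
  by (simp add: pairing_def)

text \<open>Chains are generated by simplices under differences, so an additive chain operator
  \<open>f\<close> has a transpose on cochains that is read off from its values on simplices.
  Boundary, prism and subdivision operators act on cochains in this way.\<close>

lemma pairing_additive:
  assumes "f 0 = 0" "\<And>a b. f (a - b) = f a - f b"
  shows "pairing u (f c) = pairing (\<lambda>\<sigma>. pairing u (f (frag_of \<sigma>))) c"
proof -
  have "Poly_Mapping.keys c \<subseteq> UNIV" by simp
  then show ?thesis
    by (induction c rule: frag_induction) (simp_all add: assms pairing_diff)
qed

section \<open>Cochains on the simplices subordinate to a family of sets\<close>

definition small_simplices :: "'a topology \<Rightarrow> 'a set set \<Rightarrow> nat \<Rightarrow> ((nat \<Rightarrow> real) \<Rightarrow> 'a) set" where
  "small_simplices X \<U> p = {\<sigma>. singular_simplex p X \<sigma> \<and> (\<exists>A\<in>\<U>. \<sigma> ` standard_simplex p \<subseteq> A)}"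

lemma small_simplices_UNIV [simp]: "small_simplices X {UNIV} p = singular_simplex_set p X"
  by (auto simp: small_simplices_def)

lemma small_simplices_simplex: "\<sigma> \<in> small_simplices X \<U> p \<Longrightarrow> singular_simplex p X \<sigma>"
  by (simp add: small_simplices_def)

lemma small_simplices_empty: "small_simplices X {{}} p = {}"
  by (auto simp: small_simplices_def nonempty_standard_simplex)

lemma small_simplices_mono:
  assumes "\<And>A. A \<in> \<U> \<Longrightarrow> \<exists>B\<in>\<V>. A \<inter> topspace X \<subseteq> B"
  shows "small_simplices X \<U> p \<subseteq> small_simplices X \<V> p"
proof
  fix \<sigma> assume "\<sigma> \<in> small_simplices X \<U> p"
  then obtain A where s: "singular_simplex p X \<sigma>" and A: "A \<in> \<U>" "\<sigma> ` standard_simplex p \<subseteq> A"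
    by (auto simp: small_simplices_def)
  have "\<sigma> ` standard_simplex p \<subseteq> topspace X"
    using s by (auto simp: singular_simplex_def continuous_map_def)
  with assms[OF A(1)] A(2) s show "\<sigma> \<in> small_simplices X \<V> p"
    unfolding small_simplices_def by blast
qed

lemma singular_face_image:
  assumes "k \<le> Suc p"
  shows "singular_face (Suc p) k \<sigma> ` standard_simplex p \<subseteq> \<sigma> ` standard_simplex (Suc p)"
  using assms by (auto simp: singular_face_def simplical_face_in_standard_simplex)

lemma small_simplices_face:
  assumes "\<sigma> \<in> small_simplices X \<U> (Suc p)" "k \<le> Suc p"
  shows "singular_face (Suc p) k \<sigma> \<in> small_simplices X \<U> p"
  using assms singular_simplex_singular_face[of "Suc p" X \<sigma> k] singular_face_image[OF assms(2), of \<sigma>]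
  unfolding small_simplices_def by (auto simp del: image_subset_iff)

lemma keys_chain_boundary:
  "Poly_Mapping.keys (chain_boundary (Suc p) (frag_of \<sigma>)) \<subseteq> (\<lambda>k. singular_face (Suc p) k \<sigma>) ` {..Suc p}"
proof -
  have "Poly_Mapping.keys (chain_boundary (Suc p) (frag_of \<sigma>))
      \<subseteq> (\<Union>k\<in>{..Suc p}. Poly_Mapping.keys (frag_cmul ((-1) ^ k) (frag_of (singular_face (Suc p) k \<sigma>))))"
    using keys_sum by (simp add: chain_boundary_of del: sum.atMost_Suc)
  also have "\<dots> \<subseteq> (\<lambda>k. singular_face (Suc p) k \<sigma>) ` {..Suc p}"
    using keys_cmul by fastforce
  finally show ?thesis .
qed

lemma small_chain_boundary:
  assumes "\<sigma> \<in> small_simplices X \<U> (Suc p)"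
  shows "Poly_Mapping.keys (chain_boundary (Suc p) (frag_of \<sigma>)) \<subseteq> small_simplices X \<U> p"
  using keys_chain_boundary[of p \<sigma>] small_simplices_face[OF assms] by fastforce

text \<open>The families play two roles: \<U> selects the simplices on which a cochain lives, \<A>
  those on which it must vanish. \<open>{UNIV}\<close> selects all singular simplices and
  \<open>{{}}\<close> none, since the standard simplex is nonempty. Relative cochains of
  \<open>(X, A)\<close> have \<U> = \<open>{UNIV}\<close> and \<A> = \<open>{A}\<close>; cochains of
  a subspace \<open>U\<close> have \<U> = \<open>{U}\<close>. The prescribed zero off the selected
  simplices makes equality of cochains equality of functions.\<close>

definition scochains :: "nat \<Rightarrow> 'a topology \<Rightarrow> 'a set set \<Rightarrow> 'a set set \<Rightarrow> (((nat \<Rightarrow> real) \<Rightarrow> 'a) \<Rightarrow> int) set" where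
  "scochains p X \<U> \<A> = {u. \<forall>\<sigma>. \<sigma> \<notin> small_simplices X \<U> p \<or> \<sigma> \<in> small_simplices X \<A> p \<longrightarrow> u \<sigma> = 0}"

definition scoboundary ::
    "nat \<Rightarrow> 'a topology \<Rightarrow> 'a set set \<Rightarrow> (((nat \<Rightarrow> real) \<Rightarrow> 'a) \<Rightarrow> int) \<Rightarrow> ((nat \<Rightarrow> real) \<Rightarrow> 'a) \<Rightarrow> int" where
  "scoboundary p X \<U> u = (\<lambda>\<sigma>. if \<sigma> \<in> small_simplices X \<U> (Suc p)
      then pairing u (chain_boundary (Suc p) (frag_of \<sigma>)) else 0)"

definition scocycles :: "nat \<Rightarrow> 'a topology \<Rightarrow> 'a set set \<Rightarrow> 'a set set \<Rightarrow> (((nat \<Rightarrow> real) \<Rightarrow> 'a) \<Rightarrow> int) set" where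
  "scocycles p X \<U> \<A> = {u \<in> scochains p X \<U> \<A>. scoboundary p X \<U> u = 0}"

fun scoboundaries :: "nat \<Rightarrow> 'a topology \<Rightarrow> 'a set set \<Rightarrow> 'a set set \<Rightarrow> (((nat \<Rightarrow> real) \<Rightarrow> 'a) \<Rightarrow> int) set" where
  "scoboundaries 0 X \<U> \<A> = {0}"
| "scoboundaries (Suc p) X \<U> \<A> = scoboundary p X \<U> ` scochains p X \<U> \<A>"

lemma scochains_outside: "u \<in> scochains p X \<U> \<A> \<Longrightarrow> \<sigma> \<notin> small_simplices X \<U> p \<Longrightarrow> u \<sigma> = 0"
  by (auto simp: scochains_def)

lemma scochains_vanish: "u \<in> scochains p X \<U> \<A> \<Longrightarrow> \<sigma> \<in> small_simplices X \<A> p \<Longrightarrow> u \<sigma> = 0"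
  by (auto simp: scochains_def)

lemma scochains_0 [simp]: "0 \<in> scochains p X \<U> \<A>"
  by (simp add: scochains_def)

lemma scochains_add: "u \<in> scochains p X \<U> \<A> \<Longrightarrow> v \<in> scochains p X \<U> \<A> \<Longrightarrow> u + v \<in> scochains p X \<U> \<A>"
  by (simp add: scochains_def)

lemma scochains_diff: "u \<in> scochains p X \<U> \<A> \<Longrightarrow> v \<in> scochains p X \<U> \<A> \<Longrightarrow> u - v \<in> scochains p X \<U> \<A>"
  by (simp add: scochains_def)

lemma scochains_uminus: "u \<in> scochains p X \<U> \<A> \<Longrightarrow> - u \<in> scochains p X \<U> \<A>"
  by (simp add: scochains_def)

lemma scochains_sum: "(\<And>i. i \<in> I \<Longrightarrow> f i \<in> scochains p X \<U> \<A>) \<Longrightarrow> sum f I \<in> scochains p X \<U> \<A>"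
  by (induction I rule: infinite_finite_induct) (auto intro: scochains_add)

lemma scochains_antimono:
  assumes "\<And>A. A \<in> \<A> \<Longrightarrow> \<exists>B\<in>\<B>. A \<inter> topspace X \<subseteq> B"
  shows "scochains p X \<U> \<B> \<subseteq> scochains p X \<U> \<A>"
  using small_simplices_mono[of \<A> \<B> X p, OF assms] by (auto simp: scochains_def)

lemma scoboundary_add: "scoboundary p X \<U> (u + v) = scoboundary p X \<U> u + scoboundary p X \<U> v"
  by (auto simp: scoboundary_def)

lemma scoboundary_diff: "scoboundary p X \<U> (u - v) = scoboundary p X \<U> u - scoboundary p X \<U> v"
  by (auto simp: scoboundary_def)

lemma scoboundary_uminus: "scoboundary p X \<U> (- u) = - scoboundary p X \<U> u"
  by (auto simp: scoboundary_def)

lemma scoboundary_0 [simp]: "scoboundary p X \<U> 0 = 0"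
  by (auto simp: scoboundary_def)

lemma scoboundary_in_scochains:
  assumes "u \<in> scochains p X \<U> \<A>"
  shows "scoboundary p X \<U> u \<in> scochains (Suc p) X \<U> \<A>"
proof -
  have "pairing u (chain_boundary (Suc p) (frag_of \<sigma>)) = 0" if "\<sigma> \<in> small_simplices X \<A> (Suc p)" for \<sigma>
    using small_chain_boundary[OF that] scochains_vanish[OF assms] by (blast intro: pairing_eq_0)
  then show ?thesis
    by (auto simp: scochains_def scoboundary_def)
qed

lemma pairing_scoboundary:
  assumes "Poly_Mapping.keys c \<subseteq> small_simplices X \<U> (Suc p)"
  shows "pairing (scoboundary p X \<U> u) c = pairing u (chain_boundary (Suc p) c)"
proof -
  have "pairing u (chain_boundary (Suc p) c) = pairing (\<lambda>\<sigma>. pairing u (chain_boundary (Suc p) (frag_of \<sigma>))) c"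
    by (rule pairing_additive) (simp_all add: chain_boundary_diff)
  also have "\<dots> = pairing (scoboundary p X \<U> u) c"
    by (rule pairing_cong) (use assms in \<open>auto simp: scoboundary_def\<close>)
  finally show ?thesis ..
qed

lemma scoboundary_scoboundary [simp]: "scoboundary (Suc p) X \<U> (scoboundary p X \<U> u) = 0"
proof
  fix \<sigma>
  show "scoboundary (Suc p) X \<U> (scoboundary p X \<U> u) \<sigma> = (0 :: _ \<Rightarrow> int) \<sigma>"
  proof (cases "\<sigma> \<in> small_simplices X \<U> (Suc (Suc p))")
    case True
    then have "singular_chain (Suc (Suc p)) X (frag_of \<sigma>)"
      by (simp add: singular_chain_of small_simplices_simplex)
    from chain_boundary_boundary[OF this]
    show ?thesis using True
      by (simp add: scoboundary_def[of "Suc p"] pairing_scoboundary small_chain_boundary)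
  qed (simp add: scoboundary_def)
qed

lemma scocycles_0 [simp]: "0 \<in> scocycles p X \<U> \<A>"
  by (simp add: scocycles_def)

lemma scocycles_add: "u \<in> scocycles p X \<U> \<A> \<Longrightarrow> v \<in> scocycles p X \<U> \<A> \<Longrightarrow> u + v \<in> scocycles p X \<U> \<A>"
  by (simp add: scocycles_def scochains_add scoboundary_add)

lemma scocycles_diff: "u \<in> scocycles p X \<U> \<A> \<Longrightarrow> v \<in> scocycles p X \<U> \<A> \<Longrightarrow> u - v \<in> scocycles p X \<U> \<A>"
  by (simp add: scocycles_def scochains_diff scoboundary_diff)

lemma scocycles_uminus: "u \<in> scocycles p X \<U> \<A> \<Longrightarrow> - u \<in> scocycles p X \<U> \<A>"
  by (simp add: scocycles_def scochains_uminus scoboundary_uminus)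

lemma scocycles_sum: "(\<And>i. i \<in> I \<Longrightarrow> f i \<in> scocycles p X \<U> \<A>) \<Longrightarrow> sum f I \<in> scocycles p X \<U> \<A>"
  by (induction I rule: infinite_finite_induct) (auto intro: scocycles_add)

lemma scocycles_antimono:
  assumes "\<And>A. A \<in> \<A> \<Longrightarrow> \<exists>B\<in>\<B>. A \<inter> topspace X \<subseteq> B"
  shows "scocycles p X \<U> \<B> \<subseteq> scocycles p X \<U> \<A>"
  using scochains_antimono[of \<A> \<B> X p \<U>, OF assms] by (auto simp: scocycles_def)

lemma scoboundaries_antimono:
  assumes "\<And>A. A \<in> \<A> \<Longrightarrow> \<exists>B\<in>\<B>. A \<inter> topspace X \<subseteq> B"
  shows "scoboundaries p X \<U> \<B> \<subseteq> scoboundaries p X \<U> \<A>"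
  using scochains_antimono[of \<A> \<B> X _ \<U>, OF assms] by (cases p) auto

lemma scoboundaries_0 [simp]: "0 \<in> scoboundaries p X \<U> \<A>"
  by (cases p) (auto intro!: image_eqI[where x = 0])

lemma scoboundaries_add:
  "u \<in> scoboundaries p X \<U> \<A> \<Longrightarrow> v \<in> scoboundaries p X \<U> \<A> \<Longrightarrow> u + v \<in> scoboundaries p X \<U> \<A>"
  by (cases p) (auto simp flip: scoboundary_add intro!: imageI scochains_add)

lemma scoboundaries_diff:
  "u \<in> scoboundaries p X \<U> \<A> \<Longrightarrow> v \<in> scoboundaries p X \<U> \<A> \<Longrightarrow> u - v \<in> scoboundaries p X \<U> \<A>"
  by (cases p) (auto simp flip: scoboundary_diff intro!: imageI scochains_diff)

lemma scoboundaries_uminus: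
  "u \<in> scoboundaries p X \<U> \<A> \<Longrightarrow> - u \<in> scoboundaries p X \<U> \<A>"
  by (cases p) (auto simp flip: scoboundary_uminus intro!: imageI scochains_uminus)

lemma scoboundaries_sum:
  "(\<And>i. i \<in> I \<Longrightarrow> f i \<in> scoboundaries p X \<U> \<A>) \<Longrightarrow> sum f I \<in> scoboundaries p X \<U> \<A>"
  by (induction I rule: infinite_finite_induct) (auto intro: scoboundaries_add)

lemma scoboundaries_subset_scocycles: "scoboundaries p X \<U> \<A> \<subseteq> scocycles p X \<U> \<A>"
  by (cases p) (auto simp: scocycles_def scoboundary_in_scochains)

subsection \<open>Cup products\<close>

lemma front_face_self: "singular_simplex p X \<sigma> \<Longrightarrow> front_face p \<sigma> = \<sigma>"
  by (simp add: front_face_def singular_simplex_def extensional_restrict)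

lemma back_face_self: "singular_simplex p X \<sigma> \<Longrightarrow> back_face 0 p \<sigma> = \<sigma>"
  by (simp add: back_face_def singular_simplex_def extensional_restrict)

lemma shift_in_standard_simplex:
  assumes "x \<in> standard_simplex q"
  shows "(\<lambda>i. if i < p then 0 else x (i - p)) \<in> standard_simplex (p + q)"
proof -
  have "(\<Sum>i\<le>p + q. if i < p then 0 else x (i - p)) = (\<Sum>i\<in>{p..p+q}. x (i - p))"
    by (rule sum.mono_neutral_cong_right) auto
  also have "\<dots> = (\<Sum>i\<le>q. x i)"
    by (rule sum.reindex_bij_witness[of _ "\<lambda>i. i + p" "\<lambda>i. i - p"]) auto
  finally show ?thesis
    using assms by (auto simp: standard_simplex_def)
qed

lemma continuous_map_shift:
  "continuous_map (subtopology (powertop_real UNIV) (standard_simplex q))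
     (subtopology (powertop_real UNIV) (standard_simplex (p + q)))
     (\<lambda>x i. if i < p then 0 else x (i - p))"
proof -
  have "continuous_map (subtopology (powertop_real UNIV) (standard_simplex q)) euclideanreal
          (\<lambda>x. if i < p then 0 else x (i - p))" for i
    by (cases "i < p") (auto intro: continuous_map_from_subtopology continuous_map_product_projection)
  then show ?thesis
    by (auto simp: continuous_map_in_subtopology continuous_map_componentwise shift_in_standard_simplex
        intro: continuous_map_from_subtopology)
qed

lemma singular_simplex_back_face:
  assumes "singular_simplex (p + q) X \<sigma>"
  shows "singular_simplex q X (back_face p q \<sigma>)"
proof -
  have "continuous_map (subtopology (powertop_real UNIV) (standard_simplex q)) X
          (\<sigma> \<circ> (\<lambda>x i. if i < p then 0 else x (i - p)))"
    using continuous_map_compose[OF continuous_map_shift] assms singular_simplex_def by blast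
  then have "continuous_map (subtopology (powertop_real UNIV) (standard_simplex q)) X (back_face p q \<sigma>)"
    by (rule continuous_map_eq) (simp add: back_face_def)
  then show ?thesis
    by (simp add: singular_simplex_def back_face_def)
qed

lemma singular_simplex_front_face:
  assumes "singular_simplex (p + q) X \<sigma>"
  shows "singular_simplex p X (front_face p \<sigma>)"
proof -
  have "continuous_map (subtopology (powertop_real UNIV) (standard_simplex p)) X \<sigma>"
    using assms unfolding singular_simplex_def
    by (meson continuous_map_from_subtopology_mono le_add1 standard_simplex_mono)
  then have "continuous_map (subtopology (powertop_real UNIV) (standard_simplex p)) X (front_face p \<sigma>)"
    by (rule continuous_map_eq) (simp add: front_face_def)
  then show ?thesis
    by (simp add: singular_simplex_def front_face_def)
qed

lemma front_face_image: "front_face p \<sigma> ` standard_simplex p \<subseteq> \<sigma> ` standard_simplex (p + q)"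
  using standard_simplex_mono[of p "p + q"] by (auto simp: front_face_def)

lemma back_face_image: "back_face p q \<sigma> ` standard_simplex q \<subseteq> \<sigma> ` standard_simplex (p + q)"
  using shift_in_standard_simplex by (auto simp: back_face_def)

lemma small_front_face: "\<sigma> \<in> small_simplices X \<U> (p + q) \<Longrightarrow> front_face p \<sigma> \<in> small_simplices X \<U> p"
  using front_face_image[of p \<sigma> q] singular_simplex_front_face[of p q X \<sigma>]
  unfolding small_simplices_def by (auto simp del: image_subset_iff)

lemma small_back_face: "\<sigma> \<in> small_simplices X \<U> (p + q) \<Longrightarrow> back_face p q \<sigma> \<in> small_simplices X \<U> q"
  using back_face_image[of p q \<sigma>] singular_simplex_back_face[of p q X \<sigma>]
  unfolding small_simplices_def by (auto simp del: image_subset_iff)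

definition scup ::
    "nat \<Rightarrow> nat \<Rightarrow> 'a topology \<Rightarrow> 'a set set \<Rightarrow> (((nat \<Rightarrow> real) \<Rightarrow> 'a) \<Rightarrow> int) \<Rightarrow> (((nat \<Rightarrow> real) \<Rightarrow> 'a) \<Rightarrow> int) \<Rightarrow>
      ((nat \<Rightarrow> real) \<Rightarrow> 'a) \<Rightarrow> int" where
  "scup p q X \<U> u v = (\<lambda>\<sigma>. if \<sigma> \<in> small_simplices X \<U> (p + q)
      then u (front_face p \<sigma>) * v (back_face p q \<sigma>) else 0)"

lemma scup_add_left: "scup p q X \<U> (u + u') v = scup p q X \<U> u v + scup p q X \<U> u' v"
  by (auto simp: scup_def distrib_right)

lemma scup_add_right: "scup p q X \<U> u (v + v') = scup p q X \<U> u v + scup p q X \<U> u v'"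
  by (auto simp: scup_def distrib_left)

lemma scup_diff_left: "scup p q X \<U> (u - u') v = scup p q X \<U> u v - scup p q X \<U> u' v"
  by (auto simp: scup_def left_diff_distrib)

lemma scup_diff_right: "scup p q X \<U> u (v - v') = scup p q X \<U> u v - scup p q X \<U> u v'"
  by (auto simp: scup_def right_diff_distrib)

lemma scup_0_left [simp]: "scup p q X \<U> 0 v = 0"
  by (auto simp: scup_def)

lemma scup_0_right [simp]: "scup p q X \<U> u 0 = 0"
  by (auto simp: scup_def)

text \<open>The front and back face of a simplex lie in the same member of the family as the
  simplex, so one factor is zero. Only the family \<open>\<A> \<union> \<B>\<close> is reached: a
  simplex inside the union of a member of \<A> and one of \<B> may lie in neither, which is why
  products into the cohomology relative to a union require excision.\<close>

lemma scup_in_scochains: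
  assumes u: "u \<in> scochains p X \<U> \<A>" and v: "v \<in> scochains q X \<U> \<B>"
  shows "scup p q X \<U> u v \<in> scochains (p + q) X \<U> (\<A> \<union> \<B>)"
proof -
  have "u (front_face p \<sigma>) * v (back_face p q \<sigma>) = 0" if "\<sigma> \<in> small_simplices X (\<A> \<union> \<B>) (p + q)" for \<sigma>
  proof -
    have "\<sigma> \<in> small_simplices X \<A> (p + q) \<or> \<sigma> \<in> small_simplices X \<B> (p + q)"
      using that by (auto simp: small_simplices_def)
    then consider "\<sigma> \<in> small_simplices X \<A> (p + q)" | "\<sigma> \<in> small_simplices X \<B> (p + q)"
      by blast
    then show ?thesis
    proof cases
      case 1
      then show ?thesis
        by (simp add: scochains_vanish[OF u small_front_face])
    next
      case 2
      then show ?thesis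
        by (simp add: scochains_vanish[OF v small_back_face])
    qed
  qed
  then show ?thesis
    by (auto simp: scochains_def scup_def)
qed

text \<open>Deleting vertex \<open>k\<close> affects the front or the back part according to the
  position of \<open>k\<close> relative to the cut at vertex \<open>p\<close>. This and the next
  three facts are the cases; for the back face, index \<open>p\<close> falls under two of them, and
  that coincidence supplies a cancelling term in the Leibniz rule.\<close>

lemma front_face_face_le:
  assumes "k \<le> p"
  shows "front_face p (singular_face (Suc (p + q)) k \<sigma>) = singular_face (Suc p) k (front_face (Suc p) \<sigma>)"
proof
  fix x
  have "x \<in> standard_simplex (p + q)" if "x \<in> standard_simplex p"
    using that standard_simplex_mono[of p "p + q"] by auto
  then show "front_face p (singular_face (Suc (p + q)) k \<sigma>) x = singular_face (Suc p) k (front_face (Suc p) \<sigma>) x"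
    using assms by (simp add: front_face_def singular_face_def simplical_face_in_standard_simplex)
qed

lemma front_face_face_gt:
  assumes "p < k"
  shows "front_face p (singular_face (Suc (p + q)) k \<sigma>) = front_face p \<sigma>"
proof
  fix x
  show "front_face p (singular_face (Suc (p + q)) k \<sigma>) x = front_face p \<sigma> x"
  proof (cases "x \<in> standard_simplex p")
    case True
    then have "x \<in> standard_simplex (p + q)"
      using standard_simplex_mono[of p "p + q"] by auto
    moreover have "simplical_face k x = x"
      using True assms by (auto simp: simplical_face_def standard_simplex_def)
    ultimately show ?thesis
      using True by (simp add: front_face_def singular_face_def)
  qed (simp add: front_face_def)
qed

lemma back_face_face_le:
  assumes "k \<le> p"
  shows "back_face p q (singular_face (Suc (p + q)) k \<sigma>) = back_face (Suc p) q \<sigma>"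
proof
  fix x
  show "back_face p q (singular_face (Suc (p + q)) k \<sigma>) x = back_face (Suc p) q \<sigma> x"
  proof (cases "x \<in> standard_simplex q")
    case True
    moreover have "simplical_face k (\<lambda>i. if i < p then 0 else x (i - p)) = (\<lambda>i. if i < Suc p then 0 else x (i - Suc p))"
      using assms by (fastforce simp: simplical_face_def fun_eq_iff)
    ultimately show ?thesis
      using shift_in_standard_simplex[OF True, of p]
      by (simp add: back_face_def singular_face_def)
  qed (simp add: back_face_def)
qed

lemma back_face_face_ge:
  assumes "k \<le> Suc q"
  shows "back_face p q (singular_face (Suc (p + q)) (p + k) \<sigma>) = singular_face (Suc q) k (back_face p (Suc q) \<sigma>)"
proof
  fix x
  show "back_face p q (singular_face (Suc (p + q)) (p + k) \<sigma>) x = singular_face (Suc q) k (back_face p (Suc q) \<sigma>) x"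
  proof (cases "x \<in> standard_simplex q")
    case True
    moreover have "simplical_face (p + k) (\<lambda>i. if i < p then 0 else x (i - p))
        = (\<lambda>i. if i < p then 0 else simplical_face k x (i - p))"
      by (auto simp: simplical_face_def fun_eq_iff intro: arg_cong[where f = x])
    moreover have "simplical_face k x \<in> standard_simplex (Suc q)"
      using assms True by (simp add: simplical_face_in_standard_simplex)
    ultimately show ?thesis
      using shift_in_standard_simplex[OF True, of p]
      by (simp add: back_face_def singular_face_def)
  qed (simp add: back_face_def singular_face_def)
qed

lemma scoboundary_face_sum:
  assumes "\<sigma> \<in> small_simplices X \<U> (Suc p)"
  shows "scoboundary p X \<U> u \<sigma> = (\<Sum>k\<le>Suc p. (-1) ^ k * u (singular_face (Suc p) k \<sigma>))"
  using assms by (simp add: scoboundary_def chain_boundary_of pairing_sum pairing_cmul del: sum.atMost_Suc)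

lemma face_last: "singular_face (Suc p) (Suc p) (front_face (Suc p) \<sigma>) = front_face p \<sigma>"
proof
  fix x
  show "singular_face (Suc p) (Suc p) (front_face (Suc p) \<sigma>) x = front_face p \<sigma> x"
  proof (cases "x \<in> standard_simplex p")
    case True
    then have "x \<in> standard_simplex (Suc p)"
      using standard_simplex_mono[of p "Suc p"] by auto
    moreover have "simplical_face (Suc p) x = x"
      using True by (auto simp: simplical_face_def standard_simplex_def)
    ultimately show ?thesis
      using True by (simp add: front_face_def singular_face_def)
  qed (simp add: front_face_def singular_face_def)
qed

text \<open>The Leibniz rule. Among the faces of \<sigma>, those of index at most \<open>p\<close>
  belong to the first product, the others to the second. Each product has one surplus term: the last
  face of the front part and the zeroth face of the back part both give \<open>?g\<close>, with
  opposite signs.\<close>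

lemma scoboundary_scup:
  "scoboundary (p + q) X \<U> (scup p q X \<U> u v) =
     scup (Suc p) q X \<U> (scoboundary p X \<U> u) v
     + (\<lambda>\<sigma>. (-1) ^ p * scup p (Suc q) X \<U> u (scoboundary q X \<U> v) \<sigma>)"
proof
  fix \<sigma>
  show "scoboundary (p + q) X \<U> (scup p q X \<U> u v) \<sigma> =
     (scup (Suc p) q X \<U> (scoboundary p X \<U> u) v
     + (\<lambda>\<sigma>. (-1) ^ p * scup p (Suc q) X \<U> u (scoboundary q X \<U> v) \<sigma>)) \<sigma>"
  proof (cases "\<sigma> \<in> small_simplices X \<U> (Suc (p + q))")
    case True
    let ?d = "\<lambda>k. singular_face (Suc (p + q)) k \<sigma>"
    let ?f = "\<lambda>k. (-1) ^ k * (u (front_face p (?d k)) * v (back_face p q (?d k)))"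
    let ?g = "u (front_face p \<sigma>) * v (back_face (Suc p) q \<sigma>)"
    have "front_face (Suc p) \<sigma> \<in> small_simplices X \<U> (Suc p)"
      using True small_front_face[of \<sigma> X \<U> "Suc p" q] by simp
    then have "scoboundary p X \<U> u (front_face (Suc p) \<sigma>)
        = (\<Sum>k\<le>p. (-1) ^ k * u (front_face p (?d k))) - (-1) ^ p * u (front_face p \<sigma>)"
      by (simp add: scoboundary_face_sum front_face_face_le face_last)
    then have 1: "scoboundary p X \<U> u (front_face (Suc p) \<sigma>) * v (back_face (Suc p) q \<sigma>)
        = (\<Sum>k\<le>p. ?f k) - (-1) ^ p * ?g"
      by (simp add: back_face_face_le sum_distrib_right left_diff_distrib mult.assoc)
    have "back_face p (Suc q) \<sigma> \<in> small_simplices X \<U> (Suc q)"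
      using True small_back_face[of \<sigma> X \<U> p "Suc q"] by simp
    then have "scoboundary q X \<U> v (back_face p (Suc q) \<sigma>)
        = (\<Sum>k\<le>Suc q. (-1) ^ k * v (back_face p q (?d (p + k))))"
      by (simp add: scoboundary_face_sum back_face_face_ge del: sum.atMost_Suc)
    \<comment> \<open>The term of index 0 is the surplus one: removing vertex \<open>p\<close> from
      \<sigma> leaves the back face that starts at vertex \<open>Suc p\<close>.\<close>
    also have "\<dots> = v (back_face (Suc p) q \<sigma>) + (\<Sum>k\<in>{1..Suc q}. (-1) ^ k * v (back_face p q (?d (p + k))))"
      by (simp add: atMost_atLeast0 sum.atLeast_Suc_atMost back_face_face_le del: sum.cl_ivl_Suc)
    finally have "(-1) ^ p * (u (front_face p \<sigma>) * scoboundary q X \<U> v (back_face p (Suc q) \<sigma>))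
        = (-1) ^ p * ?g + (\<Sum>k\<in>{1..Suc q}. ?f (p + k))"
      by (simp add: distrib_left sum_distrib_left front_face_face_gt power_add mult.assoc mult.left_commute
          del: sum.cl_ivl_Suc)
    also have "(\<Sum>k\<in>{1..Suc q}. ?f (p + k)) = (\<Sum>k\<in>{Suc p..Suc (p + q)}. ?f k)"
      by (rule sum.reindex_bij_witness[of _ "\<lambda>k. k - p" "\<lambda>k. p + k"]) auto
    finally have 2: "(-1) ^ p * (u (front_face p \<sigma>) * scoboundary q X \<U> v (back_face p (Suc q) \<sigma>))
        = (-1) ^ p * ?g + (\<Sum>k\<in>{Suc p..Suc (p + q)}. ?f k)" .
    have "{..Suc (p + q)} = {..p} \<union> {Suc p..Suc (p + q)}" by auto
    then have "(\<Sum>k\<le>Suc (p + q). ?f k) = (\<Sum>k\<le>p. ?f k) + (\<Sum>k\<in>{Suc p..Suc (p + q)}. ?f k)"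
      by (simp only:) (rule sum.union_disjoint, auto)
    moreover have "scoboundary (p + q) X \<U> (scup p q X \<U> u v) \<sigma> = (\<Sum>k\<le>Suc (p + q). ?f k)"
      using True by (simp add: scoboundary_face_sum scup_def small_simplices_face del: sum.atMost_Suc)
    ultimately show ?thesis
      using True 1 2 by (simp add: scup_def)
  qed (simp add: scoboundary_def scup_def)
qed

text \<open>Associativity is strict on cochains: both sides evaluate \<open>u\<close>,
  \<open>v\<close>, \<open>w\<close> on the three consecutive blocks of vertices of \<sigma>, cut at
  \<open>p\<close> and at \<open>p + q\<close>.\<close>

lemma scup_assoc:
  fixes X :: "'a topology"
  shows
  "scup (p + q) r X \<U> (scup p q X \<U> u v) w = scup p (q + r) X \<U> u (scup q r X \<U> v w)"
proof
  fix \<sigma> :: "(nat \<Rightarrow> real) \<Rightarrow> 'a"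
  have 1: "front_face p (front_face (p + q) \<sigma>) = front_face p \<sigma>"
    using standard_simplex_mono[of p "p + q"] by (auto simp: front_face_def fun_eq_iff)
  have 2: "back_face p q (front_face (p + q) \<sigma>) = front_face q (back_face p (q + r) \<sigma>)"
    using standard_simplex_mono[of q "q + r"] shift_in_standard_simplex
    by (auto simp: front_face_def back_face_def fun_eq_iff)
  have 3: "back_face (p + q) r \<sigma> = back_face q r (back_face p (q + r) \<sigma>)"
  proof
    fix x :: "nat \<Rightarrow> real"
    have "(\<lambda>i. if i < p + q then 0 else x (i - (p + q)))
        = (\<lambda>i. if i < p then 0 else if i - p < q then 0 else x (i - p - q))"
      by (auto simp: fun_eq_iff)
    then show "back_face (p + q) r \<sigma> x = back_face q r (back_face p (q + r) \<sigma>) x"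
      using shift_in_standard_simplex[of x r q] by (auto simp: back_face_def)
  qed
  show "scup (p + q) r X \<U> (scup p q X \<U> u v) w \<sigma> = scup p (q + r) X \<U> u (scup q r X \<U> v w) \<sigma>"
  proof (cases "\<sigma> \<in> small_simplices X \<U> (p + q + r)")
    case True
    moreover from True have "front_face (p + q) \<sigma> \<in> small_simplices X \<U> (p + q)"
      using small_front_face by blast
    moreover from True have "back_face p (q + r) \<sigma> \<in> small_simplices X \<U> (q + r)"
      using small_back_face[of \<sigma> X \<U> p "q + r"] by (simp add: add.assoc)
    ultimately show ?thesis
      by (simp add: scup_def 1 2 3 add.assoc)
  qed (simp add: scup_def add.assoc)
qed

definition sunit :: "'a topology \<Rightarrow> 'a set set \<Rightarrow> ((nat \<Rightarrow> real) \<Rightarrow> 'a) \<Rightarrow> int" where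
  "sunit X \<U> = (\<lambda>\<sigma>. if \<sigma> \<in> small_simplices X \<U> 0 then 1 else 0)"

lemma scup_unit_left: "v \<in> scochains q X \<U> \<A> \<Longrightarrow> scup 0 q X \<U> (sunit X \<U>) v = v"
  using small_front_face[of _ X \<U> 0 q]
  by (auto simp: scup_def sunit_def fun_eq_iff back_face_self[OF small_simplices_simplex] scochains_outside)

lemma scup_unit_right: "u \<in> scochains p X \<U> \<A> \<Longrightarrow> scup p 0 X \<U> u (sunit X \<U>) = u"
  using small_back_face[of _ X \<U> p 0]
  by (auto simp: scup_def sunit_def fun_eq_iff front_face_self[OF small_simplices_simplex] scochains_outside)

lemma sunit_in_scocycles: "sunit X \<U> \<in> scocycles 0 X \<U> {{}}"
proof -
  have "scoboundary 0 X \<U> (sunit X \<U>) \<sigma> = 0" for \<sigma>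
  proof (cases "\<sigma> \<in> small_simplices X \<U> (Suc 0)")
    case True
    with small_simplices_face[OF True] show ?thesis
      by (simp add: scoboundary_face_sum sunit_def)
  qed (simp add: scoboundary_def)
  then show ?thesis
    by (auto simp: scocycles_def scochains_def sunit_def small_simplices_empty)
qed

lemma scup_in_scocycles:
  assumes u: "u \<in> scocycles p X \<U> \<A>" and v: "v \<in> scocycles q X \<U> \<B>"
  shows "scup p q X \<U> u v \<in> scocycles (p + q) X \<U> (\<A> \<union> \<B>)"
  using assms scup_in_scochains[of u p X \<U> \<A> v q \<B>]
  by (simp add: scocycles_def scoboundary_scup) (simp add: fun_eq_iff)

lemma scup_scoboundaries_left:
  assumes u: "u \<in> scoboundaries p X \<U> \<A>" and v: "v \<in> scocycles q X \<U> \<B>"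
  shows "scup p q X \<U> u v \<in> scoboundaries (p + q) X \<U> (\<A> \<union> \<B>)"
proof (cases p)
  case (Suc p')
  with u obtain a where a: "a \<in> scochains p' X \<U> \<A>" "u = scoboundary p' X \<U> a" by auto
  have "scoboundary (p' + q) X \<U> (scup p' q X \<U> a v) = scup p q X \<U> u v"
    using v a Suc by (simp add: scoboundary_scup scocycles_def) (simp add: fun_eq_iff)
  then show ?thesis
    using Suc v a(1) scup_in_scochains[of a p' X \<U> \<A> v q \<B>] by (force simp: scocycles_def)
qed (use u in simp)

lemma scup_scoboundaries_right:
  assumes u: "u \<in> scocycles p X \<U> \<A>" and v: "v \<in> scoboundaries q X \<U> \<B>"
  shows "scup p q X \<U> u v \<in> scoboundaries (p + q) X \<U> (\<A> \<union> \<B>)"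
proof (cases q)
  case (Suc q')
  with v obtain b where b: "b \<in> scochains q' X \<U> \<B>" "v = scoboundary q' X \<U> b" by auto
  have c: "scup p q' X \<U> u b \<in> scochains (p + q') X \<U> (\<A> \<union> \<B>)"
    using u b by (auto simp: scocycles_def intro: scup_in_scochains)
  have "scoboundary (p + q') X \<U> (scup p q' X \<U> u b) = (\<lambda>\<sigma>. (-1) ^ p * scup p q X \<U> u v \<sigma>)"
    using u b Suc by (simp add: scoboundary_scup scocycles_def)
  then have "scup p q X \<U> u v = (if even p then scoboundary (p + q') X \<U> (scup p q' X \<U> u b)
      else - scoboundary (p + q') X \<U> (scup p q' X \<U> u b))"
    by (auto simp: fun_eq_iff)
  then show ?thesis
    using Suc c by (auto simp flip: scoboundary_uminus intro!: imageI scochains_uminus)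
qed (use v in simp)

lemma scup_cohomologous:
  assumes "u \<in> scocycles p X \<U> \<A>" "u' - u \<in> scoboundaries p X \<U> \<A>"
    and "v \<in> scocycles q X \<U> \<B>" "v' - v \<in> scoboundaries q X \<U> \<B>"
  shows "scup p q X \<U> u' v' - scup p q X \<U> u v \<in> scoboundaries (p + q) X \<U> (\<A> \<union> \<B>)"
proof -
  have "v + (v' - v) \<in> scocycles q X \<U> \<B>"
    using assms(3,4) by (intro scocycles_add) (auto intro: subsetD[OF scoboundaries_subset_scocycles])
  then have "v' \<in> scocycles q X \<U> \<B>" by simp
  then have "scup p q X \<U> (u' - u) v' + scup p q X \<U> u (v' - v) \<in> scoboundaries (p + q) X \<U> (\<A> \<union> \<B>)"
    using assms by (intro scoboundaries_add scup_scoboundaries_left scup_scoboundaries_right)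
  then show ?thesis
    by (simp add: scup_diff_left scup_diff_right)
qed

section \<open>Cohomology classes of simplex cochains\<close>

definition eval_cochain ::
    "nat \<Rightarrow> 'a topology \<Rightarrow> (((nat \<Rightarrow> real) \<Rightarrow> 'a) \<Rightarrow> int) \<Rightarrow> 'a chain \<Rightarrow> int" where
  "eval_cochain p X u = (\<lambda>c\<in>singular_chain_set p X. pairing u c)"

lemma eval_cochain_in_cochains:
  assumes "u \<in> scochains p X {UNIV} \<A>"
  shows "eval_cochain p X u \<in> cochains p X \<A>"
proof -
  have "eval_cochain p X u \<in> hom (chain_group p X) integer_group"
    by (rule homI) (auto simp: eval_cochain_def pairing_add singular_chain_add)
  moreover have "eval_cochain p X u c = 0"
    if "S \<in> \<A>" "singular_chain p (subtopology X S) c" for S c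
  proof -
    have "u \<sigma> = 0" if "\<sigma> \<in> Poly_Mapping.keys c" for \<sigma>
      using \<open>S \<in> \<A>\<close> \<open>singular_chain p (subtopology X S) c\<close> that
      by (intro scochains_vanish[OF assms])
         (auto simp: small_simplices_def singular_chain_def singular_simplex_subtopology subset_eq)
    moreover have "singular_chain p X c"
      using that singular_chain_subtopology by blast
    ultimately show ?thesis
      by (auto simp: eval_cochain_def intro: pairing_eq_0)
  qed
  ultimately show ?thesis
    by (auto simp: cochains_def eval_cochain_def)
qed

lemma cochains_eval_cochain:
  assumes "\<phi> \<in> cochains p X \<A>"
  obtains u where "u \<in> scochains p X {UNIV} \<A>" "\<phi> = eval_cochain p X u"
proof
  define u where "u = (\<lambda>\<sigma>. if singular_simplex p X \<sigma> then \<phi> (frag_of \<sigma>) else 0)"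
  have hom: "\<phi> \<in> hom (chain_group p X) integer_group" and ext: "\<phi> \<in> extensional (singular_chain_set p X)"
    and van: "\<And>S c. S \<in> \<A> \<Longrightarrow> singular_chain p (subtopology X S) c \<Longrightarrow> \<phi> c = 0"
    using assms by (auto simp: cochains_def)
  have add: "\<phi> (a + b) = \<phi> a + \<phi> b" if "singular_chain p X a" "singular_chain p X b" for a b
    using hom_mult[OF hom, of a b] that by simp
  have zero: "\<phi> 0 = 0"
    using add[of 0 0] by simp
  have diff: "\<phi> (a - b) = \<phi> a - \<phi> b" if "singular_chain p X a" "singular_chain p X b" for a b
    using add[of "a - b" b] that singular_chain_diff[OF that] by simp
  have "\<phi> c = pairing u c" if "singular_chain p X c" for c
  proof -
    have "Poly_Mapping.keys c \<subseteq> {\<sigma>. singular_simplex p X \<sigma>}"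
      using that by (simp add: singular_chain_def)
    then have "singular_chain p X c \<and> \<phi> c = pairing u c"
      by (induction c rule: frag_induction)
        (auto simp: zero diff pairing_diff u_def singular_chain_of singular_chain_diff)
    then show ?thesis ..
  qed
  then show "\<phi> = eval_cochain p X u"
    using ext by (auto simp: eval_cochain_def extensional_def fun_eq_iff)
  show "u \<in> scochains p X {UNIV} \<A>"
    using van by (auto simp: scochains_def u_def small_simplices_def singular_chain_of singular_simplex_subtopology
        simp del: image_subset_iff)
qed

text \<open>Values on single simplices recover the function there, and both functions are 0 off the
  singular simplices. The vanishing families may differ, which allows cochains relative to different
  subsets to be compared.\<close>

lemma eval_cochain_inj:
  assumes "eval_cochain p X u = eval_cochain p X v"
    and "u \<in> scochains p X {UNIV} \<A>" "v \<in> scochains p X {UNIV} \<B>"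
  shows "u = v"
proof
  fix \<sigma>
  show "u \<sigma> = v \<sigma>"
  proof (cases "singular_simplex p X \<sigma>")
    case True
    then show ?thesis
      using fun_cong[OF assms(1), of "frag_of \<sigma>"] by (simp add: eval_cochain_def singular_chain_of)
  next
    case False
    then show ?thesis
      using assms(2,3) by (simp add: scochains_outside)
  qed
qed

lemma coboundary_eval_cochain:
  "coboundary p X (eval_cochain p X u) = eval_cochain (Suc p) X (scoboundary p X {UNIV} u)"
  by (auto simp: coboundary_def eval_cochain_def pairing_scoboundary singular_chain_def
      singular_chain_boundary_alt[unfolded singular_chain_def] fun_eq_iff)

lemma eval_cochain_mult:
  "eval_cochain p X u \<otimes>\<^bsub>cochain_group p X \<A>\<^esub> eval_cochain p X v = eval_cochain p X (u + v)"
  by (auto simp: cochain_group_def eval_cochain_def)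

lemma one_cochain_group: "\<one>\<^bsub>cochain_group p X \<A>\<^esub> = eval_cochain p X 0"
  by (auto simp: cochain_group_def eval_cochain_def)

lemma cocycles_eq: "cocycles p X \<A> = eval_cochain p X ` scocycles p X {UNIV} \<A>"
proof (intro equalityI subsetI)
  fix \<phi> assume "\<phi> \<in> cocycles p X \<A>"
  then have \<phi>: "\<phi> \<in> cochains p X \<A>" "coboundary p X \<phi> = eval_cochain (Suc p) X 0"
    by (auto simp: cocycles_def one_cochain_group)
  from \<phi>(1) obtain u where u: "u \<in> scochains p X {UNIV} \<A>" "\<phi> = eval_cochain p X u"
    by (rule cochains_eval_cochain)
  have "scoboundary p X {UNIV} u = 0"
    using \<phi>(2) u scoboundary_in_scochains[OF u(1)] scochains_0
    by (intro eval_cochain_inj) (auto simp: coboundary_eval_cochain)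
  then show "\<phi> \<in> eval_cochain p X ` scocycles p X {UNIV} \<A>"
    using u by (auto simp: scocycles_def)
next
  fix \<phi> assume "\<phi> \<in> eval_cochain p X ` scocycles p X {UNIV} \<A>"
  then show "\<phi> \<in> cocycles p X \<A>"
    by (auto simp: cocycles_def scocycles_def one_cochain_group coboundary_eval_cochain eval_cochain_in_cochains)
qed

lemma coboundaries_eq: "coboundaries p X \<A> = eval_cochain p X ` scoboundaries p X {UNIV} \<A>"
proof (cases p)
  case (Suc q)
  have "cochains q X \<A> = eval_cochain q X ` scochains q X {UNIV} \<A>"
    by (auto intro: eval_cochain_in_cochains elim: cochains_eval_cochain)
  then show ?thesis
    using Suc by (simp add: image_image coboundary_eval_cochain)
qed (simp add: one_cochain_group)

definition cohomology_class ::
    "nat \<Rightarrow> 'a topology \<Rightarrow> 'a set set \<Rightarrow> (((nat \<Rightarrow> real) \<Rightarrow> 'a) \<Rightarrow> int) \<Rightarrow> ('a chain \<Rightarrow> int) set" where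
  "cohomology_class p X \<A> u = (\<lambda>w. eval_cochain p X (u + w)) ` scoboundaries p X {UNIV} \<A>"

lemma coset_eq_cohomology_class:
  "coboundaries p X \<A> #>\<^bsub>cochain_group p X \<B>\<^esub> eval_cochain p X u = cohomology_class p X \<A> u"
  by (auto simp: r_coset_def coboundaries_eq eval_cochain_mult cohomology_class_def add.commute)

lemma carrier_cohomology_group:
  "carrier (cohomology_group p X \<A>) = cohomology_class p X \<A> ` scocycles p X {UNIV} \<A>"
proof -
  have "carrier (cohomology_group p X \<A>)
      = (\<Union>a\<in>cocycles p X \<A>. {coboundaries p X \<A> #>\<^bsub>cochain_group p X \<A>\<^esub> a})"
    by (simp add: cohomology_group_def FactGroup_def RCOSETS_def r_coset_def)
  then show ?thesis
    by (auto simp: cocycles_eq coset_eq_cohomology_class)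
qed

lemma one_cohomology_group: "\<one>\<^bsub>cohomology_group p X \<A>\<^esub> = cohomology_class p X \<A> 0"
  by (simp add: cohomology_group_def FactGroup_def cohomology_class_def coboundaries_eq)

lemma mult_cohomology_class:
  "cohomology_class p X \<A> u \<otimes>\<^bsub>cohomology_group p X \<A>\<^esub> cohomology_class p X \<A> v
     = cohomology_class p X \<A> (u + v)"
proof -
  have "cohomology_class p X \<A> u \<otimes>\<^bsub>cohomology_group p X \<A>\<^esub> cohomology_class p X \<A> v
      = (\<Union>w\<in>scoboundaries p X {UNIV} \<A>. \<Union>w'\<in>scoboundaries p X {UNIV} \<A>. {eval_cochain p X (u + w + (v + w'))})"
    unfolding cohomology_group_def FactGroup_def set_mult_def cohomology_class_def
    by (simp add: eval_cochain_mult)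
  also have "\<dots> = (\<Union>w\<in>scoboundaries p X {UNIV} \<A>. {eval_cochain p X (u + v + w)})"
  proof (intro equalityI subsetI)
    fix \<phi> assume "\<phi> \<in> (\<Union>w\<in>scoboundaries p X {UNIV} \<A>. \<Union>w'\<in>scoboundaries p X {UNIV} \<A>. {eval_cochain p X (u + w + (v + w'))})"
    then obtain w w' where w: "w \<in> scoboundaries p X {UNIV} \<A>" "w' \<in> scoboundaries p X {UNIV} \<A>"
      "\<phi> = eval_cochain p X (u + w + (v + w'))" by blast
    then have "\<phi> = eval_cochain p X (u + v + (w + w'))" by (simp add: ac_simps)
    then show "\<phi> \<in> (\<Union>w\<in>scoboundaries p X {UNIV} \<A>. {eval_cochain p X (u + v + w)})"
      by (intro UN_I[OF scoboundaries_add[OF w(1,2)]]) simp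
  next
    fix \<phi> assume "\<phi> \<in> (\<Union>w\<in>scoboundaries p X {UNIV} \<A>. {eval_cochain p X (u + v + w)})"
    then obtain w where w: "w \<in> scoboundaries p X {UNIV} \<A>" "\<phi> = eval_cochain p X (u + v + w)"
      by blast
    then have "\<phi> = eval_cochain p X (u + w + (v + 0))" by (simp add: ac_simps)
    then show "\<phi> \<in> (\<Union>w\<in>scoboundaries p X {UNIV} \<A>. \<Union>w'\<in>scoboundaries p X {UNIV} \<A>. {eval_cochain p X (u + w + (v + w'))})"
      by (intro UN_I[OF w(1)] UN_I[OF scoboundaries_0]) simp
  qed
  finally show ?thesis
    unfolding cohomology_class_def by blast
qed

lemma cohomology_class_self: "eval_cochain p X u \<in> cohomology_class p X \<A> u"
  unfolding cohomology_class_def by (rule image_eqI[where x = 0]) simp_all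

lemma in_cohomology_classE:
  assumes "\<phi> \<in> cohomology_class p X \<A> u" "u \<in> scocycles p X {UNIV} \<A>"
  obtains u' where "u' \<in> scocycles p X {UNIV} \<A>" "u' - u \<in> scoboundaries p X {UNIV} \<A>" "\<phi> = eval_cochain p X u'"
proof -
  from assms obtain w where w: "w \<in> scoboundaries p X {UNIV} \<A>" "\<phi> = eval_cochain p X (u + w)"
    by (auto simp: cohomology_class_def)
  then have "u + w \<in> scocycles p X {UNIV} \<A>"
    using assms(2) scoboundaries_subset_scocycles by (blast intro: scocycles_add)
  with w that[of "u + w"] show thesis by simp
qed

text \<open>The family \<B> of \<open>u'\<close> is free: what matters is vanishing off the singular
  simplices, so that \<open>eval_cochain\<close> can be cancelled. For cup products
  \<open>u'\<close> vanishes on a union and \<open>u\<close> only on its two parts.\<close>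

lemma cohomology_class_memD:
  assumes "eval_cochain p X u' \<in> cohomology_class p X \<A> u"
    and "u \<in> scocycles p X {UNIV} \<A>" "u' \<in> scocycles p X {UNIV} \<B>"
  shows "u' - u \<in> scoboundaries p X {UNIV} \<A>"
proof -
  obtain w where w: "w \<in> scocycles p X {UNIV} \<A>" "w - u \<in> scoboundaries p X {UNIV} \<A>"
      "eval_cochain p X u' = eval_cochain p X w"
    using in_cohomology_classE[OF assms(1,2)] by blast
  moreover have "u' = w"
    using w assms(3) by (intro eval_cochain_inj[OF w(3), of \<B> \<A>]) (auto simp: scocycles_def)
  ultimately show ?thesis by simp
qed

lemma cohomology_class_memI:
  assumes "u' - u \<in> scoboundaries p X {UNIV} \<A>"
  shows "eval_cochain p X u' \<in> cohomology_class p X \<A> u"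
  unfolding cohomology_class_def using assms by (intro image_eqI[where x = "u' - u"]) simp_all

lemma cohomology_class_eq_iff:
  assumes "u \<in> scocycles p X {UNIV} \<A>" "v \<in> scocycles p X {UNIV} \<A>"
  shows "cohomology_class p X \<A> u = cohomology_class p X \<A> v \<longleftrightarrow> u - v \<in> scoboundaries p X {UNIV} \<A>"
proof
  assume "cohomology_class p X \<A> u = cohomology_class p X \<A> v"
  then show "u - v \<in> scoboundaries p X {UNIV} \<A>"
    using cohomology_class_self[of p X u \<A>] cohomology_class_memD[of p X u \<A> v] assms by simp
next
  assume uv: "u - v \<in> scoboundaries p X {UNIV} \<A>"
  have *: "cohomology_class p X \<A> u \<subseteq> cohomology_class p X \<A> v"
    if "u - v \<in> scoboundaries p X {UNIV} \<A>" for u v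
  proof
    fix \<phi> assume "\<phi> \<in> cohomology_class p X \<A> u"
    then obtain w where w: "w \<in> scoboundaries p X {UNIV} \<A>" "\<phi> = eval_cochain p X (u + w)"
      by (auto simp: cohomology_class_def)
    have "u - v + w \<in> scoboundaries p X {UNIV} \<A>"
      using that w(1) by (rule scoboundaries_add)
    then have "u + w - v \<in> scoboundaries p X {UNIV} \<A>" by (simp add: algebra_simps)
    with w(2) show "\<phi> \<in> cohomology_class p X \<A> v"
      by (simp add: cohomology_class_memI)
  qed
  moreover have "v - u \<in> scoboundaries p X {UNIV} \<A>"
    using scoboundaries_uminus[OF uv] by simp
  ultimately show "cohomology_class p X \<A> u = cohomology_class p X \<A> v"
    using uv by (intro equalityI) auto
qed

lemma comm_group_cohomology_group: "comm_group (cohomology_group p X \<A>)"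
proof (rule comm_groupI)
  fix x y z
  assume "x \<in> carrier (cohomology_group p X \<A>)" "y \<in> carrier (cohomology_group p X \<A>)" "z \<in> carrier (cohomology_group p X \<A>)"
  then obtain u v w where u: "u \<in> scocycles p X {UNIV} \<A>" "x = cohomology_class p X \<A> u"
    and v: "v \<in> scocycles p X {UNIV} \<A>" "y = cohomology_class p X \<A> v"
    and w: "w \<in> scocycles p X {UNIV} \<A>" "z = cohomology_class p X \<A> w"
    by (auto simp: carrier_cohomology_group)
  show "x \<otimes>\<^bsub>cohomology_group p X \<A>\<^esub> y \<otimes>\<^bsub>cohomology_group p X \<A>\<^esub> z
      = x \<otimes>\<^bsub>cohomology_group p X \<A>\<^esub> (y \<otimes>\<^bsub>cohomology_group p X \<A>\<^esub> z)"
    by (simp add: u v w mult_cohomology_class add.assoc)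
next
  fix x y
  assume "x \<in> carrier (cohomology_group p X \<A>)" "y \<in> carrier (cohomology_group p X \<A>)"
  then obtain u v where u: "u \<in> scocycles p X {UNIV} \<A>" "x = cohomology_class p X \<A> u"
    and v: "v \<in> scocycles p X {UNIV} \<A>" "y = cohomology_class p X \<A> v"
    by (auto simp: carrier_cohomology_group)
  show "x \<otimes>\<^bsub>cohomology_group p X \<A>\<^esub> y \<in> carrier (cohomology_group p X \<A>)"
    using u v by (simp add: mult_cohomology_class carrier_cohomology_group scocycles_add)
  show "x \<otimes>\<^bsub>cohomology_group p X \<A>\<^esub> y = y \<otimes>\<^bsub>cohomology_group p X \<A>\<^esub> x"
    by (simp add: u v mult_cohomology_class add.commute)
next
  show "\<one>\<^bsub>cohomology_group p X \<A>\<^esub> \<in> carrier (cohomology_group p X \<A>)"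
    by (simp add: one_cohomology_group carrier_cohomology_group)
next
  fix x assume "x \<in> carrier (cohomology_group p X \<A>)"
  then obtain u where u: "u \<in> scocycles p X {UNIV} \<A>" "x = cohomology_class p X \<A> u"
    by (auto simp: carrier_cohomology_group)
  show "\<one>\<^bsub>cohomology_group p X \<A>\<^esub> \<otimes>\<^bsub>cohomology_group p X \<A>\<^esub> x = x"
    by (simp add: u mult_cohomology_class one_cohomology_group)
  have "cohomology_class p X \<A> (- u) \<otimes>\<^bsub>cohomology_group p X \<A>\<^esub> x = \<one>\<^bsub>cohomology_group p X \<A>\<^esub>"
    by (simp add: u mult_cohomology_class one_cohomology_group)
  then show "\<exists>y\<in>carrier (cohomology_group p X \<A>). y \<otimes>\<^bsub>cohomology_group p X \<A>\<^esub> x = \<one>\<^bsub>cohomology_group p X \<A>\<^esub>"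
    using scocycles_uminus[OF u(1)] by (auto simp: carrier_cohomology_group intro: bexI[where x = "- u"])
qed

lemma finprod_cohomology_class:
  assumes "finite I" "\<And>i. i \<in> I \<Longrightarrow> f i \<in> scocycles p X {UNIV} \<A>"
  shows "finprod (cohomology_group p X \<A>) (\<lambda>i. cohomology_class p X \<A> (f i)) I = cohomology_class p X \<A> (sum f I)"
proof -
  interpret comm_group "cohomology_group p X \<A>"
    by (rule comm_group_cohomology_group)
  show ?thesis using assms
  proof (induction I rule: finite_induct)
    case empty
    then show ?case by (metis finprod_empty one_cohomology_group sum.empty)
  next
    case (insert i I)
    have "finprod (cohomology_group p X \<A>) (\<lambda>i. cohomology_class p X \<A> (f i)) (insert i I)
        = cohomology_class p X \<A> (f i) \<otimes>\<^bsub>cohomology_group p X \<A>\<^esub> cohomology_class p X \<A> (sum f I)"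
      using insert by (subst finprod_insert) (auto simp: carrier_cohomology_group)
    also have "\<dots> = cohomology_class p X \<A> (sum f (insert i I))"
      using insert.hyps by (metis mult_cohomology_class sum.insert)
    finally show ?case .
  qed
qed

lemma cup_cochain_eval_cochain:
  "cup_cochain p q X (eval_cochain p X u) (eval_cochain q X v) = eval_cochain (p + q) X (scup p q X {UNIV} u v)"
proof
  fix c
  show "cup_cochain p q X (eval_cochain p X u) (eval_cochain q X v) c = eval_cochain (p + q) X (scup p q X {UNIV} u v) c"
  proof (cases "singular_chain (p + q) X c")
    case True
    have "eval_cochain p X u (frag_of (front_face p \<sigma>)) * eval_cochain q X v (frag_of (back_face p q \<sigma>))
        = scup p q X {UNIV} u v \<sigma>" if "\<sigma> \<in> Poly_Mapping.keys c" for \<sigma>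
    proof -
      have "singular_simplex (p + q) X \<sigma>"
        using True that by (auto simp: singular_chain_def)
      then show ?thesis
        using singular_simplex_front_face[of p q X \<sigma>] singular_simplex_back_face[of p q X \<sigma>]
        by (simp add: eval_cochain_def scup_def singular_chain_of)
    qed
    then show ?thesis
      using True by (simp add: cup_cochain_def) (simp add: eval_cochain_def pairing_def)
  qed (simp add: cup_cochain_def eval_cochain_def)
qed

lemma cohomology_unit_eq: "cohomology_unit X = cohomology_class 0 X {{}} (sunit X {UNIV})"
proof -
  have "(\<lambda>c\<in>singular_chain_set 0 X. \<Sum>\<sigma>\<in>Poly_Mapping.keys c. Poly_Mapping.lookup c \<sigma>)
      = eval_cochain 0 X (sunit X {UNIV})"
    by (auto simp: eval_cochain_def pairing_def sunit_def singular_chain_def fun_eq_iff intro!: sum.cong)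
  then show ?thesis
    by (simp add: cohomology_unit_def coset_eq_cohomology_class del: coboundaries.simps)
qed

text \<open>
  The hypothesis \<open>inj\<close> makes the \<open>THE\<close> in the definition of the product well defined.
\<close>

lemma cup_product_cohomology_class:
  assumes u: "u \<in> scocycles p X {UNIV} {A}" and v: "v \<in> scocycles q X {UNIV} {B}"
    and w: "w \<in> scocycles (p + q) X {UNIV} {A \<union> B}"
    and uvw: "w - scup p q X {UNIV} u v \<in> scoboundaries (p + q) X {UNIV} {A, B}"
    and inj: "\<And>z. z \<in> scocycles (p + q) X {UNIV} {A \<union> B} \<Longrightarrow> z \<in> scoboundaries (p + q) X {UNIV} {A, B} \<Longrightarrow>
       z \<in> scoboundaries (p + q) X {UNIV} {A \<union> B}"
  shows "cup_product p q X A B (cohomology_class p X {A} u) (cohomology_class q X {B} v)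
           = cohomology_class (p + q) X {A \<union> B} w"
proof -
  define uv where "uv = scup p q X {UNIV} u v"
  have mono: "scoboundaries (p + q) X {UNIV} {A \<union> B} \<subseteq> scoboundaries (p + q) X {UNIV} {A, B}"
    by (rule scoboundaries_antimono) auto
  \<comment> \<open>Independence of representatives: changing \<phi>, \<psi> and \<xi> within their
    classes moves the product and \<open>w\<close> by coboundaries relative to
    \<open>{A, B}\<close>.\<close>
  have key: "\<xi> \<in> coboundaries (p + q) X {A, B} #>\<^bsub>cochain_group (p + q) X {A, B}\<^esub> cup_cochain p q X \<phi> \<psi>"
    if \<phi>: "\<phi> \<in> cohomology_class p X {A} u" and \<psi>: "\<psi> \<in> cohomology_class q X {B} v"
      and \<xi>: "\<xi> \<in> cohomology_class (p + q) X {A \<union> B} w" for \<phi> \<psi> \<xi>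
  proof -
    obtain u' where u': "u' \<in> scocycles p X {UNIV} {A}" "u' - u \<in> scoboundaries p X {UNIV} {A}" "\<phi> = eval_cochain p X u'"
      using in_cohomology_classE[OF \<phi> u] .
    obtain v' where v': "v' \<in> scocycles q X {UNIV} {B}" "v' - v \<in> scoboundaries q X {UNIV} {B}" "\<psi> = eval_cochain q X v'"
      using in_cohomology_classE[OF \<psi> v] .
    obtain w' where w': "w' - w \<in> scoboundaries (p + q) X {UNIV} {A \<union> B}" "\<xi> = eval_cochain (p + q) X w'"
      using in_cohomology_classE[OF \<xi> w] by metis
    have "scup p q X {UNIV} u' v' - uv \<in> scoboundaries (p + q) X {UNIV} {A, B}"
      using scup_cohomologous[OF u u'(2) v v'(2)] by (simp add: uv_def insert_commute)
    moreover have "w' - w \<in> scoboundaries (p + q) X {UNIV} {A, B}"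
      using w'(1) mono by blast
    ultimately have "(w' - w) + (w - uv) - (scup p q X {UNIV} u' v' - uv) \<in> scoboundaries (p + q) X {UNIV} {A, B}"
      using uvw[folded uv_def] by (blast intro: scoboundaries_add scoboundaries_diff)
    then have "w' - scup p q X {UNIV} u' v' \<in> scoboundaries (p + q) X {UNIV} {A, B}"
      by simp
    then show ?thesis
      by (simp add: u' v' w' cup_cochain_eval_cochain coset_eq_cohomology_class cohomology_class_memI)
  qed
  show ?thesis
    unfolding cup_product_def
  proof (rule the_equality)
    show "cohomology_class (p + q) X {A \<union> B} w \<in> carrier (relative_cohomology_group (p + q) X (A \<union> B)) \<and>
      (\<forall>\<phi>\<in>cohomology_class p X {A} u. \<forall>\<psi>\<in>cohomology_class q X {B} v. \<forall>\<xi>\<in>cohomology_class (p + q) X {A \<union> B} w.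
         \<xi> \<in> coboundaries (p + q) X {A, B} #>\<^bsub>cochain_group (p + q) X {A, B}\<^esub> cup_cochain p q X \<phi> \<psi>)"
      using key w by (auto simp: carrier_cohomology_group)
  next
    fix c
    assume c: "c \<in> carrier (relative_cohomology_group (p + q) X (A \<union> B)) \<and>
      (\<forall>\<phi>\<in>cohomology_class p X {A} u. \<forall>\<psi>\<in>cohomology_class q X {B} v. \<forall>\<xi>\<in>c.
         \<xi> \<in> coboundaries (p + q) X {A, B} #>\<^bsub>cochain_group (p + q) X {A, B}\<^esub> cup_cochain p q X \<phi> \<psi>)"
    then obtain w' where w': "w' \<in> scocycles (p + q) X {UNIV} {A \<union> B}" "c = cohomology_class (p + q) X {A \<union> B} w'"
      by (auto simp: carrier_cohomology_group)
    have "eval_cochain (p + q) X w' \<in> coboundaries (p + q) X {A, B} #>\<^bsub>cochain_group (p + q) X {A, B}\<^esub>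
        cup_cochain p q X (eval_cochain p X u) (eval_cochain q X v)"
      using c w'(2) cohomology_class_self by blast
    then have "eval_cochain (p + q) X w' \<in> cohomology_class (p + q) X {A, B} uv"
      by (simp add: cup_cochain_eval_cochain coset_eq_cohomology_class uv_def)
    moreover have "uv \<in> scocycles (p + q) X {UNIV} {A, B}"
      using scup_in_scocycles[OF u v] by (simp add: uv_def insert_commute)
    ultimately have "w' - uv \<in> scoboundaries (p + q) X {UNIV} {A, B}"
      using w'(1) by (rule cohomology_class_memD)
    then have "(w' - uv) - (w - uv) \<in> scoboundaries (p + q) X {UNIV} {A, B}"
      using uvw[folded uv_def] by (rule scoboundaries_diff)
    then have "w' - w \<in> scoboundaries (p + q) X {UNIV} {A, B}" by simp
    \<comment> \<open>Uniqueness: two candidates agree modulo coboundaries relative to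
      \<open>{A, B}\<close>, and \<open>inj\<close> lifts this to coboundaries relative to the
      union.\<close>
    then have "w' - w \<in> scoboundaries (p + q) X {UNIV} {A \<union> B}"
      using w'(1) w by (intro inj scocycles_diff)
    then show "c = cohomology_class (p + q) X {A \<union> B} w"
      using w' w by (simp add: cohomology_class_eq_iff)
  qed
qed

text \<open>For empty subsets the families \<open>{A, B}\<close> and \<open>{A \<union> B}\<close>
  coincide, so the product of cochains already represents the class.\<close>

lemma cup_product_class_empty:
  assumes "u \<in> scocycles p Y {UNIV} {{}}" "v \<in> scocycles q Y {UNIV} {{}}"
  shows "cup_product p q Y {} {} (cohomology_class p Y {{}} u) (cohomology_class q Y {{}} v)
     = cohomology_class (p + q) Y {{}} (scup p q Y {UNIV} u v)"
  using cup_product_cohomology_class[of u p Y "{}" v q "{}" "scup p q Y {UNIV} u v"] assms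
    scup_in_scocycles[OF assms] by simp

section \<open>Graded rings\<close>

lemma finprod_hom:
  assumes "comm_group A" "comm_group B"
    and f: "f \<in> carrier A \<rightarrow> carrier B"
    and mult: "\<And>x y. x \<in> carrier A \<Longrightarrow> y \<in> carrier A \<Longrightarrow> f (x \<otimes>\<^bsub>A\<^esub> y) = f x \<otimes>\<^bsub>B\<^esub> f y"
    and "finite I" "g \<in> I \<rightarrow> carrier A"
  shows "f (finprod A g I) = finprod B (\<lambda>i. f (g i)) I"
proof -
  interpret A: comm_group A by fact
  interpret B: comm_group B by fact
  have one: "f \<one>\<^bsub>A\<^esub> = \<one>\<^bsub>B\<^esub>"
    using mult[of "\<one>\<^bsub>A\<^esub>" "\<one>\<^bsub>A\<^esub>"] f by (metis A.one_closed A.r_one B.l_cancel_one' PiE)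
  show ?thesis
    using assms(5,6)
  proof (induction I rule: finite_induct)
    case (insert i I)
    then have "finprod A g (insert i I) = g i \<otimes>\<^bsub>A\<^esub> finprod A g I"
      by (intro A.finprod_insert) auto
    moreover have "finprod B (\<lambda>i. f (g i)) (insert i I) = f (g i) \<otimes>\<^bsub>B\<^esub> finprod B (\<lambda>i. f (g i)) I"
      using insert f by (intro B.finprod_insert) auto
    ultimately show ?case
      using insert mult by simp
  qed (simp add: one)
qed

text \<open>Both sides run over the triangle of pairs with sum at most \<open>k\<close>, by
  diagonals on the left and by rows on the right; the induction adds the diagonal of sum
  \<open>Suc k\<close>. Associativity of a graded product comes down to this regrouping.\<close>

lemma (in comm_monoid) finprod_triangle:
  fixes f :: "nat \<Rightarrow> nat \<Rightarrow> 'a"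
  assumes "\<And>i j. i + j \<le> k \<Longrightarrow> f i j \<in> carrier G"
  shows "finprod G (\<lambda>j. finprod G (\<lambda>i. f i (j - i)) {..j}) {..k}
       = finprod G (\<lambda>j. finprod G (\<lambda>i. f j i) {..k - j}) {..k}"
  using assms
proof (induction k)
  case (Suc k)
  have IH: "finprod G (\<lambda>j. finprod G (\<lambda>i. f i (j - i)) {..j}) {..k}
       = finprod G (\<lambda>j. finprod G (\<lambda>i. f j i) {..k - j}) {..k}"
    using Suc.prems by (intro Suc.IH) auto
  have "finprod G (\<lambda>j. finprod G (\<lambda>i. f j i) {..Suc k - j}) {..k}
      = finprod G (\<lambda>j. f j (Suc k - j) \<otimes> finprod G (\<lambda>i. f j i) {..k - j}) {..k}"
  proof (rule finprod_cong')
    fix j assume "j \<in> {..k}"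
    then have j: "Suc k - j = Suc (k - j)" by auto
    show "finprod G (\<lambda>i. f j i) {..Suc k - j} = f j (Suc k - j) \<otimes> finprod G (\<lambda>i. f j i) {..k - j}"
      unfolding j using Suc.prems \<open>j \<in> {..k}\<close> by (intro finprod_Suc) auto
  qed (use Suc.prems in \<open>auto intro!: m_closed finprod_closed\<close>)
  also have "\<dots> = finprod G (\<lambda>j. f j (Suc k - j)) {..k} \<otimes> finprod G (\<lambda>j. finprod G (\<lambda>i. f j i) {..k - j}) {..k}"
    using Suc.prems by (intro finprod_multf) (auto intro!: finprod_closed)
  finally have 1: "finprod G (\<lambda>j. finprod G (\<lambda>i. f j i) {..Suc k - j}) {..k}
      = finprod G (\<lambda>j. f j (Suc k - j)) {..k} \<otimes> finprod G (\<lambda>j. finprod G (\<lambda>i. f j i) {..k - j}) {..k}" .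
  have "finprod G (\<lambda>j. finprod G (\<lambda>i. f j i) {..Suc k - j}) {..Suc k}
      = finprod G (\<lambda>i. f (Suc k) i) {..Suc k - Suc k} \<otimes> finprod G (\<lambda>j. finprod G (\<lambda>i. f j i) {..Suc k - j}) {..k}"
    using Suc.prems by (intro finprod_Suc) (auto intro!: finprod_closed)
  also have "finprod G (\<lambda>i. f (Suc k) i) {..Suc k - Suc k} = f (Suc k) 0"
    using Suc.prems by simp
  finally have 2: "finprod G (\<lambda>j. finprod G (\<lambda>i. f j i) {..Suc k - j}) {..Suc k}
      = f (Suc k) 0 \<otimes> (finprod G (\<lambda>j. f j (Suc k - j)) {..k} \<otimes> finprod G (\<lambda>j. finprod G (\<lambda>i. f j i) {..k - j}) {..k})"
    unfolding 1 .
  have "finprod G (\<lambda>i. f i (Suc k - i)) {..Suc k} = f (Suc k) 0 \<otimes> finprod G (\<lambda>j. f j (Suc k - j)) {..k}"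
    using Suc.prems by (subst finprod_Suc) auto
  moreover have "finprod G (\<lambda>j. finprod G (\<lambda>i. f i (j - i)) {..j}) {..Suc k}
      = finprod G (\<lambda>i. f i (Suc k - i)) {..Suc k} \<otimes> finprod G (\<lambda>j. finprod G (\<lambda>i. f i (j - i)) {..j}) {..k}"
    using Suc.prems by (intro finprod_Suc) (auto intro!: finprod_closed)
  moreover have "f (Suc k) 0 \<in> carrier G" "finprod G (\<lambda>j. f j (Suc k - j)) {..k} \<in> carrier G"
    "finprod G (\<lambda>j. finprod G (\<lambda>i. f j i) {..k - j}) {..k} \<in> carrier G"
    using Suc.prems by (auto intro!: finprod_closed)
  ultimately show ?case
    unfolding 2 IH by (simp add: m_assoc)
qed simp

text \<open>All graded pieces share one carrier type, so degrees appear only as indices and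
  associativity is stated without transport between \<open>p + q + r\<close> and
  \<open>p + (q + r)\<close>. As the groups are written multiplicatively, the two distributive laws
  express biadditivity of the product.\<close>

locale graded_ring_data =
  fixes G :: "nat \<Rightarrow> 'c monoid" and \<mu> :: "nat \<Rightarrow> nat \<Rightarrow> 'c \<Rightarrow> 'c \<Rightarrow> 'c" and e :: 'c
  assumes comm_group: "comm_group (G n)"
    and closed: "x \<in> carrier (G p) \<Longrightarrow> y \<in> carrier (G q) \<Longrightarrow> \<mu> p q x y \<in> carrier (G (p + q))"
    and distrib_left: "x \<in> carrier (G p) \<Longrightarrow> y \<in> carrier (G q) \<Longrightarrow> y' \<in> carrier (G q) \<Longrightarrow>
          \<mu> p q x (y \<otimes>\<^bsub>G q\<^esub> y') = \<mu> p q x y \<otimes>\<^bsub>G (p + q)\<^esub> \<mu> p q x y'"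
    and distrib_right: "x \<in> carrier (G p) \<Longrightarrow> x' \<in> carrier (G p) \<Longrightarrow> y \<in> carrier (G q) \<Longrightarrow>
          \<mu> p q (x \<otimes>\<^bsub>G p\<^esub> x') y = \<mu> p q x y \<otimes>\<^bsub>G (p + q)\<^esub> \<mu> p q x' y"
    and assoc: "x \<in> carrier (G p) \<Longrightarrow> y \<in> carrier (G q) \<Longrightarrow> z \<in> carrier (G r) \<Longrightarrow>
          \<mu> (p + q) r (\<mu> p q x y) z = \<mu> p (q + r) x (\<mu> q r y z)"
    and unit_closed: "e \<in> carrier (G 0)"
    and unit_left: "x \<in> carrier (G p) \<Longrightarrow> \<mu> 0 p e x = x"
    and unit_right: "x \<in> carrier (G p) \<Longrightarrow> \<mu> p 0 x e = x"

lemma carrier_graded_sum_ring: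
  assumes "\<And>n. comm_group (G n)"
  shows "carrier (graded_sum_ring G \<mu> e) = {x. (\<forall>n. x n \<in> carrier (G n)) \<and> finite {n. x n \<noteq> \<one>\<^bsub>G n\<^esub>}}"
  using comm_group.axioms(2)[OF assms] by (auto simp: graded_sum_ring_def carrier_sum_group)

lemma graded_sum_ring_sel:
  "\<one>\<^bsub>graded_sum_ring G \<mu> e\<^esub> = (\<lambda>n. if n = 0 then e else \<one>\<^bsub>G n\<^esub>)"
  "\<zero>\<^bsub>graded_sum_ring G \<mu> e\<^esub> = (\<lambda>n. \<one>\<^bsub>G n\<^esub>)"
  "x \<oplus>\<^bsub>graded_sum_ring G \<mu> e\<^esub> y = (\<lambda>n. x n \<otimes>\<^bsub>G n\<^esub> y n)"
  "x \<otimes>\<^bsub>graded_sum_ring G \<mu> e\<^esub> y = (\<lambda>n. finprod (G n) (\<lambda>p. \<mu> p (n - p) (x p) (y (n - p))) {..n})"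
  by (simp_all add: graded_sum_ring_def restrict_UNIV)

context graded_ring_data
begin

lemma closed': "x \<in> carrier (G p) \<Longrightarrow> p \<le> n \<Longrightarrow> y \<in> carrier (G (n - p)) \<Longrightarrow> \<mu> p (n - p) x y \<in> carrier (G n)"
  using closed[of x p y "n - p"] by simp

lemma left_one:
  assumes "y \<in> carrier (G q)" shows "\<mu> p q \<one>\<^bsub>G p\<^esub> y = \<one>\<^bsub>G (p + q)\<^esub>"
proof -
  interpret P: comm_group "G p" by (rule comm_group)
  interpret PQ: comm_group "G (p + q)" by (rule comm_group)
  have "\<mu> p q \<one>\<^bsub>G p\<^esub> y = \<mu> p q \<one>\<^bsub>G p\<^esub> y \<otimes>\<^bsub>G (p + q)\<^esub> \<mu> p q \<one>\<^bsub>G p\<^esub> y"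
    using distrib_right[OF P.one_closed P.one_closed assms] by simp
  then show ?thesis
    using closed[OF P.one_closed assms] by (metis PQ.l_cancel_one')
qed

lemma right_one:
  assumes "x \<in> carrier (G p)" shows "\<mu> p q x \<one>\<^bsub>G q\<^esub> = \<one>\<^bsub>G (p + q)\<^esub>"
proof -
  interpret Q: comm_group "G q" by (rule comm_group)
  interpret PQ: comm_group "G (p + q)" by (rule comm_group)
  have "\<mu> p q x \<one>\<^bsub>G q\<^esub> = \<mu> p q x \<one>\<^bsub>G q\<^esub> \<otimes>\<^bsub>G (p + q)\<^esub> \<mu> p q x \<one>\<^bsub>G q\<^esub>"
    using distrib_left[OF assms Q.one_closed Q.one_closed] by simp
  then show ?thesis
    using closed[OF assms Q.one_closed] by (metis PQ.l_cancel_one')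
qed

lemma finprod_right:
  assumes "x \<in> carrier (G p)" "finite I" "g \<in> I \<rightarrow> carrier (G q)"
  shows "\<mu> p q x (finprod (G q) g I) = finprod (G (p + q)) (\<lambda>i. \<mu> p q x (g i)) I"
  using assms by (intro finprod_hom[of "G q"] comm_group) (auto intro: closed distrib_left)

lemma finprod_left:
  assumes "y \<in> carrier (G q)" "finite I" "g \<in> I \<rightarrow> carrier (G p)"
  shows "\<mu> p q (finprod (G p) g I) y = finprod (G (p + q)) (\<lambda>i. \<mu> p q (g i) y) I"
  using assms by (intro finprod_hom[of "G p" _ "\<lambda>x. \<mu> p q x y"] comm_group) (auto intro: closed distrib_right)

text \<open>If \<open>x\<close> is trivial from degree \<open>M\<close> on and \<open>y\<close> from
  degree \<open>N\<close> on, every summand in degree at least \<open>M + N\<close> has a trivial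
  factor, so the support of the product is finite.\<close>

lemma mult_closed:
  assumes x: "x \<in> carrier (graded_sum_ring G \<mu> e)" and y: "y \<in> carrier (graded_sum_ring G \<mu> e)"
  shows "x \<otimes>\<^bsub>graded_sum_ring G \<mu> e\<^esub> y \<in> carrier (graded_sum_ring G \<mu> e)"
proof -
  have xc: "\<And>n. x n \<in> carrier (G n)" and yc: "\<And>n. y n \<in> carrier (G n)"
    and fx: "finite {n. x n \<noteq> \<one>\<^bsub>G n\<^esub>}" and fy: "finite {n. y n \<noteq> \<one>\<^bsub>G n\<^esub>}"
    using x y by (auto simp: carrier_graded_sum_ring comm_group)
  have c: "finprod (G n) (\<lambda>p. \<mu> p (n - p) (x p) (y (n - p))) {..n} \<in> carrier (G n)" for n
  proof -
    interpret N: comm_group "G n" by (rule comm_group)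
    show ?thesis by (rule N.finprod_closed) (auto intro: closed' xc yc)
  qed
  obtain M where M: "\<And>n. x n \<noteq> \<one>\<^bsub>G n\<^esub> \<Longrightarrow> n < M"
    using fx by (auto simp: finite_nat_set_iff_bounded)
  obtain N where N: "\<And>n. y n \<noteq> \<one>\<^bsub>G n\<^esub> \<Longrightarrow> n < N"
    using fy by (auto simp: finite_nat_set_iff_bounded)
  have "finprod (G n) (\<lambda>p. \<mu> p (n - p) (x p) (y (n - p))) {..n} = \<one>\<^bsub>G n\<^esub>" if "M + N \<le> n" for n
  proof -
    interpret N: comm_group "G n" by (rule comm_group)
    show ?thesis
    proof (rule N.finprod_one_eqI)
      fix p assume p: "p \<in> {..n}"
      show "\<mu> p (n - p) (x p) (y (n - p)) = \<one>\<^bsub>G n\<^esub>"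
      proof (cases "p < M")
        case True
        then have "\<not> n - p < N" using that by arith
        then have "y (n - p) = \<one>\<^bsub>G (n - p)\<^esub>" using N by blast
        then show ?thesis using right_one[OF xc[of p], of "n - p"] p by simp
      next
        case False
        then have "x p = \<one>\<^bsub>G p\<^esub>" using M[of p] by auto
        then show ?thesis using left_one[OF yc[of "n - p"], of p] p by simp
      qed
    qed
  qed
  then have "{n. finprod (G n) (\<lambda>p. \<mu> p (n - p) (x p) (y (n - p))) {..n} \<noteq> \<one>\<^bsub>G n\<^esub>} \<subseteq> {..<M + N}"
    by (auto simp: not_less[symmetric])
  then show ?thesis
    using c finite_subset by (auto simp: carrier_graded_sum_ring comm_group graded_sum_ring_sel)
qed

lemma mult_assoc:
  assumes x: "x \<in> carrier (graded_sum_ring G \<mu> e)" and y: "y \<in> carrier (graded_sum_ring G \<mu> e)"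
    and z: "z \<in> carrier (graded_sum_ring G \<mu> e)"
  shows "x \<otimes>\<^bsub>graded_sum_ring G \<mu> e\<^esub> y \<otimes>\<^bsub>graded_sum_ring G \<mu> e\<^esub> z
       = x \<otimes>\<^bsub>graded_sum_ring G \<mu> e\<^esub> (y \<otimes>\<^bsub>graded_sum_ring G \<mu> e\<^esub> z)"
proof
  fix n
  interpret N: comm_group "G n" by (rule comm_group)
  have xc: "x n \<in> carrier (G n)" and yc: "y n \<in> carrier (G n)" and zc: "z n \<in> carrier (G n)" for n
    using x y z by (auto simp: carrier_graded_sum_ring comm_group)
  \<comment> \<open>The threefold product with degrees \<open>i\<close>, \<open>j\<close> and the
    remaining \<open>n - i - j\<close>; both bracketings become products of \<open>f\<close> over
    the triangle \<open>i + j \<le> n\<close>.\<close>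
  define f where "f = (\<lambda>i j. \<mu> i (n - i) (x i) (\<mu> j (n - i - j) (y j) (z (n - i - j))))"
  have fc: "f i j \<in> carrier (G n)" if "i + j \<le> n" for i j
    unfolding f_def using that by (intro closed' xc yc zc) auto
  have "(x \<otimes>\<^bsub>graded_sum_ring G \<mu> e\<^esub> y \<otimes>\<^bsub>graded_sum_ring G \<mu> e\<^esub> z) n
      = finprod (G n) (\<lambda>k. \<mu> k (n - k) (finprod (G k) (\<lambda>p. \<mu> p (k - p) (x p) (y (k - p))) {..k}) (z (n - k))) {..n}"
    by (simp add: graded_sum_ring_sel)
  also have "\<dots> = finprod (G n) (\<lambda>k. finprod (G n) (\<lambda>p. f p (k - p)) {..k}) {..n}"
  proof (rule N.finprod_cong')
    fix k assume k: "k \<in> {..n}"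
    have "\<mu> k (n - k) (finprod (G k) (\<lambda>p. \<mu> p (k - p) (x p) (y (k - p))) {..k}) (z (n - k))
        = finprod (G (k + (n - k))) (\<lambda>p. \<mu> k (n - k) (\<mu> p (k - p) (x p) (y (k - p))) (z (n - k))) {..k}"
      by (rule finprod_left) (auto intro: closed' xc yc zc)
    also have "\<dots> = finprod (G n) (\<lambda>p. \<mu> k (n - k) (\<mu> p (k - p) (x p) (y (k - p))) (z (n - k))) {..k}"
      using k by simp
    also have "\<dots> = finprod (G n) (\<lambda>p. f p (k - p)) {..k}"
    proof (rule N.finprod_cong')
      fix p assume p: "p \<in> {..k}"
      have "\<mu> (p + (k - p)) (n - k) (\<mu> p (k - p) (x p) (y (k - p))) (z (n - k))
          = \<mu> p (k - p + (n - k)) (x p) (\<mu> (k - p) (n - k) (y (k - p)) (z (n - k)))"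
        by (rule assoc) (auto intro: xc yc zc)
      moreover have "k - p + (n - k) = n - p" "n - p - (k - p) = n - k" "p + (k - p) = k"
        using p k by auto
      ultimately show "\<mu> k (n - k) (\<mu> p (k - p) (x p) (y (k - p))) (z (n - k)) = f p (k - p)"
        by (simp add: f_def)
    qed (use k in \<open>auto intro: fc\<close>)
    finally show "\<mu> k (n - k) (finprod (G k) (\<lambda>p. \<mu> p (k - p) (x p) (y (k - p))) {..k}) (z (n - k))
        = finprod (G n) (\<lambda>p. f p (k - p)) {..k}" .
  qed (auto intro!: fc N.finprod_closed)
  also have "\<dots> = finprod (G n) (\<lambda>j. finprod (G n) (\<lambda>i. f j i) {..n - j}) {..n}"
    by (rule N.finprod_triangle) (rule fc)
  also have "\<dots> = finprod (G n) (\<lambda>j. \<mu> j (n - j) (x j)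
      (finprod (G (n - j)) (\<lambda>i. \<mu> i (n - j - i) (y i) (z (n - j - i))) {..n - j})) {..n}"
  proof (rule N.finprod_cong')
    fix j assume j: "j \<in> {..n}"
    have "\<mu> j (n - j) (x j) (finprod (G (n - j)) (\<lambda>i. \<mu> i (n - j - i) (y i) (z (n - j - i))) {..n - j})
       = finprod (G (j + (n - j))) (\<lambda>i. \<mu> j (n - j) (x j) (\<mu> i (n - j - i) (y i) (z (n - j - i)))) {..n - j}"
    proof (rule finprod_right)
      show "(\<lambda>i. \<mu> i (n - j - i) (y i) (z (n - j - i))) \<in> {..n - j} \<rightarrow> carrier (G (n - j))"
        by (intro Pi_I closed' yc zc) simp
    qed (simp_all add: xc)
    then show "finprod (G n) (\<lambda>i. f j i) {..n - j} = \<mu> j (n - j) (x j)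
      (finprod (G (n - j)) (\<lambda>i. \<mu> i (n - j - i) (y i) (z (n - j - i))) {..n - j})"
      using j by (simp add: f_def)
  next
    show "(\<lambda>j. \<mu> j (n - j) (x j) (finprod (G (n - j)) (\<lambda>i. \<mu> i (n - j - i) (y i) (z (n - j - i))) {..n - j}))
        \<in> {..n} \<rightarrow> carrier (G n)"
      by (intro Pi_I closed' xc yc zc comm_monoid.finprod_closed comm_group.axioms(1)[OF comm_group]) auto
  qed simp
  also have "\<dots> = (x \<otimes>\<^bsub>graded_sum_ring G \<mu> e\<^esub> (y \<otimes>\<^bsub>graded_sum_ring G \<mu> e\<^esub> z)) n"
    by (simp add: graded_sum_ring_sel)
  finally show "(x \<otimes>\<^bsub>graded_sum_ring G \<mu> e\<^esub> y \<otimes>\<^bsub>graded_sum_ring G \<mu> e\<^esub> z) n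
       = (x \<otimes>\<^bsub>graded_sum_ring G \<mu> e\<^esub> (y \<otimes>\<^bsub>graded_sum_ring G \<mu> e\<^esub> z)) n" .
qed

lemma mult_unit:
  assumes x: "x \<in> carrier (graded_sum_ring G \<mu> e)"
  shows "\<one>\<^bsub>graded_sum_ring G \<mu> e\<^esub> \<otimes>\<^bsub>graded_sum_ring G \<mu> e\<^esub> x = x"
    and "x \<otimes>\<^bsub>graded_sum_ring G \<mu> e\<^esub> \<one>\<^bsub>graded_sum_ring G \<mu> e\<^esub> = x"
proof -
  have xc: "x n \<in> carrier (G n)" for n
    using x by (auto simp: carrier_graded_sum_ring comm_group)
  have "finprod (G n) (\<lambda>p. \<mu> p (n - p) (if p = 0 then e else \<one>\<^bsub>G p\<^esub>) (x (n - p))) {..n} = x n" for n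
  proof -
    interpret N: comm_group "G n" by (rule comm_group)
    have "finprod (G n) (\<lambda>p. \<mu> p (n - p) (if p = 0 then e else \<one>\<^bsub>G p\<^esub>) (x (n - p))) {..n}
        = finprod (G n) (\<lambda>p. if 0 = p then x n else \<one>\<^bsub>G n\<^esub>) {..n}"
    proof (rule N.finprod_cong')
      fix p assume "p \<in> {..n}"
      then show "\<mu> p (n - p) (if p = 0 then e else \<one>\<^bsub>G p\<^esub>) (x (n - p)) = (if 0 = p then x n else \<one>\<^bsub>G n\<^esub>)"
        using left_one[OF xc[of "n - p"], of p] unit_left[OF xc] by auto
    qed (auto simp: xc)
    also have "\<dots> = x n"
      using xc by (intro N.finprod_singleton[of 0 "{..n}" "\<lambda>_. x n"]) auto
    finally show ?thesis .
  qed
  then show "\<one>\<^bsub>graded_sum_ring G \<mu> e\<^esub> \<otimes>\<^bsub>graded_sum_ring G \<mu> e\<^esub> x = x"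
    by (simp add: graded_sum_ring_sel)
  have "finprod (G n) (\<lambda>p. \<mu> p (n - p) (x p) (if n - p = 0 then e else \<one>\<^bsub>G (n - p)\<^esub>)) {..n} = x n" for n
  proof -
    interpret N: comm_group "G n" by (rule comm_group)
    have "finprod (G n) (\<lambda>p. \<mu> p (n - p) (x p) (if n - p = 0 then e else \<one>\<^bsub>G (n - p)\<^esub>)) {..n}
        = finprod (G n) (\<lambda>p. if n = p then x n else \<one>\<^bsub>G n\<^esub>) {..n}"
    proof (rule N.finprod_cong')
      fix p assume p: "p \<in> {..n}"
      show "\<mu> p (n - p) (x p) (if n - p = 0 then e else \<one>\<^bsub>G (n - p)\<^esub>) = (if n = p then x n else \<one>\<^bsub>G n\<^esub>)"
      proof (cases "p = n")
        case True
        then show ?thesis using unit_right[OF xc] by simp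
      next
        case False
        then have "n - p \<noteq> 0" using p by auto
        then show ?thesis using right_one[OF xc[of p], of "n - p"] p False by simp
      qed
    qed (auto simp: xc)
    also have "\<dots> = x n"
      using xc by (intro N.finprod_singleton[of n "{..n}" "\<lambda>_. x n"]) auto
    finally show ?thesis .
  qed
  then show "x \<otimes>\<^bsub>graded_sum_ring G \<mu> e\<^esub> \<one>\<^bsub>graded_sum_ring G \<mu> e\<^esub> = x"
    by (simp add: graded_sum_ring_sel del: diff_is_0_eq)
qed

lemma abelian_group_graded_sum_ring: "abelian_group (graded_sum_ring G \<mu> e)"
proof -
  let ?R = "graded_sum_ring G \<mu> e"
  have grp: "group (G n)" for n
    using comm_group comm_group.axioms(2) by blast
  interpret S: group "sum_group UNIV G"
    by (rule sum_group) (rule grp)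
  show ?thesis
  proof (rule abelian_groupI)
    fix x y assume "x \<in> carrier ?R" "y \<in> carrier ?R"
    then have "x n \<in> carrier (G n)" "y n \<in> carrier (G n)" for n
      by (auto simp: carrier_graded_sum_ring comm_group)
    then show "x \<oplus>\<^bsub>?R\<^esub> y = y \<oplus>\<^bsub>?R\<^esub> x"
      using comm_group comm_group.axioms(1) comm_monoid.m_comm by (fastforce simp: graded_sum_ring_sel)
  next
    fix x assume "x \<in> carrier ?R"
    then have "x \<in> carrier (sum_group UNIV G)"
      by (simp add: graded_sum_ring_def)
    then show "\<exists>y\<in>carrier ?R. y \<oplus>\<^bsub>?R\<^esub> x = \<zero>\<^bsub>?R\<^esub>"
      using S.l_inv_ex by (simp add: graded_sum_ring_def)
  qed (use S.m_assoc S.m_closed in \<open>simp_all add: graded_sum_ring_def del: mult_sum_group one_sum_group\<close>)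
qed

lemma ring_graded_sum_ring: "ring (graded_sum_ring G \<mu> e)"
proof -
  let ?R = "graded_sum_ring G \<mu> e"
  interpret A: abelian_group ?R by (rule abelian_group_graded_sum_ring)
  show ?thesis
  proof (rule ringI)
    show "monoid ?R"
    proof (rule monoidI)
      have "finite {n. (if n = 0 then e else \<one>\<^bsub>G n\<^esub>) \<noteq> \<one>\<^bsub>G n\<^esub>}"
        by (rule finite_subset[of _ "{0}"]) auto
      then show "\<one>\<^bsub>?R\<^esub> \<in> carrier ?R"
        using unit_closed comm_group monoid.one_closed[OF group.is_monoid[OF comm_group.axioms(2)[OF comm_group]]]
        by (simp add: carrier_graded_sum_ring graded_sum_ring_sel)
    qed (simp_all add: mult_closed mult_assoc mult_unit)
  next
    fix x y z assume "x \<in> carrier ?R" "y \<in> carrier ?R" "z \<in> carrier ?R"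
    then have c: "x n \<in> carrier (G n)" "y n \<in> carrier (G n)" "z n \<in> carrier (G n)" for n
      by (auto simp: carrier_graded_sum_ring comm_group)
    have "finprod (G n) (\<lambda>p. \<mu> p (n - p) (x p \<otimes>\<^bsub>G p\<^esub> y p) (z (n - p))) {..n}
        = finprod (G n) (\<lambda>p. \<mu> p (n - p) (x p) (z (n - p))) {..n} \<otimes>\<^bsub>G n\<^esub>
          finprod (G n) (\<lambda>p. \<mu> p (n - p) (y p) (z (n - p))) {..n}" for n
    proof -
      interpret N: comm_group "G n" by (rule comm_group)
      have "finprod (G n) (\<lambda>p. \<mu> p (n - p) (x p \<otimes>\<^bsub>G p\<^esub> y p) (z (n - p))) {..n}
          = finprod (G n) (\<lambda>p. \<mu> p (n - p) (x p) (z (n - p)) \<otimes>\<^bsub>G n\<^esub> \<mu> p (n - p) (y p) (z (n - p))) {..n}"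
        using distrib_right[OF c(1,2,3)] by (intro N.finprod_cong') (auto intro!: closed' c)
      then show ?thesis
        by (subst (asm) N.finprod_multf) (auto intro!: closed' c)
    qed
    then show "(x \<oplus>\<^bsub>?R\<^esub> y) \<otimes>\<^bsub>?R\<^esub> z = x \<otimes>\<^bsub>?R\<^esub> z \<oplus>\<^bsub>?R\<^esub> y \<otimes>\<^bsub>?R\<^esub> z"
      by (simp add: graded_sum_ring_sel)
    have "finprod (G n) (\<lambda>p. \<mu> p (n - p) (z p) (x (n - p) \<otimes>\<^bsub>G (n - p)\<^esub> y (n - p))) {..n}
        = finprod (G n) (\<lambda>p. \<mu> p (n - p) (z p) (x (n - p))) {..n} \<otimes>\<^bsub>G n\<^esub>
          finprod (G n) (\<lambda>p. \<mu> p (n - p) (z p) (y (n - p))) {..n}" for n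
    proof -
      interpret N: comm_group "G n" by (rule comm_group)
      have "finprod (G n) (\<lambda>p. \<mu> p (n - p) (z p) (x (n - p) \<otimes>\<^bsub>G (n - p)\<^esub> y (n - p))) {..n}
          = finprod (G n) (\<lambda>p. \<mu> p (n - p) (z p) (x (n - p)) \<otimes>\<^bsub>G n\<^esub> \<mu> p (n - p) (z p) (y (n - p))) {..n}"
        using distrib_left[OF c(3,1,2)] by (intro N.finprod_cong') (auto intro!: closed' c)
      then show ?thesis
        by (subst (asm) N.finprod_multf) (auto intro!: closed' c)
    qed
    then show "z \<otimes>\<^bsub>?R\<^esub> (x \<oplus>\<^bsub>?R\<^esub> y) = z \<otimes>\<^bsub>?R\<^esub> x \<oplus>\<^bsub>?R\<^esub> z \<otimes>\<^bsub>?R\<^esub> y"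
      by (simp add: graded_sum_ring_sel)
  qed (rule abelian_group_graded_sum_ring)
qed

end

section \<open>Transport of a graded ring structure along a relation\<close>

locale graded_ring_correspondence = graded_ring_data G \<mu> e
  for G :: "nat \<Rightarrow> 'c monoid" and \<mu> e +
  fixes G' :: "nat \<Rightarrow> 'd monoid" and \<mu>' :: "nat \<Rightarrow> nat \<Rightarrow> 'd \<Rightarrow> 'd \<Rightarrow> 'd" and e' :: 'd
    and rel :: "nat \<Rightarrow> 'c \<Rightarrow> 'd \<Rightarrow> bool"
  assumes comm_group': "comm_group (G' n)"
    and rel_carrier: "rel n x y \<Longrightarrow> x \<in> carrier (G n) \<and> y \<in> carrier (G' n)"
    and rel_left: "x \<in> carrier (G n) \<Longrightarrow> \<exists>y. rel n x y"
    and rel_right: "y \<in> carrier (G' n) \<Longrightarrow> \<exists>x. rel n x y"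
    and rel_mult: "rel n x y \<Longrightarrow> rel n x' y' \<Longrightarrow> rel n (x \<otimes>\<^bsub>G n\<^esub> x') (y \<otimes>\<^bsub>G' n\<^esub> y')"
    and rel_one: "rel n x y \<Longrightarrow> x = \<one>\<^bsub>G n\<^esub> \<longleftrightarrow> y = \<one>\<^bsub>G' n\<^esub>"
    and rel_prod: "rel p x y \<Longrightarrow> rel q x' y' \<Longrightarrow> rel (p + q) (\<mu> p q x x') (\<mu>' p q y y')"
    and rel_unit: "rel 0 e e'"
begin

text \<open>Compatibility with products and \<open>rel_one\<close> turn the relation into a
  bijection: a partner of the inverse of \<open>x'\<close> must be the inverse of \<open>y'\<close>,
  so the quotient of \<open>x\<close> and \<open>x'\<close> is the unit exactly when that of
  \<open>y\<close> and \<open>y'\<close> is.\<close>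

lemma rel_unique:
  assumes "rel n x y" "rel n x' y'"
  shows "x = x' \<longleftrightarrow> y = y'"
proof -
  interpret N: comm_group "G n" by (rule comm_group)
  interpret N': comm_group "G' n" by (rule comm_group')
  have c: "x \<in> carrier (G n)" "x' \<in> carrier (G n)" "y \<in> carrier (G' n)" "y' \<in> carrier (G' n)"
    using assms rel_carrier by auto
  obtain w where w: "rel n (inv\<^bsub>G n\<^esub> x') w"
    using rel_left[of "inv\<^bsub>G n\<^esub> x'" n] c by auto
  then have wc: "w \<in> carrier (G' n)" using rel_carrier by auto
  have "y' \<otimes>\<^bsub>G' n\<^esub> w = \<one>\<^bsub>G' n\<^esub>"
    using rel_one[OF rel_mult[OF assms(2) w]] c by simp
  then have w': "w = inv\<^bsub>G' n\<^esub> y'"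
    using c wc N'.inv_equality N'.m_comm by metis
  have "x = x' \<longleftrightarrow> x \<otimes>\<^bsub>G n\<^esub> inv\<^bsub>G n\<^esub> x' = \<one>\<^bsub>G n\<^esub>"
    using c by (metis N.inv_equality N.inv_inv N.inv_closed N.r_inv)
  also have "\<dots> \<longleftrightarrow> y \<otimes>\<^bsub>G' n\<^esub> inv\<^bsub>G' n\<^esub> y' = \<one>\<^bsub>G' n\<^esub>"
    using rel_one[OF rel_mult[OF assms(1) w]] w' by simp
  also have "\<dots> \<longleftrightarrow> y = y'"
    using c by (metis N'.inv_equality N'.inv_inv N'.inv_closed N'.r_inv)
  finally show ?thesis .
qed

text \<open>Each identity is lifted to the \<open>G\<close> side by \<open>rel_right\<close>, holds
  there, and descends by uniqueness. Biadditivity and associativity on the \<open>G'\<close> side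
  are thus inherited and never computed.\<close>

lemma graded_ring_data': "graded_ring_data G' \<mu>' e'"
proof (rule graded_ring_data.intro)
  show "comm_group (G' n)" for n by (rule comm_group')
  show "\<mu>' p q x y \<in> carrier (G' (p + q))" if "x \<in> carrier (G' p)" "y \<in> carrier (G' q)" for p q x y
    using that rel_right rel_prod rel_carrier by meson
  show "\<mu>' p q x (y \<otimes>\<^bsub>G' q\<^esub> y') = \<mu>' p q x y \<otimes>\<^bsub>G' (p + q)\<^esub> \<mu>' p q x y'"
    if "x \<in> carrier (G' p)" "y \<in> carrier (G' q)" "y' \<in> carrier (G' q)" for p q x y y'
  proof -
    from rel_right that obtain a b b' where r: "rel p a x" "rel q b y" "rel q b' y'"
      by meson
    show ?thesis
      using rel_unique[OF rel_prod[OF r(1) rel_mult[OF r(2,3)]] rel_mult[OF rel_prod[OF r(1,2)] rel_prod[OF r(1,3)]]]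
        distrib_left rel_carrier r by blast
  qed
  show "\<mu>' p q (x \<otimes>\<^bsub>G' p\<^esub> x') y = \<mu>' p q x y \<otimes>\<^bsub>G' (p + q)\<^esub> \<mu>' p q x' y"
    if "x \<in> carrier (G' p)" "x' \<in> carrier (G' p)" "y \<in> carrier (G' q)" for p q x x' y
  proof -
    from rel_right that obtain a a' b where r: "rel p a x" "rel p a' x'" "rel q b y"
      by meson
    show ?thesis
      using rel_unique[OF rel_prod[OF rel_mult[OF r(1,2)] r(3)] rel_mult[OF rel_prod[OF r(1,3)] rel_prod[OF r(2,3)]]]
        distrib_right rel_carrier r by blast
  qed
  show "\<mu>' (p + q) r (\<mu>' p q x y) z = \<mu>' p (q + r) x (\<mu>' q r y z)"
    if "x \<in> carrier (G' p)" "y \<in> carrier (G' q)" "z \<in> carrier (G' r)" for p q r x y z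
  proof -
    from rel_right that obtain a b c where r: "rel p a x" "rel q b y" "rel r c z"
      by meson
    have "rel (p + q + r) (\<mu> p (q + r) a (\<mu> q r b c)) (\<mu>' p (q + r) x (\<mu>' q r y z))"
      using rel_prod[OF r(1) rel_prod[OF r(2,3)]] by (simp add: add.assoc)
    from rel_unique[OF rel_prod[OF rel_prod[OF r(1,2)] r(3)] this]
    show ?thesis
      using assoc rel_carrier r by blast
  qed
  show "e' \<in> carrier (G' 0)"
    using rel_unit rel_carrier by auto
  show "\<mu>' 0 p e' x = x" if "x \<in> carrier (G' p)" for p x
  proof -
    from rel_right that obtain a where r: "rel p a x" by meson
    have "rel p (\<mu> 0 p e a) (\<mu>' 0 p e' x)"
      using rel_prod[OF rel_unit r] by simp
    from rel_unique[OF this r] show ?thesis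
      using unit_left rel_carrier r by blast
  qed
  show "\<mu>' p 0 x e' = x" if "x \<in> carrier (G' p)" for p x
  proof -
    from rel_right that obtain a where r: "rel p a x" by meson
    have "rel p (\<mu> p 0 a e) (\<mu>' p 0 x e')"
      using rel_prod[OF r rel_unit] by simp
    from rel_unique[OF this r] show ?thesis
      using unit_right rel_carrier r by blast
  qed
qed

theorem graded_ring_isomorphic: "graded_ring_isomorphic (graded_sum_ring G \<mu> e) (graded_sum_ring G' \<mu>' e')"
proof -
  let ?R = "graded_sum_ring G \<mu> e" and ?S = "graded_sum_ring G' \<mu>' e'"
  interpret D': graded_ring_data G' \<mu>' e' by (rule graded_ring_data')
  define h where "h = (\<lambda>n x. SOME y. rel n x y)"
  have rel_h: "rel n x (h n x)" if "x \<in> carrier (G n)" for n x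
    unfolding h_def using rel_left[OF that] by (rule someI_ex)
  have h_eq: "h n x = y" if "rel n x y" for n x y
    using rel_unique[OF rel_h that] rel_carrier[OF that] by auto
  have hc: "h n x \<in> carrier (G' n)" if "x \<in> carrier (G n)" for n x
    using rel_h[OF that] rel_carrier by auto
  have h_one: "h n x = \<one>\<^bsub>G' n\<^esub> \<longleftrightarrow> x = \<one>\<^bsub>G n\<^esub>" if "x \<in> carrier (G n)" for n x
    using rel_one[OF rel_h[OF that]] by auto
  have h_one': "h n \<one>\<^bsub>G n\<^esub> = \<one>\<^bsub>G' n\<^esub>" for n
    using h_one comm_group monoid.one_closed[OF group.is_monoid[OF comm_group.axioms(2)[OF comm_group]]] by auto
  have h_mult: "h n (x \<otimes>\<^bsub>G n\<^esub> y) = h n x \<otimes>\<^bsub>G' n\<^esub> h n y" if "x \<in> carrier (G n)" "y \<in> carrier (G n)" for n x y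
    using that by (intro h_eq rel_mult rel_h)
  have h_prod: "h n (\<mu> p (n - p) x y) = \<mu>' p (n - p) (h p x) (h (n - p) y)"
    if "x \<in> carrier (G p)" "y \<in> carrier (G (n - p))" "p \<le> n" for n p x y
    using h_eq[OF rel_prod[OF rel_h[OF that(1)] rel_h[OF that(2)]]] that(3) by simp
  have h_inj: "x = y" if "h n x = h n y" "x \<in> carrier (G n)" "y \<in> carrier (G n)" for n x y
    using rel_unique[OF rel_h rel_h, of x n y] that by auto
  define H where "H = (\<lambda>x n. h n (x n))"
  define K where "K = (\<lambda>y n. SOME x. rel n x (y n))"
  have cR: "x \<in> carrier ?R \<longleftrightarrow> (\<forall>n. x n \<in> carrier (G n)) \<and> finite {n. x n \<noteq> \<one>\<^bsub>G n\<^esub>}" for x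
    by (simp add: carrier_graded_sum_ring comm_group)
  have cS: "x \<in> carrier ?S \<longleftrightarrow> (\<forall>n. x n \<in> carrier (G' n)) \<and> finite {n. x n \<noteq> \<one>\<^bsub>G' n\<^esub>}" for x
    by (simp add: carrier_graded_sum_ring comm_group')
  have Hc: "H x \<in> carrier ?S" if "x \<in> carrier ?R" for x
    using that by (simp add: cR cS H_def hc h_one)
  have K: "K y \<in> carrier ?R" "H (K y) = y" if "y \<in> carrier ?S" for y
  proof -
    have r: "rel n (K y n) (y n)" for n
      unfolding K_def using that rel_right[of "y n" n] by (auto simp: cS intro: someI_ex)
    then have "{n. K y n \<noteq> \<one>\<^bsub>G n\<^esub>} = {n. y n \<noteq> \<one>\<^bsub>G' n\<^esub>}"
      using rel_one by blast
    then show "K y \<in> carrier ?R"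
      using that rel_carrier[OF r] by (simp add: cR cS)
    show "H (K y) = y"
      using h_eq[OF r] by (simp add: H_def fun_eq_iff)
  qed
  have inj: "inj_on H (carrier ?R)"
    by (rule inj_onI) (auto simp: H_def cR fun_eq_iff intro: h_inj)
  have "H \<in> ring_iso ?R ?S"
  proof (rule ring_iso_memI)
    show "bij_betw H (carrier ?R) (carrier ?S)"
      unfolding bij_betw_def using inj Hc K by (auto intro!: image_eqI[where x = "K _"])
    show "H (x \<otimes>\<^bsub>?R\<^esub> y) = H x \<otimes>\<^bsub>?S\<^esub> H y" if "x \<in> carrier ?R" "y \<in> carrier ?R" for x y
    proof
      fix n
      interpret N': comm_group "G' n" by (rule comm_group')
      have c: "x n \<in> carrier (G n)" "y n \<in> carrier (G n)" for n
        using that by (auto simp: cR)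
      have "H (x \<otimes>\<^bsub>?R\<^esub> y) n = h n (finprod (G n) (\<lambda>p. \<mu> p (n - p) (x p) (y (n - p))) {..n})"
        by (simp add: H_def graded_sum_ring_sel)
      also have "\<dots> = finprod (G' n) (\<lambda>p. h n (\<mu> p (n - p) (x p) (y (n - p)))) {..n}"
        by (rule finprod_hom) (auto intro: comm_group comm_group' hc h_mult closed' c)
      also have "\<dots> = finprod (G' n) (\<lambda>p. \<mu>' p (n - p) (h p (x p)) (h (n - p) (y (n - p)))) {..n}"
        by (rule N'.finprod_cong') (auto simp: h_prod c intro!: D'.closed' hc c)
      also have "\<dots> = (H x \<otimes>\<^bsub>?S\<^esub> H y) n"
        by (simp add: H_def graded_sum_ring_sel)
      finally show "H (x \<otimes>\<^bsub>?R\<^esub> y) n = (H x \<otimes>\<^bsub>?S\<^esub> H y) n" .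
    qed
    show "H (x \<oplus>\<^bsub>?R\<^esub> y) = H x \<oplus>\<^bsub>?S\<^esub> H y" if "x \<in> carrier ?R" "y \<in> carrier ?R" for x y
      using that by (simp add: H_def graded_sum_ring_sel h_mult cR)
    show "H \<one>\<^bsub>?R\<^esub> = \<one>\<^bsub>?S\<^esub>"
      using h_eq[OF rel_unit] h_one' by (auto simp: H_def graded_sum_ring_sel fun_eq_iff)
  qed (rule Hc)
  moreover have "H ` homogeneous ?R n = homogeneous ?S n" for n
  proof (intro equalityI subsetI)
    fix y assume "y \<in> H ` homogeneous ?R n"
    then show "y \<in> homogeneous ?S n"
      using Hc by (auto simp: homogeneous_def graded_sum_ring_sel H_def h_one')
  next
    fix y assume y: "y \<in> homogeneous ?S n"
    then have "y \<in> carrier ?S" by (simp add: homogeneous_def)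
    note K = K[OF this]
    have "K y k = \<one>\<^bsub>G k\<^esub>" if "k \<noteq> n" for k
    proof -
      have "h k (K y k) = y k"
        using fun_cong[OF K(2), of k] by (simp add: H_def)
      moreover have "y k = \<one>\<^bsub>G' k\<^esub>"
        using y that by (simp add: homogeneous_def graded_sum_ring_sel)
      moreover have "K y k \<in> carrier (G k)"
        using K(1) by (simp add: cR)
      ultimately show ?thesis
        using h_one by simp
    qed
    then have "K y \<in> homogeneous ?R n"
      using K by (simp add: homogeneous_def graded_sum_ring_sel)
    then show "y \<in> H ` homogeneous ?R n"
      using K(2) by (metis imageI)
  qed
  ultimately show ?thesis
    unfolding graded_ring_isomorphic_def using ring_graded_sum_ring D'.ring_graded_sum_ring by blast
qed

end

section \<open>Homotopy invariance on the chain level\<close>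

text \<open>Contracting \<open>W\<close> makes \<open>c\<close> homologous to its image under a
  constant map, a cycle in a one-point space. There every cycle of positive degree bounds; hence the
  degree \<open>Suc p\<close>.\<close>

lemma contractible_imp_cycle_boundary:
  assumes W: "contractible_space W" and c: "singular_chain (Suc p) W c" "chain_boundary (Suc p) c = 0"
  obtains d where "singular_chain (Suc (Suc p)) W d" "chain_boundary (Suc (Suc p)) d = c"
proof (cases "topspace W = {}")
  case True
  then have "c = 0" using c by (simp add: singular_chain_empty)
  then show ?thesis using that[of 0] by simp
next
  case False
  obtain a where hom: "homotopic_with (\<lambda>x. True) W W id (\<lambda>x. a)"
    using W by (auto simp: contractible_space_def)
  have cyc: "singular_relcycle (Suc p) W {} c"
    using c by (simp add: singular_cycle)
  have cont: "continuous_map W W (\<lambda>x. a)"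
    using hom homotopic_with_imp_continuous_maps by blast
  with False have a: "a \<in> topspace W"
    by (auto simp: continuous_map_def)
  have "homologous_rel (Suc p) W {} (chain_map (Suc p) id c) (chain_map (Suc p) (\<lambda>x. a) c)"
    by (rule homotopic_imp_homologous_rel_chain_maps[where T = "{}" and S = W, OF _ cyc]) (use hom in simp)
  then have 1: "singular_relboundary (Suc p) W {} (c - chain_map (Suc p) (\<lambda>x. a) c)"
    using c by (simp add: homologous_rel_def chain_map_ident)
  have "singular_relcycle (Suc p) (subtopology W {a}) {} (chain_map (Suc p) (\<lambda>x. a) c)"
    by (rule singular_relcycle_chain_map[OF cyc]) (use cont a in \<open>auto simp: continuous_map_in_subtopology\<close>)
  then have "singular_relboundary (Suc p) (subtopology W {a}) {} (chain_map (Suc p) (\<lambda>x. a) c)"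
    using singular_boundary_eq_cycle_singleton[of "subtopology W {a}" a "Suc p"] a by simp
  then have "singular_relboundary (Suc p) W {} (chain_map (Suc p) (\<lambda>x. a) c)"
    using singular_boundary_mono[of "{a}" "topspace W" "Suc p" W] a by simp
  from singular_relboundary_add[OF 1 this] show ?thesis
    using that by (auto simp: singular_boundary)
qed

lemma contractible_space_standard_simplex:
  "contractible_space (subtopology (powertop_real UNIV) (standard_simplex p))"
proof -
  let ?S = "subtopology (powertop_real UNIV) (standard_simplex p)"
  define a :: "nat \<Rightarrow> real" where "a = (\<lambda>j. if j = 0 then 1 else 0)"
  have a: "a \<in> standard_simplex p"
    by (simp add: a_def)
  define h where "h = (\<lambda>(t, x) i. (1 - t) * x i + t * a i)"
  have "continuous_map (prod_topology (top_of_set {0..1}) ?S) euclideanreal (\<lambda>z. h z i)" for i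
  proof -
    have "continuous_map (prod_topology (top_of_set {0..1::real}) ?S) euclideanreal fst"
      by (metis continuous_map_fst continuous_map_into_fulltopology)
    moreover have "continuous_map ?S euclideanreal (\<lambda>x. x i)"
      by (auto intro: continuous_map_from_subtopology continuous_map_product_projection)
    then have "continuous_map (prod_topology (top_of_set {0..1::real}) ?S) euclideanreal (\<lambda>z. snd z i)"
      using continuous_map_compose[OF continuous_map_snd] by (fastforce simp: o_def)
    ultimately show ?thesis
      by (auto simp: h_def case_prod_unfold intro!: continuous_map_add continuous_map_real_mult continuous_map_diff)
  qed
  then have "continuous_map (prod_topology (top_of_set {0..1}) ?S) ?S h"
    using a by (auto simp: continuous_map_in_subtopology continuous_map_componentwise_UNIV h_def
        intro!: convex_standard_simplex)
  moreover have "h (0, x) = id x" "h (1, x) = a" for x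
    by (auto simp: h_def)
  ultimately have "homotopic_with (\<lambda>x. True) ?S ?S id (\<lambda>x. a)"
    unfolding homotopic_with_def by auto
  then show ?thesis
    unfolding contractible_space_def by blast
qed

text \<open>
  The library proves homotopy invariance of homology but keeps the prism operator hidden inside the
  proof.  Cochains need the operator itself; it is rebuilt here from acyclic models, the prism
  \<open>[0,1] \<times> \<Delta>\<^sup>q\<close> being contractible.
\<close>

abbreviation simplex_space :: "nat \<Rightarrow> (nat \<Rightarrow> real) topology" where
  "simplex_space q \<equiv> subtopology (powertop_real UNIV) (standard_simplex q)"

abbreviation cylinder :: "'a topology \<Rightarrow> (real \<times> 'a) topology" where
  "cylinder X \<equiv> prod_topology (top_of_set {0..1}) X"

text \<open>The value \<open>P\<close> on the identity simplex determines a natural operator: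
  \<sigma> transports it by \<open>(t, x) \<mapsto> (t, \<sigma> x)\<close>. With \<open>P\<close>
  as a parameter, the recursion for \<open>prism_model\<close> can use the operator one degree lower
  before \<open>prism\<close> exists.\<close>

definition prism_from ::
    "(real \<times> (nat \<Rightarrow> real)) chain \<Rightarrow> nat \<Rightarrow> 'a chain \<Rightarrow> (real \<times> 'a) chain" where
  "prism_from P q = frag_extend (\<lambda>\<sigma>. chain_map (Suc q) (\<lambda>(t, x). (t, \<sigma> x)) P)"

definition id_simplex :: "nat \<Rightarrow> (nat \<Rightarrow> real) chain" where
  "id_simplex q = frag_of (restrict id (standard_simplex q))"

text \<open>A chain filling the prism over the standard simplex: its boundary is top minus bottom
  minus the walls, that is, the prism over the boundary. In degree 0 there are no walls. Such
  fillings exist by \<open>prism_model_spec\<close>, whose proof relies on naturality.\<close>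

primrec prism_model :: "nat \<Rightarrow> (real \<times> (nat \<Rightarrow> real)) chain" where
  "prism_model 0 = (SOME d. singular_chain (Suc 0) (cylinder (simplex_space 0)) d \<and>
     chain_boundary (Suc 0) d = chain_map 0 (Pair 1) (id_simplex 0) - chain_map 0 (Pair 0) (id_simplex 0))"
| "prism_model (Suc q) = (SOME d. singular_chain (Suc (Suc q)) (cylinder (simplex_space (Suc q))) d \<and>
     chain_boundary (Suc (Suc q)) d = chain_map (Suc q) (Pair 1) (id_simplex (Suc q)) - chain_map (Suc q) (Pair 0) (id_simplex (Suc q))
       - prism_from (prism_model q) q (chain_boundary (Suc q) (id_simplex (Suc q))))"

definition prism :: "nat \<Rightarrow> 'a chain \<Rightarrow> (real \<times> 'a) chain" where
  "prism q = prism_from (prism_model q) q"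

lemma prism_0 [simp]: "prism q 0 = 0"
  by (simp add: prism_def prism_from_def)

lemma prism_diff: "prism q (a - b) = prism q a - prism q b"
  by (simp add: prism_def prism_from_def frag_extend_diff)

lemma prism_of: "prism q (frag_of \<sigma>) = chain_map (Suc q) (\<lambda>(t, x). (t, \<sigma> x)) (prism_model q)"
  by (simp add: prism_def prism_from_def)

lemma continuous_map_cylinder:
  assumes "continuous_map X Y f"
  shows "continuous_map (cylinder X) (cylinder Y) (\<lambda>(t, x). (t, f x))"
  using continuous_map_compose[OF continuous_map_snd assms, of "top_of_set {0..1::real}"]
  by (simp add: case_prod_unfold continuous_map_paired continuous_map_fst o_def)

text \<open>The property of the model is a hypothesis, here, in \<open>prism_natural\<close> and in
  \<open>prism_boundary_of\<close>, since these facts serve in the induction that establishes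
  it.\<close>

lemma singular_chain_prism_of:
  assumes "singular_chain (Suc q) (cylinder (simplex_space q)) (prism_model q)" "singular_chain q X c"
  shows "singular_chain (Suc q) (cylinder X) (prism q c)"
  unfolding prism_def prism_from_def
proof (rule singular_chain_extend)
  fix \<sigma> assume "\<sigma> \<in> Poly_Mapping.keys c"
  then have "continuous_map (simplex_space q) X \<sigma>"
    using assms(2) by (auto simp: singular_chain_def singular_simplex_def)
  then show "singular_chain (Suc q) (cylinder X) (chain_map (Suc q) (\<lambda>(t, x). (t, \<sigma> x)) (prism_model q))"
    by (rule singular_chain_chain_map[OF assms(1) continuous_map_cylinder])
qed

lemma prism_natural:
  assumes "singular_chain q X c" "singular_chain (Suc q) (cylinder (simplex_space q)) (prism_model q)"
  shows "chain_map (Suc q) (\<lambda>(t, x). (t, f x)) (prism q c) = prism q (chain_map q f c)"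
  using assms(1) unfolding singular_chain_def
proof (induction c rule: frag_induction)
  case (one \<sigma>)
  have "chain_map (Suc q) (\<lambda>(t, x). (t, f x)) (chain_map (Suc q) (\<lambda>(t, x). (t, \<sigma> x)) (prism_model q))
      = chain_map (Suc q) ((\<lambda>(t, x). (t, f x)) \<circ> (\<lambda>(t, x). (t, \<sigma> x))) (prism_model q)"
    by (simp add: chain_map_compose)
  also have "\<dots> = chain_map (Suc q) (\<lambda>(t, x). (t, simplex_map q f \<sigma> x)) (prism_model q)"
    by (rule chain_map_eq[OF assms(2)]) (auto simp: simplex_map_def)
  finally show ?case
    by (simp add: prism_of)
qed (auto simp: chain_map_diff prism_diff)

lemma singular_simplex_id_simplex: "singular_simplex q (simplex_space q) (restrict id (standard_simplex q))"
proof -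
  have "continuous_map (simplex_space q) (simplex_space q) (restrict id (standard_simplex q))"
    by (rule continuous_map_eq[OF continuous_map_id]) simp
  then show ?thesis
    by (simp add: singular_simplex_def)
qed

lemma singular_chain_id_simplex: "singular_chain q (simplex_space q) (id_simplex q)"
  by (simp add: id_simplex_def singular_chain_of singular_simplex_id_simplex)

lemma continuous_map_Pair_cylinder: "t \<in> {0..1} \<Longrightarrow> continuous_map X (cylinder X) (Pair t)"
  by (simp add: continuous_map_pairwise o_def)

text \<open>By naturality the formula needs checking only on the identity simplex, of which every
  \<sigma> is an image. For \<open>q = 0\<close> the term with index \<open>q - 1\<close> vanishes
  because the boundary of a 0-chain is 0.\<close>

lemma prism_boundary_of:
  assumes model: "singular_chain (Suc q) (cylinder (simplex_space q)) (prism_model q)"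
    and bd: "chain_boundary (Suc q) (prism_model q) = chain_map q (Pair 1) (id_simplex q) - chain_map q (Pair 0) (id_simplex q)
         - prism (q - 1) (chain_boundary q (id_simplex q))"
    and model': "q > 0 \<Longrightarrow> singular_chain q (cylinder (simplex_space (q - 1))) (prism_model (q - 1))"
    and c: "singular_chain q X c"
  shows "chain_boundary (Suc q) (prism q c) = chain_map q (Pair 1) c - chain_map q (Pair 0) c - prism (q - 1) (chain_boundary q c)"
  using c unfolding singular_chain_def
proof (induction c rule: frag_induction)
  case (one \<sigma>)
  then have \<sigma>: "singular_simplex q X \<sigma>" by simp
  define S where "S = (\<lambda>(t::real, x). (t, \<sigma> x))"
  have 1: "chain_map q S (chain_map q (Pair t) (id_simplex q)) = chain_map q (Pair t) (frag_of \<sigma>)" for t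
  proof -
    have "S \<circ> Pair t = Pair t \<circ> \<sigma>"
      by (auto simp: S_def)
    then have "chain_map q S (chain_map q (Pair t) (id_simplex q)) = chain_map q (Pair t \<circ> \<sigma>) (id_simplex q)"
      by (metis chain_map_compose comp_apply)
    also have "\<dots> = chain_map q (Pair t) (chain_map q \<sigma> (id_simplex q))"
      by (simp only: chain_map_compose o_apply)
    finally show ?thesis
      unfolding singular_simplex_chain_map_id[OF \<sigma>, folded id_simplex_def] .
  qed
  have 2: "chain_map q S (prism (q - 1) (chain_boundary q (id_simplex q))) = prism (q - 1) (chain_boundary q (frag_of \<sigma>))"
  proof (cases q)
    case (Suc r)
    have "chain_map q S (prism (q - 1) (chain_boundary q (id_simplex q)))
        = prism r (chain_map r \<sigma> (chain_boundary q (id_simplex q)))"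
      unfolding S_def using Suc model' singular_chain_boundary_alt[OF singular_chain_id_simplex[of "Suc r"]]
      by (simp add: prism_natural)
    also have "chain_map r \<sigma> (chain_boundary q (id_simplex q)) = chain_boundary q (chain_map q \<sigma> (id_simplex q))"
      using chain_boundary_chain_map[OF singular_chain_id_simplex[of q], of \<sigma>] Suc by simp
    finally show ?thesis
      unfolding singular_simplex_chain_map_id[OF \<sigma>, folded id_simplex_def] using Suc by simp
  qed (simp add: chain_boundary_def)
  have "chain_boundary (Suc q) (prism q (frag_of \<sigma>)) = chain_map q S (chain_boundary (Suc q) (prism_model q))"
    using chain_boundary_chain_map[OF model, of S] by (simp add: prism_of S_def)
  then show ?case
    unfolding bd by (simp only: chain_map_diff 1 2)
qed (auto simp: chain_map_diff prism_diff chain_boundary_diff)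

lemma contractible_space_cylinder: "contractible_space (cylinder (simplex_space q))"
proof -
  have "contractible_space (top_of_set {0..1::real})"
    by (simp add: convex_imp_contractible)
  then show ?thesis
    unfolding contractible_space_prod_topology using contractible_space_standard_simplex by blast
qed

text \<open>The prescribed boundary is a cycle by the formula one degree lower, and the cylinder is
  contractible, so a filling exists.\<close>

lemma prism_model_spec:
  "singular_chain (Suc q) (cylinder (simplex_space q)) (prism_model q) \<and>
   chain_boundary (Suc q) (prism_model q) = chain_map q (Pair 1) (id_simplex q) - chain_map q (Pair 0) (id_simplex q)
         - prism (q - 1) (chain_boundary q (id_simplex q))"
proof (induction q rule: less_induct)
  case (less n)
  show ?case
  proof (cases n)
    case 0
    \<comment> \<open>Acyclicity starts in degree 1, so the base case uses that the two end
      inclusions are homotopic, via \<open>(t, x) \<mapsto> (1 - t, x)\<close>.\<close>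
    have "homotopic_with (\<lambda>h. h \<in> {} \<rightarrow> {}) (simplex_space 0) (cylinder (simplex_space 0)) (Pair 1) (Pair 0)"
      unfolding homotopic_with_def
    proof (intro exI conjI)
      have "continuous_map (cylinder (simplex_space 0)) (top_of_set {0..1}) (\<lambda>z. 1 - fst z)"
        by (auto simp: continuous_map_in_subtopology
            intro!: continuous_map_diff continuous_map_into_fulltopology[OF continuous_map_fst])
      then show "continuous_map (cylinder (simplex_space 0)) (cylinder (simplex_space 0)) (\<lambda>(t, x). (1 - t, x))"
        by (simp add: case_prod_unfold continuous_map_paired continuous_map_snd)
    qed auto
    from homotopic_imp_homologous_rel_chain_maps[OF this, of 0 "id_simplex 0"]
    have "singular_relboundary 0 (cylinder (simplex_space 0)) {}
        (chain_map 0 (Pair 1) (id_simplex 0) - chain_map 0 (Pair 0) (id_simplex 0))"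
      by (simp add: singular_cycle singular_chain_id_simplex chain_boundary_def homologous_rel_def
          del: chain_map_of)
    then obtain d where "singular_chain (Suc 0) (cylinder (simplex_space 0)) d"
       "chain_boundary (Suc 0) d = chain_map 0 (Pair 1) (id_simplex 0) - chain_map 0 (Pair 0) (id_simplex 0)"
      by (auto simp: singular_boundary simp del: chain_map_of)
    then have "\<exists>d. singular_chain (Suc 0) (cylinder (simplex_space 0)) d \<and>
       chain_boundary (Suc 0) d = chain_map 0 (Pair 1) (id_simplex 0) - chain_map 0 (Pair 0) (id_simplex 0)"
      by blast
    moreover have "chain_boundary 0 (id_simplex 0) = 0"
      by (simp add: chain_boundary_def)
    ultimately show ?thesis
      unfolding 0 prism_model.simps by (metis (mono_tags, lifting) diff_zero prism_0 someI_ex)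
  next
    case (Suc q)
    let ?S = "simplex_space (Suc q)"
    let ?i = "id_simplex (Suc q)"
    let ?z = "chain_map (Suc q) (Pair 1) ?i - chain_map (Suc q) (Pair 0) ?i - prism q (chain_boundary (Suc q) ?i)"
    have IH: "singular_chain (Suc q) (cylinder (simplex_space q)) (prism_model q)"
      "chain_boundary (Suc q) (prism_model q) = chain_map q (Pair 1) (id_simplex q) - chain_map q (Pair 0) (id_simplex q)
           - prism (q - 1) (chain_boundary q (id_simplex q))"
      using less.IH[of q] lessI[of q] unfolding Suc by blast+
    have model': "0 < q \<Longrightarrow> singular_chain q (cylinder (simplex_space (q - 1))) (prism_model (q - 1))"
      using less.IH[of "q - 1"] Suc by simp
    have ch: "singular_chain (Suc q) ?S ?i"
      by (rule singular_chain_id_simplex)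
    have z: "singular_chain (Suc q) (cylinder ?S) ?z"
      using IH ch by (intro singular_chain_diff singular_chain_chain_map[OF ch] singular_chain_prism_of
          singular_chain_boundary_alt continuous_map_Pair_cylinder) auto
    \<comment> \<open>The boundaries of the two ends cancel against those of the walls; what remains
      is the prism over a double boundary.\<close>
    have "chain_boundary (Suc q) ?z = 0"
    proof -
      have "chain_boundary (Suc q) (chain_map (Suc q) (Pair t) ?i) = chain_map q (Pair t) (chain_boundary (Suc q) ?i)" for t :: real
        using chain_boundary_chain_map[OF ch, of "Pair t"] by simp
      moreover have "chain_boundary (Suc q) (prism q (chain_boundary (Suc q) ?i))
         = chain_map q (Pair 1) (chain_boundary (Suc q) ?i) - chain_map q (Pair 0) (chain_boundary (Suc q) ?i)
           - prism (q - 1) (chain_boundary q (chain_boundary (Suc q) ?i))"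
        using IH model' singular_chain_boundary_alt[OF ch] by (intro prism_boundary_of) auto
      ultimately show ?thesis
        using chain_boundary_boundary[OF ch] by (simp add: chain_boundary_diff del: chain_map_of)
    qed
    then obtain d where "singular_chain (Suc (Suc q)) (cylinder ?S) d" "chain_boundary (Suc (Suc q)) d = ?z"
      by (rule contractible_imp_cycle_boundary[OF contractible_space_cylinder z])
    then have "\<exists>d. singular_chain (Suc (Suc q)) (cylinder ?S) d \<and> chain_boundary (Suc (Suc q)) d = ?z"
      by blast
    from someI_ex[OF this] Suc show ?thesis
      by (simp add: prism_def del: chain_map_of)
  qed
qed

lemma singular_chain_prism: "singular_chain q X c \<Longrightarrow> singular_chain (Suc q) (cylinder X) (prism q c)"
  using prism_model_spec singular_chain_prism_of by blast

lemma chain_boundary_prism: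
  assumes "singular_chain q X c"
  shows "chain_boundary (Suc q) (prism q c) = chain_map q (Pair 1) c - chain_map q (Pair 0) c - prism (q - 1) (chain_boundary q c)"
  using prism_model_spec[of q] prism_model_spec[of "q - 1"] assms by (intro prism_boundary_of) auto

section \<open>Pullback of cochains and invariance under homotopy\<close>

definition spullback :: "nat \<Rightarrow> 'a topology \<Rightarrow> 'a set set \<Rightarrow> ('a \<Rightarrow> 'b) \<Rightarrow> (((nat \<Rightarrow> real) \<Rightarrow> 'b) \<Rightarrow> int) \<Rightarrow>
    ((nat \<Rightarrow> real) \<Rightarrow> 'a) \<Rightarrow> int" where
  "spullback p X \<U> f u = (\<lambda>\<sigma>. if \<sigma> \<in> small_simplices X \<U> p then u (simplex_map p f \<sigma>) else 0)"

lemma simplex_map_small: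
  assumes "\<sigma> \<in> small_simplices X \<U> p" "continuous_map X Y f"
    and "\<And>A. A \<in> \<U> \<Longrightarrow> \<exists>B\<in>\<V>. f ` (A \<inter> topspace X) \<subseteq> B"
  shows "simplex_map p f \<sigma> \<in> small_simplices Y \<V> p"
proof -
  obtain A where s: "singular_simplex p X \<sigma>" and A: "A \<in> \<U>" "\<sigma> ` standard_simplex p \<subseteq> A"
    using assms(1) by (auto simp: small_simplices_def)
  obtain B where B: "B \<in> \<V>" "f ` (A \<inter> topspace X) \<subseteq> B"
    using assms(3)[OF A(1)] by blast
  have "\<sigma> ` standard_simplex p \<subseteq> topspace X"
    using s by (auto simp: singular_simplex_def continuous_map_def)
  then have "simplex_map p f \<sigma> ` standard_simplex p \<subseteq> B"
    using A B by (auto simp: simplex_map_def)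
  with B(1) s show ?thesis
    using singular_simplex_simplex_map[OF s assms(2)] by (auto simp: small_simplices_def simp del: image_subset_iff)
qed

lemma spullback_in_scochains:
  assumes "u \<in> scochains p Y \<V> \<A>" "continuous_map X Y f"
    and "\<And>B. B \<in> \<B> \<Longrightarrow> \<exists>A\<in>\<A>. f ` (B \<inter> topspace X) \<subseteq> A"
  shows "spullback p X \<U> f u \<in> scochains p X \<U> \<B>"
  using assms simplex_map_small[of _ X \<B> p Y f \<A>]
  by (auto simp: scochains_def spullback_def)

lemma simplex_map_face:
  "k \<le> Suc p \<Longrightarrow> singular_face (Suc p) k (simplex_map (Suc p) f \<sigma>) = simplex_map p f (singular_face (Suc p) k \<sigma>)"
  by (auto simp: singular_face_def simplex_map_def simplical_face_in_standard_simplex fun_eq_iff)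

lemma scoboundary_spullback:
  assumes "continuous_map X Y f" "\<And>A. A \<in> \<U> \<Longrightarrow> \<exists>B\<in>\<V>. f ` (A \<inter> topspace X) \<subseteq> B"
  shows "scoboundary p X \<U> (spullback p X \<U> f u) = spullback (Suc p) X \<U> f (scoboundary p Y \<V> u)"
proof
  fix \<sigma>
  show "scoboundary p X \<U> (spullback p X \<U> f u) \<sigma> = spullback (Suc p) X \<U> f (scoboundary p Y \<V> u) \<sigma>"
  proof (cases "\<sigma> \<in> small_simplices X \<U> (Suc p)")
    case True
    then have "simplex_map (Suc p) f \<sigma> \<in> small_simplices Y \<V> (Suc p)"
      using assms by (rule simplex_map_small)
    with True show ?thesis
      by (simp add: scoboundary_face_sum spullback_def simplex_map_face small_simplices_face del: sum.atMost_Suc)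
  qed (simp add: scoboundary_def spullback_def)
qed

lemma spullback_in_scocycles:
  assumes "u \<in> scocycles p Y \<V> \<A>" "continuous_map X Y f"
    and "\<And>B. B \<in> \<B> \<Longrightarrow> \<exists>A\<in>\<A>. f ` (B \<inter> topspace X) \<subseteq> A"
    and "\<And>A. A \<in> \<U> \<Longrightarrow> \<exists>B\<in>\<V>. f ` (A \<inter> topspace X) \<subseteq> B"
  shows "spullback p X \<U> f u \<in> scocycles p X \<U> \<B>"
proof -
  have "spullback (Suc p) X \<U> f 0 = 0"
    by (auto simp: spullback_def)
  then show ?thesis
    using assms spullback_in_scochains[of u p Y \<V> \<A> X f \<B> \<U>] scoboundary_spullback[of X Y f \<U> \<V> p u]
    by (auto simp: scocycles_def)
qed

lemma spullback_in_scoboundaries: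
  assumes "u \<in> scoboundaries p Y \<V> \<A>" "continuous_map X Y f"
    and "\<And>B. B \<in> \<B> \<Longrightarrow> \<exists>A\<in>\<A>. f ` (B \<inter> topspace X) \<subseteq> A"
    and "\<And>A. A \<in> \<U> \<Longrightarrow> \<exists>B\<in>\<V>. f ` (A \<inter> topspace X) \<subseteq> B"
  shows "spullback p X \<U> f u \<in> scoboundaries p X \<U> \<B>"
proof (cases p)
  case 0
  then show ?thesis using assms(1) by (auto simp: spullback_def)
next
  case (Suc r)
  then obtain w where w: "w \<in> scochains r Y \<V> \<A>" "u = scoboundary r Y \<V> w"
    using assms(1) by auto
  have "spullback p X \<U> f u = scoboundary r X \<U> (spullback r X \<U> f w)"
    using scoboundary_spullback[of X Y f \<U> \<V> r w] assms(2,4) w Suc by simp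
  then show ?thesis
    using Suc spullback_in_scochains[of w r Y \<V> \<A> X f \<B> \<U>] assms w by simp
qed

text \<open>The chain homotopy \<open>D\<close> built from the prism transposes to \<open>w\<close>,
  the value of \<open>u\<close> on \<open>D r \<tau>\<close>, which is a primitive of the difference
  because \<open>u\<close> is a cocycle. It vanishes on simplices in a member \<open>B\<close> since
  the homotopy sweeps \<open>B\<close> inside some member of \<A>. In degree 0 the two pullbacks are
  equal.\<close>

lemma homotopy_spullback:
  assumes h: "continuous_map (cylinder X) Y h"
    and AB: "\<And>B. B \<in> \<B> \<Longrightarrow> \<exists>A\<in>\<A>. h ` ({0..1} \<times> (B \<inter> topspace X)) \<subseteq> A"
    and u: "u \<in> scocycles p Y {UNIV} \<A>"
  shows "spullback p X {UNIV} (\<lambda>x. h (1, x)) u - spullback p X {UNIV} (\<lambda>x. h (0, x)) u \<in> scoboundaries p X {UNIV} \<B>"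
proof -
  define D where "D = (\<lambda>q c. chain_map (Suc q) h (prism q c))"
  have D: "singular_chain (Suc q) Y (D q c)" if "singular_chain q X c" for q c
    unfolding D_def using singular_chain_prism[OF that] h by (rule singular_chain_chain_map)
  have D0: "D q 0 = 0" and Ddiff: "D q (a - b) = D q a - D q b" for q a b
    by (simp_all add: D_def prism_diff chain_map_diff)
  have bd: "chain_boundary (Suc q) (D q c)
      = chain_map q (\<lambda>x. h (1, x)) c - chain_map q (\<lambda>x. h (0, x)) c - (if q = 0 then 0 else D (q - 1) (chain_boundary q c))"
    if c: "singular_chain q X c" for q c
  proof -
    have "h \<circ> Pair t = (\<lambda>x. h (t, x))" for t
      by auto
    then have "chain_map q h (chain_map q (Pair t) c) = chain_map q (\<lambda>x. h (t, x)) c" for t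
      using chain_map_compose[of q h "Pair t"] by simp
    then show ?thesis
      using chain_boundary_chain_map[OF singular_chain_prism[OF c], of h] chain_boundary_prism[OF c]
      by (cases q) (simp_all add: D_def chain_map_diff chain_boundary_def)
  qed
  have Dsmall: "pairing v (D q (frag_of \<sigma>)) = 0"
    if v: "v \<in> scochains (Suc q) Y {UNIV} \<A>" and \<sigma>: "\<sigma> \<in> small_simplices X \<B> q" for v q \<sigma>
  proof -
    obtain B where B: "B \<in> \<B>" "singular_simplex q (subtopology X B) \<sigma>"
      using \<sigma> by (auto simp: small_simplices_def singular_simplex_subtopology)
    obtain A where A: "A \<in> \<A>" "h ` ({0..1} \<times> (B \<inter> topspace X)) \<subseteq> A"
      using AB[OF B(1)] by blast
    have "continuous_map (subtopology X B) X (\<lambda>x. x)"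
      by (simp add: continuous_map_from_subtopology)
    from continuous_map_compose[OF continuous_map_cylinder[OF this] h]
    have "continuous_map (cylinder (subtopology X B)) Y h"
      by (simp add: o_def case_prod_unfold)
    then have "continuous_map (cylinder (subtopology X B)) (subtopology Y A) h"
      using A(2) by (auto simp: continuous_map_in_subtopology)
    \<comment> \<open>\<open>prism\<close> does not refer to the space, so the prism of \<sigma> can
      be formed in the cylinder over \<open>B\<close>, and its image lies in
      \<open>A\<close>.\<close>
    then have "singular_chain (Suc q) (subtopology Y A) (D q (frag_of \<sigma>))"
      unfolding D_def using B(2) singular_chain_of
      by (metis singular_chain_chain_map singular_chain_prism)
    then show ?thesis
      using A(1) by (intro pairing_eq_0 scochains_vanish[OF v])
        (auto simp: singular_chain_def small_simplices_def singular_simplex_subtopology subset_eq)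
  qed
  have main: "u (simplex_map p (\<lambda>x. h (1, x)) \<sigma>) - u (simplex_map p (\<lambda>x. h (0, x)) \<sigma>)
      = (if p = 0 then 0 else pairing u (D (p - 1) (chain_boundary p (frag_of \<sigma>))))"
    if \<sigma>: "singular_simplex p X \<sigma>" for \<sigma>
  proof -
    have c: "singular_chain p X (frag_of \<sigma>)" using \<sigma> by (simp add: singular_chain_of)
    have "pairing u (chain_boundary (Suc p) (D p (frag_of \<sigma>))) = pairing (scoboundary p Y {UNIV} u) (D p (frag_of \<sigma>))"
      using D[OF c] by (intro pairing_scoboundary[symmetric]) (simp add: singular_chain_def)
    also have "\<dots> = 0" using u by (simp add: scocycles_def)
    finally show ?thesis
      unfolding bd[OF c] by (auto simp: pairing_diff split: if_splits)
  qed
  show ?thesis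
  proof (cases p)
    case 0
    then have "spullback p X {UNIV} (\<lambda>x. h (1, x)) u - spullback p X {UNIV} (\<lambda>x. h (0, x)) u = 0"
      using main by (auto simp: spullback_def fun_eq_iff)
    then show ?thesis by simp
  next
    case (Suc r)
    define w where "w = (\<lambda>\<tau>. if singular_simplex r X \<tau> then pairing u (D r (frag_of \<tau>)) else 0)"
    have w: "w \<in> scochains r X {UNIV} \<B>"
      using u Suc Dsmall[of u r] by (auto simp: w_def scochains_def[of r] scocycles_def)
    have "pairing w (chain_boundary p (frag_of \<sigma>)) = pairing u (D r (chain_boundary p (frag_of \<sigma>)))"
      if "singular_simplex p X \<sigma>" for \<sigma>
    proof -
      have "pairing u (D r (chain_boundary p (frag_of \<sigma>)))
          = pairing (\<lambda>\<tau>. pairing u (D r (frag_of \<tau>))) (chain_boundary p (frag_of \<sigma>))"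
        by (rule pairing_additive) (simp_all add: D0 Ddiff)
      also have "\<dots> = pairing w (chain_boundary p (frag_of \<sigma>))"
        using that Suc small_chain_boundary[of \<sigma> X "{UNIV}" r] by (intro pairing_cong) (auto simp: w_def)
      finally show ?thesis ..
    qed
    then have "spullback p X {UNIV} (\<lambda>x. h (1, x)) u - spullback p X {UNIV} (\<lambda>x. h (0, x)) u = scoboundary r X {UNIV} w"
      using main Suc by (auto simp: spullback_def scoboundary_def fun_eq_iff)
    then show ?thesis
      using w Suc by simp
  qed
qed

section \<open>Small simplices and excision\<close>

text \<open>
  Write \<open>S\<close> for subdivision and \<open>h\<close> for the chain homotopy from \<open>id\<close> to \<open>S\<close>, so that
  \<open>T\<^sub>n = \<Sum>\<^sub>i\<^sub><\<^sub>n h S\<^sup>i\<close> is one from \<open>id\<close> to \<open>S\<^sup>n\<close>.  If \<open>u\<close> vanishes on small simplices, then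
  \<open>u (T\<^sub>n \<tau>)\<close> does not depend on \<open>n\<close> once \<open>S\<^sup>n \<tau>\<close> is small, and its negative is a primitive of \<open>u\<close>.
\<close>

lemma small_cochains_acyclic_open:
  assumes opn: "\<And>N. N \<in> \<N> \<Longrightarrow> openin Y N" and cover: "topspace Y \<subseteq> \<Union>\<N>"
    and u: "u \<in> scocycles (Suc p) Y {UNIV} \<N>"
  shows "u \<in> scoboundaries (Suc p) Y {UNIV} \<N>"
proof -
  obtain h :: "nat \<Rightarrow> 'a chain \<Rightarrow> 'a chain" where h0: "\<And>p. h p 0 = 0"
    and hdiff: "\<And>p a b. h p (a - b) = h p a - h p b"
    and hc: "\<And>p X c. singular_chain p X c \<Longrightarrow> singular_chain (Suc p) X (h p c)"
    and hbd: "\<And>p X c. singular_chain p X c \<Longrightarrow>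
       chain_boundary (Suc p) (h p c) + h (p - Suc 0) (chain_boundary p c) = singular_subdivision p c - c"
    using chain_homotopic_singular_subdivision by blast
  define S where "S = (\<lambda>p n. (singular_subdivision p ^^ n) :: 'a chain \<Rightarrow> 'a chain)"
  have S0: "S p 0 c = c" and SSuc: "S p (Suc n) c = singular_subdivision p (S p n c)" for p n c
    by (simp_all add: S_def)
  have Sc: "singular_chain p X (S p n c)" if "singular_chain p X c" for p X n c
    by (induction n) (auto simp: S0 SSuc that singular_chain_singular_subdivision)
  have Sbd: "chain_boundary (Suc p) (S (Suc p) n c) = S p n (chain_boundary (Suc p) c)"
    if "singular_chain (Suc p) X c" for p X n c
    using chain_boundary_singular_subdivision[OF Sc[OF that]] by (induction n) (simp_all add: S0 SSuc)
  define T where "T = (\<lambda>p n c. \<Sum>i<n. h p (S p i c))"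
  have Tc: "singular_chain (Suc p) X (T p n c)" if "singular_chain p X c" for p X n c
    unfolding T_def using that by (intro singular_chain_sum hc Sc)
  have Tz: "T p n 0 = 0" and Tdiff: "T p n (a - b) = T p n a - T p n b" for p n a b
    by (simp_all add: T_def S_def singular_subdivision_power_diff hdiff h0 sum_subtractf)
  have Tbd: "chain_boundary (Suc (Suc p)) (T (Suc p) n c) + T p n (chain_boundary (Suc p) c) = S (Suc p) n c - c"
    if c: "singular_chain (Suc p) X c" for p X n c
  proof (induction n)
    case (Suc n)
    have "chain_boundary (Suc (Suc p)) (h (Suc p) (S (Suc p) n c)) + h p (S p n (chain_boundary (Suc p) c))
        = S (Suc p) (Suc n) c - S (Suc p) n c"
      using hbd[OF Sc[OF c, of n]] by (simp add: Sbd[OF c] SSuc)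
    moreover have "(b + a') + (a + b') = s' - c" if "a + b = s' - s" "b' + a' = s - c"
      for a b a' b' s s' c :: "'a chain"
    proof -
      have "(b + a') + (a + b') = (a + b) + (b' + a')" by (simp add: ac_simps)
      then show ?thesis by (simp add: that)
    qed
    ultimately show ?case
      using Suc by (simp add: T_def chain_boundary_add add.commute)
  qed (simp add: T_def S0)
  have small0: "pairing u c = 0" if "Poly_Mapping.keys c \<subseteq> small_simplices Y \<N> (Suc p)" for c
    using u that by (intro pairing_eq_0 scochains_vanish[of u]) (auto simp: scocycles_def)
  have sub_small: "Poly_Mapping.keys c \<subseteq> small_simplices Y \<N> q"
    if "singular_chain q (subtopology Y N) c" "N \<in> \<N>" for q N c
  proof
    fix \<sigma> assume "\<sigma> \<in> Poly_Mapping.keys c"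
    then have "singular_simplex q (subtopology Y N) \<sigma>"
      using that(1) by (auto simp: singular_chain_def)
    then have "singular_simplex q Y \<sigma>" "\<sigma> ` standard_simplex q \<subseteq> N"
      unfolding singular_simplex_subtopology by auto
    then show "\<sigma> \<in> small_simplices Y \<N> q"
      using that(2) by (auto simp: small_simplices_def simp del: image_subset_iff)
  qed
  \<comment> \<open>Once the \<open>n\<close>-th subdivision of \<open>c\<close> is small, further
    subdivision and \<open>h\<close> keep its simplices inside members of \<N>, where
    \<open>u\<close> vanishes. Hence later summands of \<open>T\<close> do not contribute.\<close>
  have hS_small: "pairing u (h p (S p i c)) = 0"
    if "Poly_Mapping.keys (S p n c) \<subseteq> small_simplices Y \<N> p" "n \<le> i" for n i and c
  proof -
    define d where "d = S p n c"
    from that(2) obtain j where j: "i = j + n" by (metis add.commute le_Suc_ex)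
    have eq: "S p i c = S p j d"
      by (simp add: j S_def d_def funpow_add)
    have "pairing u (h p (S p j d)) = pairing (\<lambda>\<tau>. pairing u (h p (S p j (frag_of \<tau>)))) d"
      by (rule pairing_additive) (simp_all add: S_def singular_subdivision_power_diff hdiff h0)
    also have "\<dots> = 0"
    proof (rule pairing_eq_0)
      fix \<tau> assume "\<tau> \<in> Poly_Mapping.keys d"
      then have "\<tau> \<in> small_simplices Y \<N> p" using that(1) by (auto simp: d_def)
      then obtain N where N: "N \<in> \<N>" "singular_simplex p (subtopology Y N) \<tau>"
        by (auto simp: small_simplices_def singular_simplex_subtopology)
      then show "pairing u (h p (S p j (frag_of \<tau>))) = 0"
        by (intro small0 sub_small[OF hc[OF Sc]]) (auto simp: singular_chain_of)
    qed
    finally show ?thesis by (simp add: eq)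
  qed
  have ex: "\<exists>n. \<forall>m\<ge>n. Poly_Mapping.keys (S q m c) \<subseteq> small_simplices Y \<N> q" if c: "singular_chain q Y c" for q c
  proof -
    obtain n where n: "\<And>m f. n \<le> m \<Longrightarrow> f \<in> Poly_Mapping.keys ((singular_subdivision q ^^ m) c)
                      \<Longrightarrow> \<exists>V\<in>\<N>. f \<in> standard_simplex q \<rightarrow> V"
      using sufficient_iterated_singular_subdivision_exists[OF opn cover c] by blast
    have "Poly_Mapping.keys (S q m c) \<subseteq> small_simplices Y \<N> q" if m: "n \<le> m" for m
    proof
      fix \<sigma> assume \<sigma>: "\<sigma> \<in> Poly_Mapping.keys (S q m c)"
      then obtain V where "V \<in> \<N>" "\<sigma> ` standard_simplex q \<subseteq> V"
        using n[OF m] by (force simp: S_def)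
      moreover have "singular_simplex q Y \<sigma>"
        using Sc[OF c, of m] \<sigma> by (auto simp: singular_chain_def)
      ultimately show "\<sigma> \<in> small_simplices Y \<N> q"
        unfolding small_simplices_def by blast
    qed
    then show ?thesis by blast
  qed
  define k where "k = (\<lambda>\<tau>. SOME n. \<forall>m\<ge>n. Poly_Mapping.keys (S p m (frag_of \<tau>)) \<subseteq> small_simplices Y \<N> p)"
  have k: "Poly_Mapping.keys (S p m (frag_of \<tau>)) \<subseteq> small_simplices Y \<N> p"
    if "singular_simplex p Y \<tau>" "k \<tau> \<le> m" for \<tau> m
    using someI_ex[OF ex[of p "frag_of \<tau>"]] that by (auto simp: k_def singular_chain_of)
  define w where "w = (\<lambda>\<tau>. if singular_simplex p Y \<tau> then - pairing u (T p (k \<tau>) (frag_of \<tau>)) else 0)"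
  have w_eq: "w \<tau> = - pairing u (T p n (frag_of \<tau>))" if "singular_simplex p Y \<tau>" "k \<tau> \<le> n" for \<tau> n
  proof -
    have "(\<Sum>i<n. pairing u (h p (S p i (frag_of \<tau>)))) = (\<Sum>i<k \<tau>. pairing u (h p (S p i (frag_of \<tau>))))"
      using that hS_small[OF k[OF that(1) order.refl]] by (intro sum.mono_neutral_right) auto
    then show ?thesis
      using that by (simp add: w_def T_def pairing_sum)
  qed
  have "w \<in> scochains p Y {UNIV} \<N>"
  proof -
    have "pairing u (T p n (frag_of \<tau>)) = 0" if "\<tau> \<in> small_simplices Y \<N> p" for n \<tau>
    proof -
      from that obtain N where N: "N \<in> \<N>" "singular_simplex p (subtopology Y N) \<tau>"
        by (auto simp: small_simplices_def singular_simplex_subtopology)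
      then show ?thesis
        by (intro small0 sub_small[OF Tc]) (auto simp: singular_chain_of)
    qed
    then show ?thesis
      by (auto simp: scochains_def w_def)
  qed
  moreover have "u = scoboundary p Y {UNIV} w"
  proof
    fix \<sigma>
    show "u \<sigma> = scoboundary p Y {UNIV} w \<sigma>"
    proof (cases "singular_simplex (Suc p) Y \<sigma>")
      case True
      define b where "b = chain_boundary (Suc p) (frag_of \<sigma>)"
      have b: "Poly_Mapping.keys b \<subseteq> singular_simplex_set p Y"
        using small_chain_boundary[of \<sigma> Y "{UNIV}" p] True by (simp add: b_def)
      have c: "singular_chain (Suc p) Y (frag_of \<sigma>)" using True by (simp add: singular_chain_of)
      obtain n1 where n1: "\<And>m. n1 \<le> m \<Longrightarrow> Poly_Mapping.keys (S (Suc p) m (frag_of \<sigma>)) \<subseteq> small_simplices Y \<N> (Suc p)"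
        using ex[OF c] by blast
      define n where "n = Max (insert n1 (k ` Poly_Mapping.keys b))"
      have n: "n1 \<le> n" "\<And>\<tau>. \<tau> \<in> Poly_Mapping.keys b \<Longrightarrow> k \<tau> \<le> n"
        by (auto simp: n_def)
      have "pairing u (T p n b) = pairing (\<lambda>\<tau>. pairing u (T p n (frag_of \<tau>))) b"
        by (rule pairing_additive) (simp_all add: Tz Tdiff)
      also have "\<dots> = pairing (- w) b"
      proof (rule pairing_cong)
        fix \<tau> assume \<tau>: "\<tau> \<in> Poly_Mapping.keys b"
        then have "singular_simplex p Y \<tau>" using b by blast
        from w_eq[OF this n(2)[OF \<tau>]] show "pairing u (T p n (frag_of \<tau>)) = (- w) \<tau>" by simp
      qed
      finally have 1: "pairing u (T p n b) = - pairing w b" by simp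
      \<comment> \<open>The cocycle \<open>u\<close> kills the boundary term of the homotopy
        formula, leaving \<open>u (T \<partial>\<sigma>) = u (S^n \<sigma>) - u \<sigma>\<close>.
        The first term on the right is 0 by smallness, which explains the sign in
        \<open>w\<close>.\<close>
      have "pairing u (chain_boundary (Suc (Suc p)) (T (Suc p) n (frag_of \<sigma>)))
          = pairing (scoboundary (Suc p) Y {UNIV} u) (T (Suc p) n (frag_of \<sigma>))"
        using Tc[OF c, of n] by (intro pairing_scoboundary[symmetric]) (simp add: singular_chain_def)
      also have "\<dots> = 0" using u by (simp add: scocycles_def)
      finally have "pairing u (T p n b) = pairing u (S (Suc p) n (frag_of \<sigma>)) - u \<sigma>"
        using arg_cong[OF Tbd[OF c, of n], of "pairing u"] by (simp add: pairing_add pairing_diff b_def)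
      with 1 small0[OF n1[OF n(1)]] True show ?thesis
        by (simp add: scoboundary_def b_def)
    next
      case False
      then show ?thesis
        using u scochains_outside[of u "Suc p" Y "{UNIV}" \<N>] by (auto simp: scoboundary_def scocycles_def)
    qed
  qed
  ultimately show ?thesis by auto
qed

text \<open>At time 1 the deformation carries a neighbourhood of each \<open>A\<close> into
  \<open>A\<close>, so the pullback of \<open>u\<close> vanishes on simplices small for an open
  cover and is a coboundary. Since each \<open>A\<close> is preserved throughout, the pullback is
  cohomologous to \<open>u\<close> relative to \<A>. In degree 0 every simplex is a point of some
  member, so \<open>u = 0\<close>.\<close>

lemma small_cochains_acyclic:
  assumes h: "continuous_map (cylinder Y) Y h" and h0: "\<And>x. x \<in> topspace Y \<Longrightarrow> h (0, x) = x"
    and hA: "\<And>A. A \<in> \<A> \<Longrightarrow> h ` ({0..1} \<times> (A \<inter> topspace Y)) \<subseteq> A"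
    and nbhd: "\<And>A. A \<in> \<A> \<Longrightarrow> \<exists>V. openin Y V \<and> A \<inter> topspace Y \<subseteq> V \<and> (\<forall>x\<in>V. h (1, x) \<in> A)"
    and cover: "topspace Y \<subseteq> \<Union>\<A>"
    and u: "u \<in> scocycles p Y {UNIV} \<A>"
  shows "u \<in> scoboundaries p Y {UNIV} \<A>"
proof (cases p)
  case 0
  have "\<sigma> \<in> small_simplices Y \<A> 0" if \<sigma>: "singular_simplex 0 Y \<sigma>" for \<sigma>
  proof -
    obtain a where a: "\<sigma> ` standard_simplex 0 = {a}"
      by (auto simp: standard_simplex_0)
    moreover have "\<sigma> ` standard_simplex 0 \<subseteq> topspace Y"
      using \<sigma> by (auto simp: singular_simplex_def continuous_map_def)
    ultimately have "a \<in> topspace Y"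
      by simp
    then show ?thesis
      using a cover \<sigma> unfolding small_simplices_def by fastforce
  qed
  then have "u = 0"
    using u 0 by (auto simp: scocycles_def scochains_def fun_eq_iff)
  then show ?thesis by simp
next
  case (Suc r)
  from nbhd obtain N where opn: "\<And>A. A \<in> \<A> \<Longrightarrow> openin Y (N A)"
    and AN: "\<And>A. A \<in> \<A> \<Longrightarrow> A \<inter> topspace Y \<subseteq> N A"
    and hN: "\<And>A x. A \<in> \<A> \<Longrightarrow> x \<in> N A \<Longrightarrow> h (1, x) \<in> A"
    by metis
  define u1 where "u1 = spullback p Y {UNIV} (\<lambda>x. h (1, x)) u"
  have h1: "continuous_map Y Y (\<lambda>x. h (1, x))"
    using continuous_map_compose[OF continuous_map_Pair_cylinder h, of 1] by (simp add: o_def)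
  have "u1 \<in> scocycles p Y {UNIV} (N ` \<A>)"
    unfolding u1_def by (rule spullback_in_scocycles[OF u h1]) (use hN in auto)
  then have "u1 \<in> scoboundaries p Y {UNIV} (N ` \<A>)"
    unfolding Suc
  proof (rule small_cochains_acyclic_open[rotated -1])
    show "openin Y M" if "M \<in> N ` \<A>" for M
      using that opn by auto
    show "topspace Y \<subseteq> \<Union>(N ` \<A>)"
    proof
      fix x assume "x \<in> topspace Y"
      then obtain A where "A \<in> \<A>" "x \<in> A" using cover by blast
      then show "x \<in> \<Union>(N ` \<A>)" using AN \<open>x \<in> topspace Y\<close> by blast
    qed
  qed
  moreover have "scoboundaries p Y {UNIV} (N ` \<A>) \<subseteq> scoboundaries p Y {UNIV} \<A>"
    by (rule scoboundaries_antimono) (use AN in auto)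
  moreover have "u1 - spullback p Y {UNIV} (\<lambda>x. h (0, x)) u \<in> scoboundaries p Y {UNIV} \<A>"
    unfolding u1_def by (rule homotopy_spullback[OF h _ u]) (use hA in blast)
  moreover have "spullback p Y {UNIV} (\<lambda>x. h (0, x)) u = u"
    using u h0 scochains_outside[of u p Y "{UNIV}" \<A>]
    by (auto simp: spullback_def fun_eq_iff simplex_map_id_gen scocycles_def)
  ultimately have "u1 \<in> scoboundaries p Y {UNIV} \<A>" "u1 - u \<in> scoboundaries p Y {UNIV} \<A>"
    by auto
  then have "u1 - (u1 - u) \<in> scoboundaries p Y {UNIV} \<A>"
    by (rule scoboundaries_diff)
  then show ?thesis by simp
qed

text \<open>For \<A> consisting of subsets of \<open>U\<close>, the complex in question is the
  kernel of restriction from cochains of \<open>U\<close> to cochains on \<A>-small simplices. Its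
  acyclicity makes restriction an isomorphism in cohomology, and in this form excision enters the
  diagram chases below.\<close>

definition excisive :: "'a topology \<Rightarrow> 'a set \<Rightarrow> 'a set set \<Rightarrow> bool" where
  "excisive X U \<A> \<longleftrightarrow> (\<forall>p. scocycles p X {U} \<A> \<subseteq> scoboundaries p X {U} \<A>)"

text \<open>A simplex of the subspace \<open>U\<close> is a simplex of \<open>X\<close> with image
  in \<open>U\<close>, so the two complexes are equal as sets of functions and absolute results
  about \<open>U\<close> apply.\<close>

lemma excisiveI:
  assumes "\<And>p u. u \<in> scocycles p (subtopology X U) {UNIV} \<A> \<Longrightarrow> u \<in> scoboundaries p (subtopology X U) {UNIV} \<A>"
    and "\<And>A. A \<in> \<A> \<Longrightarrow> A \<subseteq> U"
  shows "excisive X U \<A>"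
proof -
  have 1: "small_simplices (subtopology X U) {UNIV} p = small_simplices X {U} p" for p
    by (auto simp: small_simplices_def singular_simplex_subtopology)
  have 2: "small_simplices (subtopology X U) \<A> p = small_simplices X \<A> p" for p
    using assms(2) by (fastforce simp: small_simplices_def singular_simplex_subtopology)
  have 3: "scochains p (subtopology X U) {UNIV} \<A> = scochains p X {U} \<A>" for p
    by (simp only: scochains_def 1 2)
  have 4: "scoboundary p (subtopology X U) {UNIV} = scoboundary p X {U}" for p
    by (simp only: scoboundary_def[abs_def] 1)
  have "scocycles p (subtopology X U) {UNIV} \<A> = scocycles p X {U} \<A>" for p
    by (simp only: scocycles_def 3 4)
  moreover have "scoboundaries p (subtopology X U) {UNIV} \<A> = scoboundaries p X {U} \<A>" for p
    by (cases p) (simp_all only: scoboundaries.simps 3 4)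
  ultimately show ?thesis
    using assms(1) unfolding excisive_def by blast
qed

section \<open>Restriction to small simplices in cohomology\<close>

definition srestrict :: "nat \<Rightarrow> 'a topology \<Rightarrow> 'a set set \<Rightarrow> (((nat \<Rightarrow> real) \<Rightarrow> 'a) \<Rightarrow> int) \<Rightarrow>
    ((nat \<Rightarrow> real) \<Rightarrow> 'a) \<Rightarrow> int" where
  "srestrict p X \<V> u = (\<lambda>\<sigma>. if \<sigma> \<in> small_simplices X \<V> p then u \<sigma> else 0)"

lemma srestrict_add: "srestrict p X \<V> (u + v) = srestrict p X \<V> u + srestrict p X \<V> v"
  by (auto simp: srestrict_def)

lemma srestrict_diff: "srestrict p X \<V> (u - v) = srestrict p X \<V> u - srestrict p X \<V> v"
  by (auto simp: srestrict_def)

lemma srestrict_0 [simp]: "srestrict p X \<V> 0 = 0"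
  by (auto simp: srestrict_def)

lemma small_simplices_subset_UNIV: "small_simplices X \<V> p \<subseteq> small_simplices X {UNIV} p"
  by (auto simp: small_simplices_def)

lemma srestrict_in_scochains:
  "u \<in> scochains p X {UNIV} \<A> \<Longrightarrow> srestrict p X \<V> u \<in> scochains p X \<V> \<A>"
  by (auto simp: scochains_def srestrict_def)

lemma scoboundary_srestrict:
  "scoboundary p X \<V> (srestrict p X \<V> u) = srestrict (Suc p) X \<V> (scoboundary p X {UNIV} u)"
proof
  fix \<sigma>
  show "scoboundary p X \<V> (srestrict p X \<V> u) \<sigma> = srestrict (Suc p) X \<V> (scoboundary p X {UNIV} u) \<sigma>"
  proof (cases "\<sigma> \<in> small_simplices X \<V> (Suc p)")
    case True
    then have "\<sigma> \<in> small_simplices X {UNIV} (Suc p)"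
      using small_simplices_subset_UNIV by blast
    with True show ?thesis
      by (simp add: scoboundary_face_sum[where \<U> = \<V>] scoboundary_face_sum[where \<U> = "{UNIV}"] srestrict_def
          small_simplices_face del: sum.atMost_Suc small_simplices_UNIV)
  qed (simp add: scoboundary_def srestrict_def)
qed

lemma srestrict_in_scocycles:
  "u \<in> scocycles p X {UNIV} \<A> \<Longrightarrow> srestrict p X \<V> u \<in> scocycles p X \<V> \<A>"
  by (simp add: scocycles_def srestrict_in_scochains scoboundary_srestrict)

lemma srestrict_in_scoboundaries:
  assumes "u \<in> scoboundaries p X {UNIV} \<A>" shows "srestrict p X \<V> u \<in> scoboundaries p X \<V> \<A>"
  using assms by (cases p) (auto simp: srestrict_in_scochains simp flip: scoboundary_srestrict)

text \<open>Extension by zero leaves the function unchanged. It does not commute with the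
  coboundary, so the coboundary over all simplices has to be formed after extending.\<close>

lemma scochains_extend:
  "u \<in> scochains p X \<V> \<A> \<Longrightarrow> u \<in> scochains p X {UNIV} \<A>"
  using small_simplices_subset_UNIV[of X \<V> p] by (auto simp: scochains_def)

lemma srestrict_same: "u \<in> scochains p X \<V> \<A> \<Longrightarrow> srestrict p X \<V> u = u"
  by (auto simp: srestrict_def scochains_def)

lemma scochains_srestrict_0:
  "u \<in> scochains p X {UNIV} \<A> \<Longrightarrow> srestrict p X \<V> u = 0 \<Longrightarrow> u \<in> scochains p X {UNIV} \<V>"
  by (auto simp: srestrict_def scochains_def fun_eq_iff) metis

text \<open>Restricted to \<open>U\<close>, the cocycle \<open>u\<close> lies in an acyclic complex
  and is a coboundary there. Extending a primitive by zero and subtracting its coboundary makes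
  \<open>u\<close> vanish on all simplices of \<open>U\<close>, not merely on those inside members
  of \<A>.\<close>

lemma excision_surj:
  assumes exc: "excisive X U \<A>" and u: "u \<in> scocycles p X {UNIV} \<A>"
  obtains u' where "u' \<in> scocycles p X {UNIV} {U}" "u - u' \<in> scoboundaries p X {UNIV} \<A>"
proof -
  have "srestrict p X {U} u \<in> scoboundaries p X {U} \<A>"
    using exc srestrict_in_scocycles[OF u] by (auto simp: excisive_def)
  then obtain w where w: "w \<in> scoboundaries p X {UNIV} \<A>" "srestrict p X {U} w = srestrict p X {U} u"
  proof (cases p)
    case (Suc r)
    assume "srestrict p X {U} u \<in> scoboundaries p X {U} \<A>"
    then obtain v where v: "v \<in> scochains r X {U} \<A>" "srestrict p X {U} u = scoboundary r X {U} v"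
      using Suc by auto
    have "srestrict p X {U} (scoboundary r X {UNIV} v) = srestrict p X {U} u"
      using v Suc scoboundary_srestrict[of r X "{U}" v] srestrict_same[OF v(1)] by simp
    then show thesis
      using that[of "scoboundary r X {UNIV} v"] Suc scochains_extend[OF v(1)] by auto
  qed (use that[of 0] in simp)
  have "u - w \<in> scocycles p X {UNIV} \<A>"
    using u w(1) scoboundaries_subset_scocycles by (blast intro: scocycles_diff)
  moreover have "srestrict p X {U} (u - w) = 0"
    by (simp add: srestrict_diff w(2))
  ultimately have "u - w \<in> scocycles p X {UNIV} {U}"
    using scochains_srestrict_0[of "u - w" p X \<A> "{U}"] by (simp add: scocycles_def)
  then show thesis
    using that[of "u - w"] w(1) by simp
qed

text \<open>If \<open>u\<close> is the coboundary of \<open>v\<close>, then \<open>v\<close>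
  restricts to a cocycle on \<open>U\<close> because \<open>u\<close> vanishes there. Acyclicity
  provides a cocycle \<open>v'\<close> of \<open>X\<close> with the same restriction, and
  \<open>v - v'\<close> is a primitive that vanishes on \<open>U\<close>.\<close>

lemma excision_inj:
  assumes exc: "excisive X U \<A>" and u: "u \<in> scocycles p X {UNIV} {U}" "u \<in> scoboundaries p X {UNIV} \<A>"
  shows "u \<in> scoboundaries p X {UNIV} {U}"
proof (cases p)
  case (Suc r)
  then obtain v where v: "v \<in> scochains r X {UNIV} \<A>" "u = scoboundary r X {UNIV} v"
    using u(2) by auto
  have "srestrict p X {U} u = 0"
    using u(1) by (auto simp: scocycles_def scochains_def srestrict_def)
  then have "srestrict r X {U} v \<in> scocycles r X {U} \<A>"
    using v Suc by (simp add: scocycles_def srestrict_in_scochains scoboundary_srestrict)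
  then have "srestrict r X {U} v \<in> scoboundaries r X {U} \<A>"
    using exc by (auto simp: excisive_def)
  then obtain v' where v': "v' \<in> scochains r X {UNIV} \<A>" "scoboundary r X {UNIV} v' = 0"
      "srestrict r X {U} v = srestrict r X {U} v'"
  proof (cases r)
    case (Suc t)
    assume "srestrict r X {U} v \<in> scoboundaries r X {U} \<A>"
    then obtain z where z: "z \<in> scochains t X {U} \<A>" "srestrict r X {U} v = scoboundary t X {U} z"
      using Suc by auto
    have "srestrict r X {U} (scoboundary t X {UNIV} z) = srestrict r X {U} v"
      using z Suc scoboundary_srestrict[of t X "{U}" z] srestrict_same[OF z(1)] by simp
    then show thesis
      using that[of "scoboundary t X {UNIV} z"] Suc scochains_extend[OF z(1)]
      by (simp add: scoboundary_in_scochains)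
  qed (use that[of 0] in simp)
  have "v - v' \<in> scochains r X {UNIV} {U}"
    using v(1) v'(1) by (rule scochains_srestrict_0[OF scochains_diff]) (simp add: srestrict_diff v')
  moreover have "u = scoboundary r X {UNIV} (v - v')"
    using v v' by (simp add: scoboundary_diff)
  ultimately show ?thesis using Suc by auto
qed (use u(2) in simp)

text \<open>Extended by zero, \<open>y\<close> may fail to be a cocycle, but its coboundary vanishes
  on small simplices. Acyclicity gives that coboundary a primitive \<open>w\<close> that also
  vanishes on small simplices, and \<open>y - w\<close> is a cocycle with restriction
  \<open>y\<close>.\<close>

lemma small_cochains_surj:
  assumes exc: "excisive X UNIV \<V>" and y: "y \<in> scocycles p X \<V> {{}}"
  obtains \<psi> where "\<psi> \<in> scocycles p X {UNIV} {{}}" "srestrict p X \<V> \<psi> = y"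
proof -
  have yc: "y \<in> scochains p X {UNIV} {{}}" and y0: "scoboundary p X \<V> y = 0" and ys: "srestrict p X \<V> y = y"
    using y scochains_extend srestrict_same by (auto simp: scocycles_def)
  have "srestrict (Suc p) X \<V> (scoboundary p X {UNIV} y) = 0"
    using scoboundary_srestrict[of p X \<V> y] y0 ys by simp
  then have "scoboundary p X {UNIV} y \<in> scocycles (Suc p) X {UNIV} \<V>"
    using scoboundary_in_scochains[OF yc] scochains_srestrict_0 by (auto simp: scocycles_def)
  then have "scoboundary p X {UNIV} y \<in> scoboundaries (Suc p) X {UNIV} \<V>"
    using exc by (auto simp: excisive_def simp del: scoboundaries.simps)
  then obtain w where w: "w \<in> scochains p X {UNIV} \<V>" "scoboundary p X {UNIV} y = scoboundary p X {UNIV} w"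
    by auto
  have "w \<in> scochains p X {UNIV} {{}}"
    using w(1) by (auto simp: scochains_def small_simplices_empty)
  then have "y - w \<in> scocycles p X {UNIV} {{}}"
    using yc w(2) by (simp add: scocycles_def scochains_diff scoboundary_diff)
  moreover have "srestrict p X \<V> w = 0"
    using w(1) by (auto simp: srestrict_def scochains_def)
  ultimately show thesis
    using that[of "y - w"] ys by (simp add: srestrict_diff)
qed

text \<open>The coboundary of an extended primitive of the restriction reduces \<psi> to a cocycle
  that vanishes on all \<V>-small simplices, and such cocycles are coboundaries by excision.\<close>

lemma small_cochains_inj:
  assumes exc: "excisive X UNIV \<V>" and \<psi>: "\<psi> \<in> scocycles p X {UNIV} {{}}"
    and b: "srestrict p X \<V> \<psi> \<in> scoboundaries p X \<V> {{}}"
  shows "\<psi> \<in> scoboundaries p X {UNIV} {{}}"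
proof -
  obtain w where w: "w \<in> scoboundaries p X {UNIV} {{}}" "srestrict p X \<V> w = srestrict p X \<V> \<psi>"
  proof (cases p)
    case (Suc r)
    then obtain v where v: "v \<in> scochains r X \<V> {{}}" "srestrict p X \<V> \<psi> = scoboundary r X \<V> v"
      using b by auto
    have "srestrict p X \<V> (scoboundary r X {UNIV} v) = srestrict p X \<V> \<psi>"
      using v Suc scoboundary_srestrict[of r X \<V> v] srestrict_same[OF v(1)] by simp
    then show thesis
      using that[of "scoboundary r X {UNIV} v"] Suc scochains_extend[OF v(1)] by auto
  qed (use that[of 0] b in simp)
  have "\<psi> - w \<in> scocycles p X {UNIV} {{}}"
    using \<psi> w(1) scoboundaries_subset_scocycles by (blast intro: scocycles_diff)
  then have "\<psi> - w \<in> scocycles p X {UNIV} \<V>"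
    using scochains_srestrict_0[of "\<psi> - w" p X "{{}}" \<V>] w(2) by (simp add: scocycles_def srestrict_diff)
  then have "\<psi> - w \<in> scoboundaries p X {UNIV} \<V>"
    using exc by (auto simp: excisive_def)
  moreover have "scoboundaries p X {UNIV} \<V> \<subseteq> scoboundaries p X {UNIV} {{}}"
    by (cases p) (auto simp: scochains_def small_simplices_empty)
  ultimately have "(\<psi> - w) + w \<in> scoboundaries p X {UNIV} {{}}"
    using w(1) by (intro scoboundaries_add) auto
  then show ?thesis by simp
qed

section \<open>Faces of a convex body and the cube\<close>

lemma convex_combination_mem:
  fixes b :: "'i \<Rightarrow> 'a::real_vector"
  assumes "convex C" "finite A" "\<And>a. a \<in> A \<Longrightarrow> 0 \<le> w a" "sum w A = 1"
    and "\<And>a. a \<in> A \<Longrightarrow> w a \<noteq> 0 \<Longrightarrow> b a \<in> C"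
  shows "(\<Sum>a\<in>A. w a *\<^sub>R b a) \<in> C"
proof -
  let ?B = "{a \<in> A. w a \<noteq> 0}"
  have "(\<Sum>a\<in>A. w a *\<^sub>R b a) = (\<Sum>a\<in>?B. w a *\<^sub>R b a)"
    by (rule sum.mono_neutral_right) (use assms in auto)
  moreover have "sum w A = sum w ?B"
    by (rule sum.mono_neutral_right) (use assms in auto)
  ultimately show ?thesis
    using assms by (auto intro!: convex_sum)
qed

text \<open>The midpoint of a point avoiding the earlier faces and one avoiding the new face avoids
  all of them, because a face containing the midpoint contains both ends.\<close>

lemma exists_point_avoiding_faces:
  fixes P :: "'a::euclidean_space set"
  assumes "finite J" "convex C" "C \<subseteq> P" "C \<noteq> {}"
    and "\<And>i. i \<in> J \<Longrightarrow> F i face_of P" "\<And>i. i \<in> J \<Longrightarrow> \<not> C \<subseteq> F i"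
  shows "\<exists>y\<in>C. \<forall>i\<in>J. y \<notin> F i"
  using assms(1,5,6)
proof (induction J rule: finite_induct)
  case (insert i J)
  then obtain y where y: "y \<in> C" "\<forall>j\<in>J. y \<notin> F j" by auto
  obtain y' where y': "y' \<in> C" "y' \<notin> F i" using insert.prems(2)[of i] by auto
  show ?case
  proof (cases "y = y'")
    case True
    then show ?thesis using y y' by auto
  next
    case False
    have "midpoint y y' \<in> C"
      using assms(2) y(1) y'(1) convex_contains_segment[of C] midpoint_in_closed_segment[of y y'] by blast
    moreover have "midpoint y y' \<notin> F k" if k: "k \<in> insert i J" for k
    proof
      assume "midpoint y y' \<in> F k"
      then have "y \<in> F k \<and> y' \<in> F k"
        using face_ofD[OF insert.prems(1)[OF k], of "midpoint y y'" y y'] False y(1) y'(1) assms(3) by auto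
      then show False using k y(2) y'(2) by auto
    qed
    ultimately show ?thesis by blast
  qed
qed (use assms in auto)

lemma convex_Diff_face:
  assumes "F face_of P" "convex P"
  shows "convex (P - F)"
  unfolding convex_contains_segment
proof (intro ballI subsetI)
  fix a b x assume ab: "a \<in> P - F" "b \<in> P - F" and x: "x \<in> closed_segment a b"
  have "x \<in> P"
    using ab x assms(2) unfolding convex_contains_segment by blast
  moreover have "x \<notin> F"
  proof
    assume "x \<in> F"
    then have "x \<in> open_segment a b"
      using ab x by (auto simp: open_segment_def)
    then show False
      using face_ofD[OF assms(1)] ab \<open>x \<in> F\<close> by blast
  qed
  ultimately show "x \<in> P - F" by simp
qed

lemma common_threshold:
  fixes Q :: "'b \<Rightarrow> real \<Rightarrow> bool"
  assumes "finite A" "\<And>a. a \<in> A \<Longrightarrow> \<exists>e>0. Q a e" "\<And>a e e'. Q a e \<Longrightarrow> 0 < e' \<Longrightarrow> e' \<le> e \<Longrightarrow> Q a e'"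
  shows "\<exists>e>0. \<forall>a\<in>A. Q a e"
  using assms(1,2)
proof (induction A rule: finite_induct)
  case (insert a A)
  then obtain e e' where "e > 0" "\<forall>a\<in>A. Q a e" "e' > 0" "Q a e'" by blast
  then show ?case
    using assms(3) by (intro exI[of _ "min e e'"]) (auto intro: assms(3)[of _ e] assms(3)[of _ e'])
qed (auto intro: exI[of _ 1])

lemma infdist_lower_bound:
  fixes K :: "'a::heine_borel set"
  assumes "compact K" "closed F" "F \<noteq> {}" "K \<inter> F = {}"
  shows "\<exists>e>0. \<forall>x\<in>K. e \<le> infdist x F"
proof -
  obtain d where d: "d > 0" "\<And>x y. x \<in> K \<Longrightarrow> y \<in> F \<Longrightarrow> d \<le> dist x y"
    using separate_compact_closed[of K F] assms by blast
  have "d \<le> infdist x F" if "x \<in> K" for x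
    using d(2)[OF that] assms(3) by (auto simp: infdist_def intro: cINF_greatest)
  with d(1) show ?thesis by blast
qed

section \<open>Coordinates on the moment-angle complex and comparison with the convex body\<close>

locale faces =
  fixes P :: "'a::euclidean_space set" and m :: nat and F :: "nat \<Rightarrow> 'a set"
  assumes convex_P: "convex P" and compact_P: "compact P" and P_nonempty: "P \<noteq> {}"
    and face_F: "i \<in> {1..m} \<Longrightarrow> F i face_of P" and F_nonempty: "i \<in> {1..m} \<Longrightarrow> F i \<noteq> {}"
begin

definition "\<Sigma> = dual_boundary_complex m F"
definition "X = real_moment_angle_set m \<Sigma>"
definition "TX = real_moment_angle_complex m \<Sigma>"

lemma compact_F: "i \<in> {1..m} \<Longrightarrow> compact (F i)"
  using face_F face_of_imp_compact compact_P convex_P by blast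

lemma F_subset: "i \<in> {1..m} \<Longrightarrow> F i \<subseteq> P"
  using face_F face_of_imp_subset by blast

lemma convex_F: "i \<in> {1..m} \<Longrightarrow> convex (F i)"
  using face_F face_of_imp_convex by blast

lemma Sigma_mono: "\<sigma> \<in> \<Sigma> \<Longrightarrow> \<tau> \<subseteq> \<sigma> \<Longrightarrow> \<tau> \<in> \<Sigma>"
  by (fastforce simp: \<Sigma>_def dual_boundary_complex_def)

text \<open>Intersecting with \<open>P\<close> absorbs the special case \<tau> = \<open>{}\<close>,
  where the empty intersection is the whole ambient space.\<close>

lemma Sigma_iff: "\<tau> \<in> \<Sigma> \<longleftrightarrow> \<tau> \<subseteq> {1..m} \<and> P \<inter> (\<Inter>i\<in>\<tau>. F i) \<noteq> {}"
proof (cases "\<tau> = {}")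
  case True
  then show ?thesis using P_nonempty by (simp add: \<Sigma>_def dual_boundary_complex_def)
next
  case False
  have "P \<inter> (\<Inter>i\<in>\<tau>. F i) = (\<Inter>i\<in>\<tau>. F i)" if "\<tau> \<subseteq> {1..m}"
    using that False F_subset by blast
  then show ?thesis
    using False by (auto simp: \<Sigma>_def dual_boundary_complex_def)
qed

text \<open>The coordinates of absolute value below 1 form the smallest index set that can witness
  membership; because \<Sigma> is closed under subsets, it suffices to test this one.\<close>

lemma X_iff: "z \<in> X \<longleftrightarrow> z \<in> extensional {1..m} \<and> (\<forall>i\<in>{1..m}. \<bar>z i\<bar> \<le> 1) \<and> {i\<in>{1..m}. \<bar>z i\<bar> < 1} \<in> \<Sigma>"
proof
  assume "z \<in> X"
  then obtain \<sigma> where \<sigma>: "\<sigma> \<in> \<Sigma>" "z \<in> {1..m} \<rightarrow>\<^sub>E {-1..1}" "\<forall>i\<in>{1..m}. i \<notin> \<sigma> \<longrightarrow> z i \<in> {-1, 1}"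
    by (auto simp: X_def real_moment_angle_set_def)
  then have "{i\<in>{1..m}. \<bar>z i\<bar> < 1} \<subseteq> \<sigma>" by fastforce
  moreover have "\<forall>i\<in>{1..m}. \<bar>z i\<bar> \<le> 1"
    using \<sigma>(2) by (fastforce simp: PiE_iff abs_le_iff)
  ultimately show "z \<in> extensional {1..m} \<and> (\<forall>i\<in>{1..m}. \<bar>z i\<bar> \<le> 1) \<and> {i\<in>{1..m}. \<bar>z i\<bar> < 1} \<in> \<Sigma>"
    using \<sigma> Sigma_mono by (auto simp: PiE_iff)
next
  assume z: "z \<in> extensional {1..m} \<and> (\<forall>i\<in>{1..m}. \<bar>z i\<bar> \<le> 1) \<and> {i\<in>{1..m}. \<bar>z i\<bar> < 1} \<in> \<Sigma>"
  then have "z \<in> {1..m} \<rightarrow>\<^sub>E {-1..1}"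
    by (auto simp: PiE_iff abs_le_iff)
  moreover have "z i \<in> {-1, 1}" if "i \<in> {1..m}" "i \<notin> {i\<in>{1..m}. \<bar>z i\<bar> < 1}" for i
  proof -
    have "\<bar>z i\<bar> = 1" using that z by force
    then show ?thesis by auto
  qed
  ultimately show "z \<in> X"
    using z unfolding X_def real_moment_angle_set_def by blast
qed

lemma topspace_TX: "topspace TX = X"
  by (auto simp: TX_def X_def real_moment_angle_complex_def real_moment_angle_set_def)

lemma continuous_map_into_TX:
  assumes "\<And>i. i \<in> {1..m} \<Longrightarrow> continuous_map T euclideanreal (\<lambda>x. f x i)" "\<And>x. x \<in> topspace T \<Longrightarrow> f x \<in> X"
  shows "continuous_map T TX f"
proof -
  have "f x i \<in> {-1..1}" if "x \<in> topspace T" "i \<in> {1..m}" for x i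
    using assms(2)[OF that(1)] that(2) by (auto simp: X_iff abs_le_iff)
  then have "continuous_map T (product_topology (\<lambda>_. top_of_set {-1..1}) {1..m}) f"
    using assms X_iff by (auto simp: continuous_map_componentwise continuous_map_in_subtopology)
  then show ?thesis
    using assms(2) by (auto simp: TX_def real_moment_angle_complex_def continuous_map_in_subtopology X_def)
qed

lemma continuous_map_TX_component:
  assumes "i \<in> {1..m}"
  shows "continuous_map TX euclideanreal (\<lambda>z. z i)"
proof -
  have "continuous_map (product_topology (\<lambda>_. top_of_set {-1..1}) {1..m}) (top_of_set {-1..1::real}) (\<lambda>z. z i)"
    using assms by (rule continuous_map_product_projection)
  then show ?thesis
    unfolding TX_def real_moment_angle_complex_def
    by (rule continuous_map_from_subtopology[OF continuous_map_into_fulltopology])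
qed

text \<open>Vertices of the cubical set \<open>Q\<close> are indexed by the sets in \<Sigma>: the
  vertex with zero set \<tau> goes to a point \<open>b \<tau>\<close> of the corresponding face, and
  \<pi> is the multilinear extension. In the other direction \<open>s\<close> records truncated
  distances to the \<open>F i\<close>. The maps are inverse only up to homotopy, so the threshold
  \<epsilon> must be small enough for \<open>s\<close> to land in \<open>X\<close> and for the
  segment from \<open>z\<close> to \<open>s (\<pi> z)\<close> to stay there.\<close>

lemma stratified_retraction:
  obtains \<pi> :: "(nat \<Rightarrow> real) \<Rightarrow> 'a" and s :: "'a \<Rightarrow> nat \<Rightarrow> real" where
    "continuous_map TX (top_of_set P) \<pi>"
    "\<And>z i. z \<in> X \<Longrightarrow> i \<in> {1..m} \<Longrightarrow> z i = 0 \<Longrightarrow> \<pi> z \<in> F i"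
    "\<And>z. \<pi> (\<lambda>i\<in>{1..m}. \<bar>z i\<bar>) = \<pi> z"
    "continuous_map (top_of_set P) TX s"
    "\<And>x i. i \<in> {1..m} \<Longrightarrow> 0 \<le> s x i"
    "\<And>x i. i \<in> {1..m} \<Longrightarrow> x \<in> F i \<Longrightarrow> s x i = 0"
    "\<And>z t. z \<in> X \<Longrightarrow> (\<And>i. i \<in> {1..m} \<Longrightarrow> 0 \<le> z i) \<Longrightarrow> 0 \<le> t \<Longrightarrow> t \<le> 1 \<Longrightarrow>
       (\<lambda>i\<in>{1..m}. (1 - t) * z i + t * s (\<pi> z) i) \<in> X"
proof -
  define I where "I = {1..m}"
  have finI: "finite I" by (simp add: I_def)
  define C where "C = (\<lambda>\<tau>. P \<inter> (\<Inter>j\<in>\<tau>. F j))"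
  have Sig: "\<tau> \<in> \<Sigma> \<longleftrightarrow> \<tau> \<subseteq> I \<and> C \<tau> \<noteq> {}" for \<tau>
    by (simp add: Sigma_iff I_def C_def)
  \<comment> \<open>\<open>b \<tau>\<close> is a generic point of the face \<open>C \<tau>\<close>:
    it lies on \<open>F i\<close> only when all of \<open>C \<tau>\<close> does. Off \<Sigma> any
    point of \<open>P\<close> serves as a default.\<close>
  have "\<exists>b. b \<in> P \<and> (\<tau> \<in> \<Sigma> \<longrightarrow> b \<in> C \<tau> \<and> (\<forall>i\<in>I. b \<in> F i \<longrightarrow> C \<tau> \<subseteq> F i))" for \<tau>
  proof (cases "\<tau> \<in> \<Sigma>")
    case True
    have "convex (C \<tau>)"
      unfolding C_def using True convex_P convex_F by (intro convex_Int convex_INT) (auto simp: Sig I_def)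
    then have "\<exists>y\<in>C \<tau>. \<forall>i\<in>{i \<in> I. \<not> C \<tau> \<subseteq> F i}. y \<notin> F i"
      using True finI face_F by (intro exists_point_avoiding_faces[where P = P]) (auto simp: Sig I_def C_def)
    then obtain y where "y \<in> C \<tau>" "\<forall>i\<in>{i \<in> I. \<not> C \<tau> \<subseteq> F i}. y \<notin> F i" by blast
    then show ?thesis by (intro exI[of _ y]) (auto simp: C_def)
  qed (use P_nonempty in auto)
  then obtain b where bP: "\<And>\<tau>. b \<tau> \<in> P" and bC: "\<And>\<tau>. \<tau> \<in> \<Sigma> \<Longrightarrow> b \<tau> \<in> C \<tau>"
    and bF: "\<And>\<tau> i. \<tau> \<in> \<Sigma> \<Longrightarrow> i \<in> I \<Longrightarrow> b \<tau> \<in> F i \<Longrightarrow> C \<tau> \<subseteq> F i"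
    by metis
  \<comment> \<open>For \<tau> outside \<Sigma> the sum of the distances to the \<open>F i\<close>
    has no zero on \<open>P\<close>; compactness bounds it below, and some summand is at least the
    average.\<close>
  have "\<exists>e>0. \<forall>x\<in>P. \<exists>i\<in>\<tau>. e \<le> infdist x (F i)" if \<tau>: "\<tau> \<in> Pow I - \<Sigma>" for \<tau>
  proof -
    have fin: "finite \<tau>" and ne: "\<tau> \<noteq> {}"
      using \<tau> finI finite_subset Sig[of "{}"] P_nonempty by (auto simp: C_def)
    define f where "f = (\<lambda>x. \<Sum>i\<in>\<tau>. infdist x (F i))"
    have "continuous_on P f"
      unfolding f_def by (intro continuous_intros)
    then obtain x0 where x0: "x0 \<in> P" "\<And>x. x \<in> P \<Longrightarrow> f x0 \<le> f x"
      using continuous_attains_inf[OF compact_P P_nonempty] by blast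
    have "f x0 \<noteq> 0"
    proof
      assume "f x0 = 0"
      then have "infdist x0 (F i) = 0" if "i \<in> \<tau>" for i
        using that fin by (simp add: f_def sum_nonneg_eq_0_iff infdist_nonneg)
      then have "x0 \<in> F i" if "i \<in> \<tau>" for i
        using that \<tau> compact_F compact_imp_closed F_nonempty in_closed_iff_infdist_zero by (metis DiffD1 I_def PowD subsetD)
      then have "x0 \<in> C \<tau>" using x0(1) by (auto simp: C_def)
      then show False using \<tau> Sig by blast
    qed
    then have pos: "f x0 > 0"
      by (simp add: f_def sum_nonneg infdist_nonneg order.not_eq_order_implies_strict)
    define e where "e = f x0 / real (card \<tau>)"
    have "\<exists>i\<in>\<tau>. e \<le> infdist x (F i)" if x: "x \<in> P" for x
    proof (rule ccontr)
      assume *: "\<not> (\<exists>i\<in>\<tau>. e \<le> infdist x (F i))"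
      have "infdist x (F i) < e" if "i \<in> \<tau>" for i
        using * that by (meson not_le)
      then have "f x < (\<Sum>i\<in>\<tau>. e)"
        unfolding f_def by (rule sum_strict_mono[OF fin ne])
      then show False
        using x0(2)[OF x] fin ne by (simp add: e_def)
    qed
    moreover have "e > 0" using pos fin ne by (simp add: e_def card_gt_0_iff)
    ultimately show ?thesis by blast
  qed
  then have "\<exists>e>0. \<forall>\<tau>\<in>Pow I - \<Sigma>. \<forall>x\<in>P. \<exists>i\<in>\<tau>. e \<le> infdist x (F i)"
  proof (rule common_threshold[rotated 1])
    show "\<forall>x\<in>P. \<exists>i\<in>\<tau>. e' \<le> infdist x (F i)" if "\<forall>x\<in>P. \<exists>i\<in>\<tau>. e \<le> infdist x (F i)" "e' \<le> e"
      for \<tau> e e'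
      using that by (meson order_trans)
  qed (use finI in auto)
  then obtain e1 where e1: "e1 > 0" "\<And>\<tau> x. \<tau> \<in> Pow I - \<Sigma> \<Longrightarrow> x \<in> P \<Longrightarrow> \<exists>i\<in>\<tau>. e1 \<le> infdist x (F i)"
    by blast
  \<comment> \<open>Convexity of \<open>P - F i\<close> keeps the hull of the points
    \<open>b \<rho>\<close> with \<rho> \<subseteq> \<tau> off \<open>F i\<close> whenever
    \<open>F i\<close> does not contain \<open>C \<tau>\<close>; compactness turns this into a
    positive distance.\<close>
  have "\<exists>e>0. \<forall>x\<in>convex hull (b ` Pow (fst a)). e \<le> infdist x (F (snd a))"
    if a: "a \<in> {a \<in> \<Sigma> \<times> I. \<not> C (fst a) \<subseteq> F (snd a)}" for a
  proof -
    obtain \<tau> i where a_eq: "a = (\<tau>, i)" by (cases a)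
    with a have \<tau>: "\<tau> \<in> \<Sigma>" and i: "i \<in> I" and nsub: "\<not> C \<tau> \<subseteq> F i" by auto
    have "b ` Pow \<tau> \<subseteq> P - F i"
    proof
      fix y assume "y \<in> b ` Pow \<tau>"
      then obtain \<rho> where \<rho>: "\<rho> \<subseteq> \<tau>" "y = b \<rho>" by auto
      then have "C \<tau> \<subseteq> C \<rho>" by (auto simp: C_def)
      then have "b \<rho> \<notin> F i"
        using bF[OF Sigma_mono[OF \<tau> \<rho>(1)] i] nsub by blast
      then show "y \<in> P - F i" using bP \<rho>(2) by simp
    qed
    moreover have "convex (P - F i)"
      using convex_Diff_face[OF face_F convex_P] i by (simp add: I_def)
    ultimately have "convex hull (b ` Pow \<tau>) \<subseteq> P - F i"
      by (rule hull_minimal)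
    moreover have "compact (convex hull (b ` Pow \<tau>))"
      using \<tau> finI finite_subset by (intro finite_imp_compact_convex_hull) (auto simp: Sig)
    ultimately have "\<exists>e>0. \<forall>x\<in>convex hull (b ` Pow \<tau>). e \<le> infdist x (F i)"
      using compact_F[of i] F_nonempty[of i] i compact_imp_closed by (intro infdist_lower_bound) (auto simp: I_def)
    then show ?thesis by (simp add: a_eq)
  qed
  then have "\<exists>e>0. \<forall>a\<in>{a \<in> \<Sigma> \<times> I. \<not> C (fst a) \<subseteq> F (snd a)}.
      \<forall>x\<in>convex hull (b ` Pow (fst a)). e \<le> infdist x (F (snd a))"
  proof (rule common_threshold[rotated 1])
    show "finite {a \<in> \<Sigma> \<times> I. \<not> C (fst a) \<subseteq> F (snd a)}"
      by (rule finite_subset[of _ "Pow I \<times> I"]) (use finI Sig in auto)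
    show "\<forall>x\<in>convex hull (b ` Pow (fst a)). e' \<le> infdist x (F (snd a))"
      if "\<forall>x\<in>convex hull (b ` Pow (fst a)). e \<le> infdist x (F (snd a))" "e' \<le> e" for a e e'
      using that by (meson order_trans)
  qed auto
  then obtain e2 where e2: "e2 > 0" "\<And>\<tau> i x. \<tau> \<in> \<Sigma> \<Longrightarrow> i \<in> I \<Longrightarrow> \<not> C \<tau> \<subseteq> F i \<Longrightarrow> x \<in> convex hull (b ` Pow \<tau>) \<Longrightarrow> e2 \<le> infdist x (F i)"
    by fastforce
  \<comment> \<open>\<open>e1\<close> serves to place \<open>s x\<close> in \<open>X\<close>,
    \<open>e2\<close> to control the segment from \<open>z\<close> to
    \<open>s (\<pi> z)\<close>.\<close>
  define \<epsilon> where "\<epsilon> = min e1 e2"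
  have \<epsilon>: "\<epsilon> > 0" using e1 e2 by (simp add: \<epsilon>_def)
  \<comment> \<open>Product weights on the cube: for \<open>z\<close> in \<open>X\<close>, the
    probability that independent choices of the indices, \<open>i\<close> with probability
    \<open>1 - \<bar>z i\<bar>\<close>, yield \<sigma>. Absolute values make \<pi> invariant under
    sign changes.\<close>
  define w where "w = (\<lambda>z \<sigma>. (\<Prod>i\<in>\<sigma>. 1 - \<bar>z i\<bar>) * (\<Prod>i\<in>I - \<sigma>. \<bar>z i\<bar>) :: real)"
  define \<pi> where "\<pi> = (\<lambda>z. \<Sum>\<sigma>\<in>Pow I. w z \<sigma> *\<^sub>R b \<sigma>)"
  define s where "s = (\<lambda>x. \<lambda>i\<in>I. min 1 (infdist x (F i) / \<epsilon>))"
  have w_nonneg: "0 \<le> w z \<sigma>" if "z \<in> X" "\<sigma> \<in> Pow I" for z \<sigma>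
    using that unfolding w_def by (intro mult_nonneg_nonneg prod_nonneg) (auto simp: X_iff I_def)
  have w_sum: "sum (w z) (Pow I) = 1" for z
    using prod_add[OF finI, of "\<lambda>i. 1 - \<bar>z i\<bar>" "\<lambda>i. \<bar>z i\<bar>"] by (simp add: w_def)
  have w_supp: "\<sigma> \<subseteq> {i \<in> I. \<bar>z i\<bar> < 1}" if "z \<in> X" "\<sigma> \<in> Pow I" "w z \<sigma> \<noteq> 0" for z \<sigma>
  proof
    fix i assume i: "i \<in> \<sigma>"
    have "finite \<sigma>" using that(2) finI finite_subset by auto
    then have "\<bar>z i\<bar> \<noteq> 1"
      using that(3) i by (auto simp: w_def)
    moreover have "\<bar>z i\<bar> \<le> 1" "i \<in> I"
      using that i by (auto simp: X_iff I_def)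
    ultimately show "i \<in> {i \<in> I. \<bar>z i\<bar> < 1}" by simp
  qed
  have X_supp: "{i \<in> I. \<bar>z i\<bar> < 1} \<in> \<Sigma>" if "z \<in> X" for z
    using that by (simp add: X_iff I_def)
  have \<pi>P: "\<pi> z \<in> P" if "z \<in> X" for z
    unfolding \<pi>_def using convex_P finI bP w_nonneg[OF that] w_sum by (intro convex_combination_mem) auto
  have \<pi>F: "\<pi> z \<in> F i" if z: "z \<in> X" and i: "i \<in> I" and zi: "z i = 0" for z i
    unfolding \<pi>_def
  proof (rule convex_combination_mem)
    fix \<sigma> assume \<sigma>: "\<sigma> \<in> Pow I" "w z \<sigma> \<noteq> 0"
    \<comment> \<open>Were \<open>i\<close> outside \<sigma>, the weight would contain the factor
      \<open>\<bar>z i\<bar> = 0\<close>.\<close>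
    have "i \<in> \<sigma>"
      using \<sigma>(2) i zi finI by (auto simp: w_def)
    moreover have "\<sigma> \<in> \<Sigma>"
      using Sigma_mono[OF X_supp[OF z] w_supp[OF z \<sigma>]] .
    ultimately show "b \<sigma> \<in> F i"
      using bC by (auto simp: C_def)
  qed (use convex_F i finI w_nonneg[OF z] w_sum in \<open>auto simp: I_def\<close>)
  have \<pi>hull: "\<pi> z \<in> convex hull (b ` Pow {i \<in> I. \<bar>z i\<bar> < 1})" if z: "z \<in> X" for z
    unfolding \<pi>_def
  proof (rule convex_combination_mem)
    fix \<sigma> assume "\<sigma> \<in> Pow I" "w z \<sigma> \<noteq> 0"
    then show "b \<sigma> \<in> convex hull (b ` Pow {i \<in> I. \<bar>z i\<bar> < 1})"
      using w_supp[OF z] by (intro hull_inc imageI) auto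
  qed (use finI w_nonneg[OF z] w_sum in auto)
  have s_ge: "0 \<le> s x i" "s x i \<le> 1" if "i \<in> I" for x i
    using that \<epsilon> by (auto simp: s_def infdist_nonneg)
  have sX: "s x \<in> X" if x: "x \<in> P" for x
  proof -
    have "{i \<in> I. \<bar>s x i\<bar> < 1} \<in> \<Sigma>"
    proof (rule ccontr)
      assume "{i \<in> I. \<bar>s x i\<bar> < 1} \<notin> \<Sigma>"
      then obtain i where "i \<in> I" "\<bar>s x i\<bar> < 1" "e1 \<le> infdist x (F i)"
        using e1(2)[of "{i \<in> I. \<bar>s x i\<bar> < 1}" x] x by auto
      then show False
        using \<epsilon> s_ge[of i x] by (auto simp: s_def \<epsilon>_def min_def divide_simps split: if_splits)
    qed
    then show ?thesis
      using s_ge by (auto simp: X_iff I_def) (auto simp: s_def I_def)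
  qed
  show thesis
  proof (rule that)
    have "continuous_map TX euclidean \<pi>"
      unfolding \<pi>_def
    proof (intro continuous_map_sum)
      fix \<sigma> assume "\<sigma> \<in> Pow I"
      then have "continuous_map TX euclideanreal (\<lambda>z. w z \<sigma>)"
        unfolding w_def using finI finite_subset
        by (intro continuous_map_real_mult continuous_map_prod continuous_map_diff continuous_map_real_abs
            continuous_map_TX_component) (auto simp: I_def)
      moreover have "continuous_map euclideanreal euclidean (\<lambda>r. r *\<^sub>R b \<sigma>)"
        by (simp add: continuous_on_scaleR continuous_on_id continuous_on_const)
      ultimately show "continuous_map TX euclidean (\<lambda>z. w z \<sigma> *\<^sub>R b \<sigma>)"
        using continuous_map_compose[of TX euclideanreal "\<lambda>z. w z \<sigma>" euclidean "\<lambda>r. r *\<^sub>R b \<sigma>"]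
        by (simp add: o_def)
    qed (use finI in simp)
    then show "continuous_map TX (top_of_set P) \<pi>"
      using \<pi>P by (auto simp: continuous_map_in_subtopology topspace_TX)
    show "\<pi> z \<in> F i" if "z \<in> X" "i \<in> {1..m}" "z i = 0" for z i
      using that \<pi>F by (simp add: I_def)
    have "w (\<lambda>i\<in>{1..m}. \<bar>z i\<bar>) \<sigma> = w z \<sigma>" if "\<sigma> \<in> Pow I" for z \<sigma>
    proof -
      have "(\<Prod>i\<in>\<sigma>. 1 - \<bar>(\<lambda>i\<in>{1..m}. \<bar>z i\<bar>) i\<bar>) = (\<Prod>i\<in>\<sigma>. 1 - \<bar>z i\<bar>)"
        by (rule prod.cong) (use that in \<open>auto simp: I_def\<close>)
      moreover have "(\<Prod>i\<in>I - \<sigma>. \<bar>(\<lambda>i\<in>{1..m}. \<bar>z i\<bar>) i\<bar>) = (\<Prod>i\<in>I - \<sigma>. \<bar>z i\<bar>)"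
        by (rule prod.cong) (use that in \<open>auto simp: I_def\<close>)
      ultimately show ?thesis by (simp only: w_def)
    qed
    then show "\<pi> (\<lambda>i\<in>{1..m}. \<bar>z i\<bar>) = \<pi> z" for z
      by (simp add: \<pi>_def)
    show "continuous_map (top_of_set P) TX s"
    proof (rule continuous_map_into_TX)
      fix i assume "i \<in> {1..m}"
      then have "(\<lambda>x. s x i) = (\<lambda>x. min 1 (infdist x (F i) / \<epsilon>))"
        by (simp add: s_def I_def)
      moreover have "continuous_on P (\<lambda>x. min 1 (infdist x (F i) / \<epsilon>))"
        using \<epsilon> by (intro continuous_intros) auto
      ultimately show "continuous_map (top_of_set P) euclideanreal (\<lambda>x. s x i)"
        by simp
    qed (use sX in simp)
    show "0 \<le> s x i" if "i \<in> {1..m}" for x i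
      using s_ge that by (simp add: I_def)
    show "s x i = 0" if "i \<in> {1..m}" "x \<in> F i" for x i
      using that by (simp add: s_def I_def)
    show "(\<lambda>i\<in>{1..m}. (1 - t) * z i + t * s (\<pi> z) i) \<in> X"
      if z: "z \<in> X" and z0: "\<And>i. i \<in> {1..m} \<Longrightarrow> 0 \<le> z i" and t: "0 \<le> t" "t \<le> 1" for z t
    proof -
      define \<tau> where "\<tau> = {i \<in> I. \<bar>z i\<bar> < 1}"
      \<comment> \<open>\<open>cl\<close> collects every \<open>F i\<close> that contains
        \<open>C \<tau>\<close>. It lies in \<Sigma> because \<open>C \<tau>\<close> is contained in
        \<open>C cl\<close>, and outside it both ends of the segment have coordinate 1.\<close>
      define cl where "cl = {i \<in> I. C \<tau> \<subseteq> F i}"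
      define y where "y = (\<lambda>i\<in>{1..m}. (1 - t) * z i + t * s (\<pi> z) i)"
      have \<tau>: "\<tau> \<in> \<Sigma>" using X_supp[OF z] by (simp add: \<tau>_def)
      have z1: "z i \<le> 1" if "i \<in> I" for i
        using z that abs_le_D1[of "z i" 1] by (auto simp: X_iff I_def)
      have y01: "0 \<le> y i" "y i \<le> 1" if "i \<in> I" for i
        using that z0[of i] z1[OF that] s_ge[OF that] t convex_bound_le[of "z i" 1 "s (\<pi> z) i" "1 - t" t]
        by (auto simp: y_def I_def)
      have "C \<tau> \<subseteq> C cl" by (auto simp: cl_def C_def)
      moreover have "C \<tau> \<noteq> {}" "cl \<subseteq> I" using \<tau> unfolding Sig cl_def by blast+
      ultimately have cl: "cl \<in> \<Sigma>" unfolding Sig by blast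
      have "y i = 1" if i: "i \<in> I" "i \<notin> cl" for i
      proof -
        have "i \<notin> \<tau>" using i by (auto simp: cl_def C_def)
        then have "z i = 1" using i(1) z0[of i] z1[of i] by (auto simp: \<tau>_def I_def)
        moreover have "e2 \<le> infdist (\<pi> z) (F i)"
          using e2(2)[OF \<tau> i(1)] i \<pi>hull[OF z] by (auto simp: cl_def \<tau>_def)
        then have "s (\<pi> z) i = 1"
          using i(1) \<epsilon> by (auto simp: s_def \<epsilon>_def min_def divide_simps)
        ultimately show ?thesis using i(1) by (simp add: y_def I_def)
      qed
      then have "{i \<in> I. \<bar>y i\<bar> < 1} \<subseteq> cl" by force
      then have "{i \<in> I. \<bar>y i\<bar> < 1} \<in> \<Sigma>" using cl Sigma_mono by blast
      then have "y \<in> X"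
        using y01 by (auto simp: X_iff I_def y_def)
      then show ?thesis by (simp add: y_def)
    qed
  qed
qed

end

section \<open>Decomposition of small cochains of the real moment-angle complex\<close>

lemma sum_insert_Pow:
  fixes g :: "'b set \<Rightarrow> 'c::comm_monoid_add"
  assumes "finite B" "x \<notin> B"
  shows "sum g (Pow (insert x B)) = sum g (Pow B) + (\<Sum>A\<in>Pow B. g (insert x A))"
proof -
  have "inj_on (insert x) (Pow B)"
    using assms(2) by (auto simp: inj_on_def)
  moreover have "Pow B \<inter> insert x ` Pow B = {}"
    using assms(2) by auto
  ultimately show ?thesis
    using assms(1) by (simp add: Pow_insert sum.union_disjoint sum.reindex)
qed

text \<open>Splitting off \<open>x\<close>, the alternating sum of \<open>f\<close> at
  \<open>insert x A\<close> is that of the shifted function at \<open>A\<close> minus that of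
  \<open>f\<close> at \<open>A\<close>. The latter cancels against the subsets without
  \<open>x\<close>, so only the shifted function on subsets of \<open>B\<close> survives.\<close>

lemma moebius_inversion:
  fixes f :: "'b set \<Rightarrow> int"
  assumes "finite B"
  shows "(\<Sum>A\<in>Pow B. \<Sum>C\<in>Pow A. (-1) ^ card (A - C) * f C) = f B"
  using assms
proof (induction B arbitrary: f rule: finite_induct)
  case (insert x B)
  define g where "g = (\<lambda>(f :: 'b set \<Rightarrow> int) A. \<Sum>C\<in>Pow A. (-1) ^ card (A - C) * f C)"
  have "g f (insert x A) = g (\<lambda>C. f (insert x C)) A - g f A" if A: "A \<in> Pow B" for A
  proof -
    have fin: "finite A" and x: "x \<notin> A" using A insert.hyps finite_subset by auto
    have "card (insert x A - C) = Suc (card (A - C))" if "C \<in> Pow A" for C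
      using that x fin by (subst insert_Diff_if) auto
    moreover have "insert x A - insert x C = A - C" if "C \<in> Pow A" for C
      using x by auto
    ultimately show ?thesis
      unfolding g_def sum_insert_Pow[OF fin x] by (simp add: sum_negf)
  qed
  then have "sum (g f) (Pow (insert x B)) = sum (g (\<lambda>C. f (insert x C))) (Pow B)"
    unfolding sum_insert_Pow[OF insert.hyps] by (simp add: sum_subtractf)
  then show ?case
    using insert.IH[of "\<lambda>C. f (insert x C)"] by (simp add: g_def)
qed simp

lemma front_face_simplex_map: "front_face p (simplex_map (p + q) f \<sigma>) = simplex_map p f (front_face p \<sigma>)"
  using standard_simplex_mono[of p "p + q"] by (auto simp: front_face_def simplex_map_def fun_eq_iff)

lemma back_face_simplex_map: "back_face p q (simplex_map (p + q) f \<sigma>) = simplex_map q f (back_face p q \<sigma>)"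
  using shift_in_standard_simplex[of _ q p] by (auto simp: back_face_def simplex_map_def fun_eq_iff)

lemma spullback_compose:
  assumes "continuous_map X Y f"
  shows "spullback p X {UNIV} f (spullback p Y {UNIV} g u) = spullback p X {UNIV} (\<lambda>x. g (f x)) u"
proof -
  have "simplex_map p g (simplex_map p f \<sigma>) = simplex_map p (\<lambda>x. g (f x)) \<sigma>" for \<sigma>
    using fun_cong[OF simplex_map_compose[of p g f], of \<sigma>] by (simp add: o_def)
  then show ?thesis
    using singular_simplex_simplex_map[OF _ assms] by (auto simp: spullback_def)
qed

section \<open>Orthants, folding and the assembly of cochains\<close>

locale stratified_faces = faces P m F for P :: "'a::euclidean_space set" and m F +
  fixes \<pi> :: "(nat \<Rightarrow> real) \<Rightarrow> 'a" and s :: "'a \<Rightarrow> nat \<Rightarrow> real"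
  assumes cont_\<pi>: "continuous_map TX (top_of_set P) \<pi>"
    and \<pi>_F: "z \<in> X \<Longrightarrow> i \<in> {1..m} \<Longrightarrow> z i = 0 \<Longrightarrow> \<pi> z \<in> F i"
    and \<pi>_abs: "\<pi> (\<lambda>i\<in>{1..m}. \<bar>z i\<bar>) = \<pi> z"
    and cont_s: "continuous_map (top_of_set P) TX s"
    and s_nonneg: "i \<in> {1..m} \<Longrightarrow> 0 \<le> s x i"
    and s_F: "i \<in> {1..m} \<Longrightarrow> x \<in> F i \<Longrightarrow> s x i = 0"
    and s_\<pi>: "z \<in> X \<Longrightarrow> (\<And>i. i \<in> {1..m} \<Longrightarrow> 0 \<le> z i) \<Longrightarrow> 0 \<le> t \<Longrightarrow> t \<le> 1 \<Longrightarrow>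
       (\<lambda>i\<in>{1..m}. (1 - t) * z i + t * s (\<pi> z) i) \<in> X"
begin

abbreviation "TP \<equiv> top_of_set P"
abbreviation "fu \<equiv> facet_union F"
definition "nonneg = {z::nat \<Rightarrow> real. \<forall>i\<in>{1..m}. 0 \<le> z i}"
definition "TQ = subtopology TX nonneg"
definition orthant :: "nat set \<Rightarrow> (nat \<Rightarrow> real) set" where
  "orthant \<beta> = {z. \<forall>i\<in>{1..m}. (i \<in> \<beta> \<longrightarrow> 0 \<le> z i) \<and> (i \<notin> \<beta> \<longrightarrow> z i \<le> 0)}"
definition "\<O> = orthant ` Pow {1..m}"
definition absz :: "(nat \<Rightarrow> real) \<Rightarrow> nat \<Rightarrow> real" where "absz z = (\<lambda>i\<in>{1..m}. \<bar>z i\<bar>)"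
definition sgnz :: "nat set \<Rightarrow> (nat \<Rightarrow> real) \<Rightarrow> nat \<Rightarrow> real" where
  "sgnz \<beta> z = (\<lambda>i\<in>{1..m}. if i \<in> \<beta> then z i else - z i)"
definition zero_at :: "nat \<Rightarrow> (nat \<Rightarrow> real) set" where "zero_at i = {z. z i = 0}"

text \<open>
  \<open>assemble\<close> extends the cochains \<open>v \<alpha>\<close>, pulled back along \<open>\<rho>\<close>, by zero from the part of the complex
  where the coordinates in \<open>\<alpha>\<close> are nonnegative, and adds them up.  On the orthant \<open>\<beta>\<close> only the
  \<open>\<alpha> \<subseteq> \<beta>\<close> contribute, so that products go to products over unions; Moebius inversion over the
  subsets of \<open>\<beta>\<close> gives the inverse.
\<close>

definition assemble ::
    "nat \<Rightarrow> ((nat \<Rightarrow> real) \<Rightarrow> 'b) \<Rightarrow> (nat set \<Rightarrow> ((nat \<Rightarrow> real) \<Rightarrow> 'b) \<Rightarrow> int) \<Rightarrow> ((nat \<Rightarrow> real) \<Rightarrow> nat \<Rightarrow> real) \<Rightarrow> int" where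
  "assemble p \<rho> v = (\<lambda>\<sigma>. if \<sigma> \<in> small_simplices TX \<O> p
     then \<Sum>\<alpha>\<in>Pow {1..m}. if \<sigma> ` standard_simplex p \<subseteq> {z. \<forall>i\<in>\<alpha>. 0 \<le> z i} then v \<alpha> (simplex_map p \<rho> \<sigma>) else 0
     else 0)"

text \<open>\<open>S i\<close> is the stratum that the hyperplane of coordinate \<open>i\<close>
  must enter. Two instances matter: \<pi> into \<open>P\<close> with strata \<open>F i\<close>, and
  the folding \<open>absz\<close> into \<open>TQ\<close> with strata
  \<open>zero_at i\<close>.\<close>

definition stratified_map :: "'b topology \<Rightarrow> (nat \<Rightarrow> 'b set) \<Rightarrow> ((nat \<Rightarrow> real) \<Rightarrow> 'b) \<Rightarrow> bool" where
  "stratified_map Y S \<rho> \<longleftrightarrow> continuous_map TX Y \<rho> \<and> (\<forall>z\<in>X. \<forall>i\<in>{1..m}. z i = 0 \<longrightarrow> \<rho> z \<in> S i)"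

lemma simplex_in_X: "singular_simplex p TX \<sigma> \<Longrightarrow> x \<in> standard_simplex p \<Longrightarrow> \<sigma> x \<in> X"
  using topspace_TX by (auto simp: singular_simplex_def continuous_map_def)

text \<open>If \<alpha> is not contained in \<beta>, a simplex of the orthant \<beta> with
  nonnegative \<alpha>-coordinates has a coordinate in \<alpha> - \<beta> that is identically 0; its
  image lies in a stratum on which \<open>v \<alpha>\<close> vanishes. For \<alpha> \<subseteq>
  \<beta> the sign condition is automatic.\<close>

lemma assemble_orthant:
  assumes \<rho>: "stratified_map Y S \<rho>" and v: "\<And>\<alpha>. \<alpha> \<in> Pow {1..m} \<Longrightarrow> v \<alpha> \<in> scochains p Y {UNIV} (S ` \<alpha>)"
    and \<sigma>: "singular_simplex p TX \<sigma>" and \<beta>: "\<beta> \<subseteq> {1..m}" and sub: "\<sigma> ` standard_simplex p \<subseteq> orthant \<beta>"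
  shows "assemble p \<rho> v \<sigma> = (\<Sum>\<alpha>\<in>Pow \<beta>. v \<alpha> (simplex_map p \<rho> \<sigma>))"
proof -
  have "\<sigma> \<in> small_simplices TX \<O> p"
    using \<sigma> \<beta> sub by (auto simp: small_simplices_def \<O>_def simp del: image_subset_iff)
  then have "assemble p \<rho> v \<sigma> = (\<Sum>\<alpha>\<in>Pow {1..m}.
      if \<sigma> ` standard_simplex p \<subseteq> {z. \<forall>i\<in>\<alpha>. 0 \<le> z i} then v \<alpha> (simplex_map p \<rho> \<sigma>) else 0)"
    by (simp add: assemble_def)
  also have "\<dots> = (\<Sum>\<alpha>\<in>Pow \<beta>. v \<alpha> (simplex_map p \<rho> \<sigma>))"
  proof (rule sum.mono_neutral_cong_right)
    show "\<forall>\<alpha>\<in>Pow {1..m} - Pow \<beta>.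
        (if \<sigma> ` standard_simplex p \<subseteq> {z. \<forall>i\<in>\<alpha>. 0 \<le> z i} then v \<alpha> (simplex_map p \<rho> \<sigma>) else 0) = 0"
    proof
      fix \<alpha> assume \<alpha>: "\<alpha> \<in> Pow {1..m} - Pow \<beta>"
      then obtain i where i: "i \<in> \<alpha>" "i \<notin> \<beta>" "i \<in> {1..m}" by blast
      have "v \<alpha> (simplex_map p \<rho> \<sigma>) = 0" if pos: "\<sigma> ` standard_simplex p \<subseteq> {z. \<forall>i\<in>\<alpha>. 0 \<le> z i}"
      proof (rule scochains_vanish[OF v])
        have "\<rho> (\<sigma> x) \<in> S i" if x: "x \<in> standard_simplex p" for x
        proof -
          have "0 \<le> \<sigma> x i" using pos x i(1) by auto
          moreover have "\<sigma> x i \<le> 0" using sub x i by (auto simp: orthant_def)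
          ultimately show ?thesis
            using \<rho> simplex_in_X[OF \<sigma> x] i(3) by (auto simp: stratified_map_def)
        qed
        then have "simplex_map p \<rho> \<sigma> ` standard_simplex p \<subseteq> S i"
          by (auto simp: simplex_map_def)
        moreover have "singular_simplex p Y (simplex_map p \<rho> \<sigma>)"
          using \<rho> \<sigma> singular_simplex_simplex_map by (auto simp: stratified_map_def)
        ultimately show "simplex_map p \<rho> \<sigma> \<in> small_simplices Y (S ` \<alpha>) p"
          using i(1) by (auto simp: small_simplices_def simp del: image_subset_iff)
      qed (use \<alpha> in auto)
      then show "(if \<sigma> ` standard_simplex p \<subseteq> {z. \<forall>i\<in>\<alpha>. 0 \<le> z i} then v \<alpha> (simplex_map p \<rho> \<sigma>) else 0) = 0"
        by simp
    qed
  next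
    fix \<alpha> assume \<alpha>: "\<alpha> \<in> Pow \<beta>"
    then have "\<sigma> ` standard_simplex p \<subseteq> {z. \<forall>i\<in>\<alpha>. 0 \<le> z i}"
      using sub \<beta> by (auto simp: orthant_def)
    then show "(if \<sigma> ` standard_simplex p \<subseteq> {z. \<forall>i\<in>\<alpha>. 0 \<le> z i} then v \<alpha> (simplex_map p \<rho> \<sigma>) else 0) = v \<alpha> (simplex_map p \<rho> \<sigma>)"
      by simp
  qed (use \<beta> in auto)
  finally show ?thesis .
qed

lemma small_orthantE:
  assumes "\<sigma> \<in> small_simplices TX \<O> p"
  obtains \<beta> where "\<beta> \<subseteq> {1..m}" "\<sigma> ` standard_simplex p \<subseteq> orthant \<beta>" "singular_simplex p TX \<sigma>"
  using assms by (auto simp: small_simplices_def \<O>_def simp del: image_subset_iff)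

lemma assemble_in_scochains: "assemble p \<rho> v \<in> scochains p TX \<O> {{}}"
  by (auto simp: scochains_def assemble_def small_simplices_empty)

lemma assemble_diff: "assemble p \<rho> (\<lambda>\<alpha>. v \<alpha> - w \<alpha>) = assemble p \<rho> v - assemble p \<rho> w"
  unfolding assemble_def fun_eq_iff by (auto simp: sum_subtractf[symmetric] intro!: sum.cong)

lemma assemble_add: "assemble p \<rho> (\<lambda>\<alpha>. v \<alpha> + w \<alpha>) = assemble p \<rho> v + assemble p \<rho> w"
  unfolding assemble_def fun_eq_iff by (auto simp: sum.distrib[symmetric] intro!: sum.cong)

lemma assemble_cong:
  "(\<And>\<alpha>. \<alpha> \<in> Pow {1..m} \<Longrightarrow> v \<alpha> = w \<alpha>) \<Longrightarrow> assemble p \<rho> v = assemble p \<rho> w"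
  unfolding assemble_def fun_eq_iff by (auto intro!: sum.cong)

lemma assemble_0: "assemble p \<rho> (\<lambda>\<alpha>. 0) = 0"
  using assemble_diff[of p \<rho> "\<lambda>_. 0" "\<lambda>_. 0"] by simp

lemma scoboundary_assemble:
  assumes \<rho>: "stratified_map Y S \<rho>" and v: "\<And>\<alpha>. \<alpha> \<in> Pow {1..m} \<Longrightarrow> v \<alpha> \<in> scochains p Y {UNIV} (S ` \<alpha>)"
  shows "scoboundary p TX \<O> (assemble p \<rho> v) = assemble (Suc p) \<rho> (\<lambda>\<alpha>. scoboundary p Y {UNIV} (v \<alpha>))"
proof
  fix \<sigma>
  show "scoboundary p TX \<O> (assemble p \<rho> v) \<sigma> = assemble (Suc p) \<rho> (\<lambda>\<alpha>. scoboundary p Y {UNIV} (v \<alpha>)) \<sigma>"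
  proof (cases "\<sigma> \<in> small_simplices TX \<O> (Suc p)")
    case True
    then obtain \<beta> where \<beta>: "\<beta> \<subseteq> {1..m}" and sub: "\<sigma> ` standard_simplex (Suc p) \<subseteq> orthant \<beta>"
      and \<sigma>: "singular_simplex (Suc p) TX \<sigma>"
      by (rule small_orthantE)
    have "singular_simplex (Suc p) Y (simplex_map (Suc p) \<rho> \<sigma>)"
      using \<rho> \<sigma> singular_simplex_simplex_map by (auto simp: stratified_map_def)
    then have d: "scoboundary p Y {UNIV} (v \<alpha>) (simplex_map (Suc p) \<rho> \<sigma>)
        = (\<Sum>k\<le>Suc p. (-1) ^ k * v \<alpha> (simplex_map p \<rho> (singular_face (Suc p) k \<sigma>)))" for \<alpha>
      by (simp add: scoboundary_face_sum simplex_map_face del: sum.atMost_Suc)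
    have f: "assemble p \<rho> v (singular_face (Suc p) k \<sigma>)
        = (\<Sum>\<alpha>\<in>Pow \<beta>. v \<alpha> (simplex_map p \<rho> (singular_face (Suc p) k \<sigma>)))" if "k \<in> {..Suc p}" for k
      using that \<sigma> subset_trans[OF singular_face_image sub] singular_simplex_singular_face[of "Suc p" TX \<sigma> k]
      by (intro assemble_orthant[OF \<rho> v _ \<beta>]) auto
    have "scoboundary p TX \<O> (assemble p \<rho> v) \<sigma>
        = (\<Sum>k\<le>Suc p. \<Sum>\<alpha>\<in>Pow \<beta>. (-1) ^ k * v \<alpha> (simplex_map p \<rho> (singular_face (Suc p) k \<sigma>)))"
      using True f by (simp add: scoboundary_face_sum sum_distrib_left del: sum.atMost_Suc)
    also have "\<dots> = (\<Sum>\<alpha>\<in>Pow \<beta>. scoboundary p Y {UNIV} (v \<alpha>) (simplex_map (Suc p) \<rho> \<sigma>))"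
      unfolding d by (rule sum.swap)
    also have "\<dots> = assemble (Suc p) \<rho> (\<lambda>\<alpha>. scoboundary p Y {UNIV} (v \<alpha>)) \<sigma>"
      by (rule assemble_orthant[OF \<rho> scoboundary_in_scochains[OF v] \<sigma> \<beta> sub, symmetric])
    finally show ?thesis .
  qed (simp add: scoboundary_def assemble_def)
qed

lemma assemble_in_scocycles:
  assumes "stratified_map Y S \<rho>" "\<And>\<alpha>. \<alpha> \<in> Pow {1..m} \<Longrightarrow> v \<alpha> \<in> scocycles p Y {UNIV} (S ` \<alpha>)"
  shows "assemble p \<rho> v \<in> scocycles p TX \<O> {{}}"
proof -
  have "scoboundary p TX \<O> (assemble p \<rho> v) = assemble (Suc p) \<rho> (\<lambda>\<alpha>. scoboundary p Y {UNIV} (v \<alpha>))"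
    using assms by (intro scoboundary_assemble) (auto simp: scocycles_def)
  also have "\<dots> = assemble (Suc p) \<rho> (\<lambda>\<alpha>. 0)"
    using assms(2) by (intro assemble_cong) (auto simp: scocycles_def)
  finally show ?thesis
    by (simp add: scocycles_def assemble_in_scochains assemble_0)
qed

lemma assemble_in_scoboundaries:
  assumes \<rho>: "stratified_map Y S \<rho>" and v: "\<And>\<alpha>. \<alpha> \<in> Pow {1..m} \<Longrightarrow> v \<alpha> \<in> scoboundaries p Y {UNIV} (S ` \<alpha>)"
  shows "assemble p \<rho> v \<in> scoboundaries p TX \<O> {{}}"
proof (cases p)
  case 0
  then have "assemble p \<rho> v = assemble p \<rho> (\<lambda>\<alpha>. 0)"
    using v by (intro assemble_cong) auto
  then show ?thesis by (simp add: assemble_0)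
next
  case (Suc r)
  have "\<exists>w. \<forall>\<alpha>\<in>Pow {1..m}. w \<alpha> \<in> scochains r Y {UNIV} (S ` \<alpha>) \<and> v \<alpha> = scoboundary r Y {UNIV} (w \<alpha>)"
    using v Suc by (intro bchoice) auto
  then obtain w where w: "\<And>\<alpha>. \<alpha> \<in> Pow {1..m} \<Longrightarrow> w \<alpha> \<in> scochains r Y {UNIV} (S ` \<alpha>)"
    "\<And>\<alpha>. \<alpha> \<in> Pow {1..m} \<Longrightarrow> v \<alpha> = scoboundary r Y {UNIV} (w \<alpha>)"
    by blast
  have "assemble p \<rho> v = assemble (Suc r) \<rho> (\<lambda>\<alpha>. scoboundary r Y {UNIV} (w \<alpha>))"
    unfolding Suc by (rule assemble_cong) (rule w(2))
  also have "\<dots> = scoboundary r TX \<O> (assemble r \<rho> w)"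
    by (rule scoboundary_assemble[OF \<rho> w(1), symmetric])
  finally show ?thesis
    using Suc assemble_in_scochains by auto
qed

lemma stratified_\<pi>: "stratified_map TP F \<pi>"
  using cont_\<pi> \<pi>_F by (auto simp: stratified_map_def)

lemma topspace_TQ: "topspace TQ = X \<inter> nonneg"
  by (simp add: TQ_def topspace_TX)

lemma absz_in_X: "z \<in> X \<Longrightarrow> absz z \<in> X"
  by (auto simp: X_iff absz_def cong: conj_cong)

lemma sgnz_in_X: "z \<in> X \<Longrightarrow> sgnz \<beta> z \<in> X"
proof -
  have "\<bar>sgnz \<beta> z i\<bar> = \<bar>z i\<bar>" if "i \<in> {1..m}" for i
    using that by (simp add: sgnz_def)
  then show "z \<in> X \<Longrightarrow> sgnz \<beta> z \<in> X"
    by (auto simp: X_iff cong: conj_cong) (simp add: sgnz_def)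
qed

lemma stratified_absz: "stratified_map TQ zero_at absz"
proof -
  have "continuous_map TX TX absz"
  proof (rule continuous_map_into_TX)
    fix i assume "i \<in> {1..m}"
    then show "continuous_map TX euclideanreal (\<lambda>x. absz x i)"
      using continuous_map_real_abs[OF continuous_map_TX_component] by (simp add: absz_def)
  qed (simp add: topspace_TX absz_in_X)
  then show ?thesis
    by (auto simp: stratified_map_def TQ_def continuous_map_in_subtopology nonneg_def absz_def zero_at_def)
qed

lemma continuous_sgnz: "continuous_map TQ TX (sgnz \<beta>)"
proof (rule continuous_map_into_TX)
  fix i assume i: "i \<in> {1..m}"
  then have "continuous_map TQ euclideanreal (\<lambda>z. z i)"
    unfolding TQ_def by (intro continuous_map_from_subtopology continuous_map_TX_component)
  with i show "continuous_map TQ euclideanreal (\<lambda>x. sgnz \<beta> x i)"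
    by (cases "i \<in> \<beta>") (auto simp: sgnz_def intro: continuous_map_minus)
qed (simp add: topspace_TQ sgnz_in_X)

lemma sgnz_orthant: "z \<in> nonneg \<Longrightarrow> sgnz \<beta> z \<in> orthant \<beta>"
  by (auto simp: sgnz_def orthant_def nonneg_def)

lemma absz_sgnz: "z \<in> X \<Longrightarrow> z \<in> nonneg \<Longrightarrow> absz (sgnz \<beta> z) = z"
  by (auto simp: absz_def sgnz_def nonneg_def X_iff extensional_def fun_eq_iff)

lemma sgnz_absz: "z \<in> X \<Longrightarrow> z \<in> orthant \<beta> \<Longrightarrow> sgnz \<beta> (absz z) = z"
  by (fastforce simp: absz_def sgnz_def orthant_def X_iff extensional_def fun_eq_iff)

section \<open>Inversion of the assembly over the nonnegative part\<close>

definition moebius :: "nat \<Rightarrow> (((nat \<Rightarrow> real) \<Rightarrow> nat \<Rightarrow> real) \<Rightarrow> int) \<Rightarrow> nat set \<Rightarrow> ((nat \<Rightarrow> real) \<Rightarrow> nat \<Rightarrow> real) \<Rightarrow> int" where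
  "moebius p y \<alpha> = (\<lambda>\<tau>. if singular_simplex p TQ \<tau>
     then \<Sum>\<beta>\<in>Pow \<alpha>. (-1) ^ card (\<alpha> - \<beta>) * y (simplex_map p (sgnz \<beta>) \<tau>) else 0)"

text \<open>On a simplex where a coordinate \<open>i\<close> in \<alpha> is 0, reflecting in that
  coordinate changes nothing. The terms for \<beta> and \<open>insert i \<beta>\<close> then agree
  up to opposite signs and cancel in pairs.\<close>

lemma moebius_in_scochains:
  assumes \<alpha>: "\<alpha> \<subseteq> {1..m}"
  shows "moebius p y \<alpha> \<in> scochains p TQ {UNIV} (zero_at ` \<alpha>)"
proof -
  have "moebius p y \<alpha> \<tau> = 0" if \<tau>: "\<tau> \<in> small_simplices TQ (zero_at ` \<alpha>) p" for \<tau>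
  proof -
    obtain i where i: "i \<in> \<alpha>" "\<tau> ` standard_simplex p \<subseteq> zero_at i" and s: "singular_simplex p TQ \<tau>"
      using \<tau> by (auto simp: small_simplices_def simp del: image_subset_iff)
    define A where "A = \<alpha> - {i}"
    have A: "finite A" "i \<notin> A" "\<alpha> = insert i A"
      using \<alpha> i(1) finite_subset by (auto simp: A_def)
    have "simplex_map p (sgnz (insert i \<beta>)) \<tau> = simplex_map p (sgnz \<beta>) \<tau>" for \<beta>
      using i(2) by (auto simp: simplex_map_def sgnz_def zero_at_def fun_eq_iff)
    moreover have "card (insert i A - \<beta>) = Suc (card (A - \<beta>))" if "\<beta> \<in> Pow A" for \<beta>
      using that A by (subst insert_Diff_if) auto
    moreover have "insert i A - insert i \<beta> = A - \<beta>" for \<beta>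
      using A by auto
    ultimately show ?thesis
      using s unfolding moebius_def A(3) sum_insert_Pow[OF A(1,2)] by (simp add: sum_negf)
  qed
  moreover have "moebius p y \<alpha> \<tau> = 0" if "\<not> singular_simplex p TQ \<tau>" for \<tau>
    using that by (simp add: moebius_def)
  ultimately show ?thesis
    unfolding scochains_def by auto
qed

lemma simplex_sgnz_orthant:
  assumes "singular_simplex p TQ \<tau>"
  shows "simplex_map p (sgnz \<beta>) \<tau> ` standard_simplex p \<subseteq> orthant \<beta>"
    and "singular_simplex p TX (simplex_map p (sgnz \<beta>) \<tau>)"
    and "\<beta> \<subseteq> {1..m} \<Longrightarrow> simplex_map p (sgnz \<beta>) \<tau> \<in> small_simplices TX \<O> p"
proof -
  have "\<tau> ` standard_simplex p \<subseteq> nonneg"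
    using assms by (auto simp: TQ_def singular_simplex_subtopology)
  then show 1: "simplex_map p (sgnz \<beta>) \<tau> ` standard_simplex p \<subseteq> orthant \<beta>"
    by (auto simp: simplex_map_def intro: sgnz_orthant)
  show 2: "singular_simplex p TX (simplex_map p (sgnz \<beta>) \<tau>)"
    using assms continuous_sgnz by (rule singular_simplex_simplex_map)
  show "simplex_map p (sgnz \<beta>) \<tau> \<in> small_simplices TX \<O> p" if "\<beta> \<subseteq> {1..m}"
    using 1 2 that by (auto simp: small_simplices_def \<O>_def simp del: image_subset_iff)
qed

lemma scoboundary_moebius:
  assumes \<alpha>: "\<alpha> \<subseteq> {1..m}"
  shows "scoboundary p TQ {UNIV} (moebius p y \<alpha>) = moebius (Suc p) (scoboundary p TX \<O> y) \<alpha>"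
proof
  fix \<tau>
  show "scoboundary p TQ {UNIV} (moebius p y \<alpha>) \<tau> = moebius (Suc p) (scoboundary p TX \<O> y) \<alpha> \<tau>"
  proof (cases "singular_simplex (Suc p) TQ \<tau>")
    case True
    have f: "singular_simplex p TQ (singular_face (Suc p) k \<tau>)" if "k \<le> Suc p" for k
      using singular_simplex_singular_face[OF True, of k] that by simp
    have "scoboundary p TX \<O> y (simplex_map (Suc p) (sgnz \<beta>) \<tau>)
        = (\<Sum>k\<le>Suc p. (-1) ^ k * y (simplex_map p (sgnz \<beta>) (singular_face (Suc p) k \<tau>)))" if "\<beta> \<in> Pow \<alpha>" for \<beta>
    proof -
      have "simplex_map (Suc p) (sgnz \<beta>) \<tau> \<in> small_simplices TX \<O> (Suc p)"
        using that \<alpha> by (intro simplex_sgnz_orthant(3)[OF True]) auto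
      then show ?thesis
        by (simp add: scoboundary_face_sum simplex_map_face del: sum.atMost_Suc)
    qed
    then have "moebius (Suc p) (scoboundary p TX \<O> y) \<alpha> \<tau>
        = (\<Sum>\<beta>\<in>Pow \<alpha>. \<Sum>k\<le>Suc p. (-1) ^ card (\<alpha> - \<beta>) * ((-1) ^ k * y (simplex_map p (sgnz \<beta>) (singular_face (Suc p) k \<tau>))))"
      using True by (simp add: moebius_def sum_distrib_left del: sum.atMost_Suc)
    also have "\<dots> = (\<Sum>k\<le>Suc p. \<Sum>\<beta>\<in>Pow \<alpha>. (-1) ^ k * ((-1) ^ card (\<alpha> - \<beta>) * y (simplex_map p (sgnz \<beta>) (singular_face (Suc p) k \<tau>))))"
      by (subst sum.swap) (simp add: mult.left_commute del: sum.atMost_Suc)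
    also have "\<dots> = (\<Sum>k\<le>Suc p. (-1) ^ k * moebius p y \<alpha> (singular_face (Suc p) k \<tau>))"
      by (rule sum.cong) (simp_all add: moebius_def f sum_distrib_left)
    also have "\<dots> = scoboundary p TQ {UNIV} (moebius p y \<alpha>) \<tau>"
      using True by (simp add: scoboundary_face_sum del: sum.atMost_Suc)
    finally show ?thesis ..
  qed (simp add: scoboundary_def moebius_def)
qed

text \<open>On a simplex of orthant \<beta> the assembly adds the alternating sums over all subsets
  of \<beta>. Moebius inversion leaves the value of \<open>y\<close> on the reflection by
  \<open>sgnz \<beta>\<close> of the folded simplex, which is \<sigma> itself.\<close>

lemma assemble_moebius:
  assumes y: "y \<in> scochains p TX \<O> {{}}"
  shows "assemble p absz (moebius p y) = y"
proof
  fix \<sigma>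
  show "assemble p absz (moebius p y) \<sigma> = y \<sigma>"
  proof (cases "\<sigma> \<in> small_simplices TX \<O> p")
    case True
    then obtain \<beta> where \<beta>: "\<beta> \<subseteq> {1..m}" and sub: "\<sigma> ` standard_simplex p \<subseteq> orthant \<beta>"
      and \<sigma>: "singular_simplex p TX \<sigma>"
      by (rule small_orthantE)
    have t: "singular_simplex p TQ (simplex_map p absz \<sigma>)"
      using \<sigma> stratified_absz singular_simplex_simplex_map by (auto simp: stratified_map_def)
    have "simplex_map p (sgnz \<beta>) (simplex_map p absz \<sigma>) x = \<sigma> x" for x
    proof (cases "x \<in> standard_simplex p")
      case True
      then have "\<sigma> x \<in> X" "\<sigma> x \<in> orthant \<beta>"
        using simplex_in_X[OF \<sigma>] sub by auto
      then show ?thesis using True by (simp add: simplex_map_def sgnz_absz)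
    next
      case False
      then show ?thesis using \<sigma> by (simp add: simplex_map_def singular_simplex_def extensional_def)
    qed
    then have eq: "simplex_map p (sgnz \<beta>) (simplex_map p absz \<sigma>) = \<sigma>" by blast
    have "assemble p absz (moebius p y) \<sigma> = (\<Sum>\<alpha>\<in>Pow \<beta>. moebius p y \<alpha> (simplex_map p absz \<sigma>))"
      using moebius_in_scochains by (intro assemble_orthant[OF stratified_absz _ \<sigma> \<beta> sub]) auto
    also have "\<dots> = y \<sigma>"
      using t moebius_inversion[of \<beta> "\<lambda>\<gamma>. y (simplex_map p (sgnz \<gamma>) (simplex_map p absz \<sigma>))"] \<beta> finite_subset eq
      by (auto simp: moebius_def)
    finally show ?thesis .
  qed (use scochains_outside[OF y] in \<open>simp add: assemble_def\<close>)
qed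

text \<open>The assembly is triangular: on the reflection of \<tau> into orthant \<alpha> it equals
  \<open>v \<alpha> \<tau>\<close> plus the terms for proper subsets, which vanish by
  induction.\<close>

lemma assemble_absz_inj:
  assumes v: "\<And>\<alpha>. \<alpha> \<in> Pow {1..m} \<Longrightarrow> v \<alpha> \<in> scochains p TQ {UNIV} (zero_at ` \<alpha>)"
    and 0: "assemble p absz v = 0" and \<alpha>: "\<alpha> \<subseteq> {1..m}"
  shows "v \<alpha> = 0"
proof -
  have "finite \<alpha>" using \<alpha> finite_subset by auto
  then show ?thesis using \<alpha>
  proof (induction \<alpha> rule: finite_psubset_induct)
    case (psubset \<alpha>)
    show ?case
    proof
      fix \<tau>
      show "v \<alpha> \<tau> = (0 :: _ \<Rightarrow> int) \<tau>"
      proof (cases "singular_simplex p TQ \<tau>")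
        case True
        have "simplex_map p absz (simplex_map p (sgnz \<alpha>) \<tau>) x = \<tau> x" for x
        proof (cases "x \<in> standard_simplex p")
          case x: True
          have "\<tau> x \<in> X \<inter> nonneg"
            using True x topspace_TQ by (auto simp: singular_simplex_def continuous_map_def)
          then show ?thesis using x by (simp add: simplex_map_def absz_sgnz)
        next
          case False
          then show ?thesis using True by (simp add: simplex_map_def singular_simplex_def extensional_def)
        qed
        then have eq: "simplex_map p absz (simplex_map p (sgnz \<alpha>) \<tau>) = \<tau>" by blast
        have "0 = (\<Sum>\<gamma>\<in>Pow \<alpha>. v \<gamma> \<tau>)"
          using assemble_orthant[OF stratified_absz v simplex_sgnz_orthant(2)[OF True] psubset.prems
              simplex_sgnz_orthant(1)[OF True]] 0 eq by simp
        also have "\<dots> = (\<Sum>\<gamma>\<in>{\<alpha>}. v \<gamma> \<tau>)"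
        proof (rule sum.mono_neutral_right)
          show "\<forall>\<gamma>\<in>Pow \<alpha> - {\<alpha>}. v \<gamma> \<tau> = 0"
          proof
            fix \<gamma> assume "\<gamma> \<in> Pow \<alpha> - {\<alpha>}"
            then have "v \<gamma> = 0" using psubset.prems by (intro psubset.IH) auto
            then show "v \<gamma> \<tau> = 0" by simp
          qed
        qed (use psubset.hyps in auto)
        finally show ?thesis by simp
      next
        case False
        then show ?thesis using scochains_outside[OF v] psubset.prems by auto
      qed
    qed
  qed
qed

section \<open>Homotopy equivalence of the nonnegative part with \<open>P\<close> on
  cochains\<close>

lemma continuous_map_line_TX:
  assumes "continuous_map T TX f" "continuous_map T TX g"
    and "\<And>t z. 0 \<le> t \<Longrightarrow> t \<le> 1 \<Longrightarrow> z \<in> topspace T \<Longrightarrow> (\<lambda>i\<in>{1..m}. (1 - t) * f z i + t * g z i) \<in> X"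
  shows "continuous_map (cylinder T) TX (\<lambda>(t, z). \<lambda>i\<in>{1..m}. (1 - t) * f z i + t * g z i)"
proof (rule continuous_map_into_TX)
  fix i assume i: "i \<in> {1..m}"
  have fst: "continuous_map (cylinder T) euclideanreal fst"
    by (rule continuous_map_into_fulltopology[OF continuous_map_fst])
  have comp: "continuous_map (cylinder T) euclideanreal (\<lambda>w. k (snd w) i)" if "continuous_map T TX k" for k
    using continuous_map_compose[OF continuous_map_compose[OF continuous_map_snd that] continuous_map_TX_component[OF i],
        of "top_of_set {0..1}"]
    by (simp add: o_def)
  show "continuous_map (cylinder T) euclideanreal (\<lambda>w. (\<lambda>(t, z). \<lambda>i\<in>{1..m}. (1 - t) * f z i + t * g z i) w i)"
    using i fst comp[OF assms(1)] comp[OF assms(2)]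
    by (auto simp: case_prod_unfold intro!: continuous_map_add continuous_map_real_mult continuous_map_diff)
qed (use assms(3) in auto)

lemma continuous_map_s_TQ: "continuous_map TP TQ s"
  using cont_s s_nonneg by (auto simp: TQ_def continuous_map_in_subtopology nonneg_def)

lemma continuous_map_\<pi>_TQ: "continuous_map TQ TP \<pi>"
  using cont_\<pi> by (simp add: TQ_def continuous_map_from_subtopology)

lemma continuous_map_line_P:
  fixes k :: "'a \<Rightarrow> 'a" and U V :: "'a set"
  assumes k: "continuous_map (top_of_set U) euclidean k" and U: "U \<subseteq> P"
    and V: "\<And>x t::real. x \<in> U \<Longrightarrow> 0 \<le> t \<Longrightarrow> t \<le> 1 \<Longrightarrow> (1 - t) *\<^sub>R x + t *\<^sub>R k x \<in> V"
  shows "continuous_map (cylinder (top_of_set U)) (top_of_set V) (\<lambda>(t, x). (1 - t) *\<^sub>R x + t *\<^sub>R k x)"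
proof -
  have "continuous_on U k" using k by simp
  then have "continuous_on ({0..1} \<times> U) (\<lambda>z. k (snd z))"
    by (rule continuous_on_compose2) (auto intro: continuous_intros)
  then have "continuous_on ({0..1::real} \<times> U) (\<lambda>(t, x). (1 - t) *\<^sub>R x + t *\<^sub>R k x)"
    unfolding case_prod_unfold by (intro continuous_intros)
  then show ?thesis
    using V by (auto simp: continuous_map_in_subtopology)
qed

text \<open>The straight line from \<open>x\<close> to \<open>\<pi> (s x)\<close> stays in
  \<open>P\<close> by convexity, and in \<open>F i\<close> for \<open>x\<close> in
  \<open>F i\<close>, since \<open>s x i = 0\<close> puts the far end in \<open>F i\<close>
  too.\<close>

lemma pullback_s_\<pi>:
  assumes u: "u \<in> scocycles p TP {UNIV} (F ` \<alpha>)" and \<alpha>: "\<alpha> \<subseteq> {1..m}"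
  shows "spullback p TP {UNIV} s (spullback p TQ {UNIV} \<pi> u) - u \<in> scoboundaries p TP {UNIV} (F ` \<alpha>)"
proof -
  let ?h = "\<lambda>(t::real, x). (1 - t) *\<^sub>R x + t *\<^sub>R \<pi> (s x)"
  have k: "continuous_map TP TP (\<lambda>x. \<pi> (s x))"
    using continuous_map_compose[OF cont_s cont_\<pi>] by (simp add: o_def)
  have h: "continuous_map (cylinder TP) TP ?h"
  proof (rule continuous_map_line_P)
    show "(1 - t) *\<^sub>R x + t *\<^sub>R \<pi> (s x) \<in> P" if "x \<in> P" "0 \<le> t" "t \<le> 1" for x and t :: real
      using that k convexD[OF convex_P, of x "\<pi> (s x)" "1 - t" t] by (auto simp: continuous_map_in_subtopology)
  qed (use k in \<open>auto simp: continuous_map_in_subtopology\<close>)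
  have F: "?h ` ({0..1} \<times> (F i \<inter> topspace TP)) \<subseteq> F i" if i: "i \<in> {1..m}" for i
  proof clarsimp
    fix t :: real and x assume tx: "0 \<le> t" "t \<le> 1" "x \<in> F i" "x \<in> P"
    have "s x \<in> X" using cont_s tx(4) topspace_TX by (auto simp: continuous_map_def)
    then have "\<pi> (s x) \<in> F i" using \<pi>_F i s_F[OF i tx(3)] by blast
    then show "(1 - t) *\<^sub>R x + t *\<^sub>R \<pi> (s x) \<in> F i"
      using tx convexD[OF convex_F[OF i], of x "\<pi> (s x)" "1 - t" t] by simp
  qed
  have "spullback p TP {UNIV} (\<lambda>x. ?h (1, x)) u - spullback p TP {UNIV} (\<lambda>x. ?h (0, x)) u
      \<in> scoboundaries p TP {UNIV} (F ` \<alpha>)"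
    using F \<alpha> by (intro homotopy_spullback[OF h _ u]) blast
  moreover have "spullback p TP {UNIV} (\<lambda>x. ?h (0, x)) u = u"
    using u scochains_outside[of u p TP "{UNIV}" "F ` \<alpha>"]
    by (auto simp: spullback_def fun_eq_iff simplex_map_id_gen scocycles_def)
  ultimately show ?thesis
    by (simp add: spullback_compose[OF continuous_map_s_TQ])
qed

text \<open>The homotopy runs along coordinate segments, which remain in \<open>X\<close> by
  \<open>s_\<pi>\<close>. A coordinate that is 0 stays 0: \<pi> sends such a point into
  \<open>F i\<close>, where \<open>s\<close> has coordinate 0.\<close>

lemma pullback_\<pi>_s:
  assumes v: "v \<in> scocycles p TQ {UNIV} (zero_at ` \<alpha>)" and \<alpha>: "\<alpha> \<subseteq> {1..m}"
  shows "spullback p TQ {UNIV} \<pi> (spullback p TP {UNIV} s v) - v \<in> scoboundaries p TQ {UNIV} (zero_at ` \<alpha>)"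
proof -
  let ?h = "\<lambda>(t::real, z). \<lambda>i\<in>{1..m}. (1 - t) * z i + t * s (\<pi> z) i"
  have ss: "continuous_map TQ TX (\<lambda>z. s (\<pi> z))"
    using continuous_map_compose[OF continuous_map_\<pi>_TQ cont_s] by (simp add: o_def)
  have "continuous_map (cylinder TQ) TX ?h"
  proof (rule continuous_map_line_TX)
    show "continuous_map TQ TX (\<lambda>z. z)"
      by (simp add: TQ_def continuous_map_from_subtopology)
  qed (use ss s_\<pi> in \<open>auto simp: topspace_TQ nonneg_def\<close>)
  then have h: "continuous_map (cylinder TQ) TQ ?h"
    using s_nonneg by (auto simp: TQ_def continuous_map_in_subtopology nonneg_def)
  have F: "?h ` ({0..1} \<times> (zero_at i \<inter> topspace TQ)) \<subseteq> zero_at i" if i: "i \<in> {1..m}" for i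
    using i \<pi>_F s_F by (auto simp: zero_at_def topspace_TQ)
  have "spullback p TQ {UNIV} (\<lambda>x. ?h (1, x)) v - spullback p TQ {UNIV} (\<lambda>x. ?h (0, x)) v
      \<in> scoboundaries p TQ {UNIV} (zero_at ` \<alpha>)"
    using F \<alpha> by (intro homotopy_spullback[OF h _ v]) blast
  moreover have "(\<lambda>i\<in>{1..m}. z i) = z" if "z \<in> X" for z
    using that by (auto simp: X_iff extensional_def fun_eq_iff)
  then have "simplex_map p (\<lambda>x. ?h (0, x)) \<sigma> = \<sigma>" if "singular_simplex p TQ \<sigma>" for \<sigma>
    using that by (intro simplex_map_id_gen) (auto simp: topspace_TQ)
  then have "spullback p TQ {UNIV} (\<lambda>x. ?h (0, x)) v = v"
    using v scochains_outside[of v p TQ "{UNIV}" "zero_at ` \<alpha>"]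
    by (intro ext) (simp add: spullback_def scocycles_def)
  moreover have "spullback p TQ {UNIV} (\<lambda>x. ?h (1, x)) v = spullback p TQ {UNIV} (\<lambda>z. s (\<pi> z)) v"
  proof -
    have h1: "?h (1, z) = s (\<pi> z)" if "z \<in> topspace TQ" for z
    proof -
      have "s (\<pi> z) \<in> X"
        using ss that topspace_TX by (auto simp: continuous_map_def)
      then show ?thesis by (auto simp: X_iff extensional_def fun_eq_iff)
    qed
    have "simplex_map p (\<lambda>x. ?h (1, x)) \<sigma> = simplex_map p (\<lambda>z. s (\<pi> z)) \<sigma>" if "singular_simplex p TQ \<sigma>" for \<sigma>
      by (rule simplex_map_eq[OF that]) (rule h1)
    then show ?thesis unfolding spullback_def by (intro ext) simp
  qed
  ultimately show ?thesis
    by (simp add: spullback_compose[OF continuous_map_\<pi>_TQ])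
qed

text \<open>Since \<pi> depends on absolute values only, it factors through the folding. Assemblies
  along \<pi> are thus assemblies over \<open>TQ\<close>, where inversion is available.\<close>

lemma assemble_\<pi>_eq:
  "assemble p \<pi> \<phi> = assemble p absz (\<lambda>\<alpha>. spullback p TQ {UNIV} \<pi> (\<phi> \<alpha>))"
proof
  fix \<sigma>
  have "simplex_map p \<pi> (simplex_map p absz \<sigma>) = simplex_map p \<pi> \<sigma>"
    using \<pi>_abs by (auto simp: simplex_map_def absz_def fun_eq_iff)
  moreover have "singular_simplex p TQ (simplex_map p absz \<sigma>)" if "\<sigma> \<in> small_simplices TX \<O> p"
    using singular_simplex_simplex_map[OF small_simplices_simplex[OF that]] stratified_absz
    by (auto simp: stratified_map_def)
  ultimately show "assemble p \<pi> \<phi> \<sigma> = assemble p absz (\<lambda>\<alpha>. spullback p TQ {UNIV} \<pi> (\<phi> \<alpha>)) \<sigma>"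
    by (simp add: assemble_def spullback_def cong: if_cong)
qed

lemma pullback_\<pi>_strata:
  assumes "\<alpha> \<subseteq> {1..m}" "B \<in> zero_at ` \<alpha>"
  shows "\<exists>A\<in>F ` \<alpha>. \<pi> ` (B \<inter> topspace TQ) \<subseteq> A"
proof -
  obtain i where i: "i \<in> \<alpha>" "B = zero_at i" using assms(2) by auto
  then have "\<pi> ` (B \<inter> topspace TQ) \<subseteq> F i"
    using \<pi>_F assms(1) by (auto simp: zero_at_def topspace_TQ)
  then show ?thesis using i(1) by blast
qed

lemma pullback_s_strata:
  assumes "\<alpha> \<subseteq> {1..m}" "B \<in> F ` \<alpha>"
  shows "\<exists>A\<in>zero_at ` \<alpha>. s ` (B \<inter> topspace TP) \<subseteq> A"
proof -
  obtain i where i: "i \<in> \<alpha>" "B = F i" using assms(2) by auto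
  then have "s ` (B \<inter> topspace TP) \<subseteq> zero_at i"
    using s_F assms(1) by (auto simp: zero_at_def)
  then show ?thesis using i(1) by blast
qed

text \<open>The candidate is the pullback along \<open>s\<close> of the alternating sums of
  \<open>y\<close>. Its assembly along \<pi> involves a pullback along
  \<open>s \<circ> \<pi>\<close>, which alters those sums by coboundaries only, and the sums
  themselves assemble to \<open>y\<close>.\<close>

lemma assemble_surj:
  assumes y: "y \<in> scocycles p TX \<O> {{}}"
  obtains \<phi> where "\<And>\<alpha>. \<alpha> \<in> Pow {1..m} \<Longrightarrow> \<phi> \<alpha> \<in> scocycles p TP {UNIV} (F ` \<alpha>)"
    "assemble p \<pi> \<phi> - y \<in> scoboundaries p TX \<O> {{}}"
proof
  define \<phi> where "\<phi> = (\<lambda>\<alpha>. spullback p TP {UNIV} s (moebius p y \<alpha>))"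
  have yc: "y \<in> scochains p TX \<O> {{}}" and y0: "scoboundary p TX \<O> y = 0"
    using y by (auto simp: scocycles_def)
  have "moebius (Suc p) 0 \<alpha> = 0" for \<alpha>
    by (auto simp: moebius_def fun_eq_iff)
  then have M: "moebius p y \<alpha> \<in> scocycles p TQ {UNIV} (zero_at ` \<alpha>)" if "\<alpha> \<in> Pow {1..m}" for \<alpha>
    using that moebius_in_scochains scoboundary_moebius y0 by (simp add: scocycles_def)
  show "\<phi> \<alpha> \<in> scocycles p TP {UNIV} (F ` \<alpha>)" if "\<alpha> \<in> Pow {1..m}" for \<alpha>
    unfolding \<phi>_def using that pullback_s_strata
    by (intro spullback_in_scocycles[OF M[OF that] continuous_map_s_TQ]) auto
  have "assemble p absz (\<lambda>\<alpha>. spullback p TQ {UNIV} \<pi> (\<phi> \<alpha>) - moebius p y \<alpha>) \<in> scoboundaries p TX \<O> {{}}"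
    unfolding \<phi>_def by (rule assemble_in_scoboundaries[OF stratified_absz pullback_\<pi>_s[OF M]]) auto
  then show "assemble p \<pi> \<phi> - y \<in> scoboundaries p TX \<O> {{}}"
    by (simp add: assemble_\<pi>_eq assemble_diff assemble_moebius[OF yc])
qed

text \<open>Over \<open>TQ\<close> the assembly is injective on cochains, so the alternating sums of
  a primitive of the assembled cochain are primitives of the pullbacks along \<pi>. Pulling back
  along \<open>s\<close> returns to \<open>P\<close>, up to the homotopy between
  \<open>\<pi> \<circ> s\<close> and the identity.\<close>

lemma assemble_inj:
  assumes \<phi>: "\<And>\<alpha>. \<alpha> \<in> Pow {1..m} \<Longrightarrow> \<phi> \<alpha> \<in> scocycles p TP {UNIV} (F ` \<alpha>)"
    and b: "assemble p \<pi> \<phi> \<in> scoboundaries p TX \<O> {{}}" and \<alpha>: "\<alpha> \<in> Pow {1..m}"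
  shows "\<phi> \<alpha> \<in> scoboundaries p TP {UNIV} (F ` \<alpha>)"
proof -
  have \<pi>\<phi>: "spullback p TQ {UNIV} \<pi> (\<phi> \<alpha>) \<in> scochains p TQ {UNIV} (zero_at ` \<alpha>)" if "\<alpha> \<in> Pow {1..m}" for \<alpha>
    using \<phi>[OF that] that pullback_\<pi>_strata
    by (intro spullback_in_scochains[OF _ continuous_map_\<pi>_TQ]) (auto simp: scocycles_def)
  have "spullback p TQ {UNIV} \<pi> (\<phi> \<alpha>) \<in> scoboundaries p TQ {UNIV} (zero_at ` \<alpha>)"
  proof (cases p)
    case 0
    then have "assemble p absz (\<lambda>\<alpha>. spullback p TQ {UNIV} \<pi> (\<phi> \<alpha>)) = 0"
      using b by (simp add: assemble_\<pi>_eq)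
    from assemble_absz_inj[OF \<pi>\<phi> this] \<alpha> show ?thesis by simp
  next
    case (Suc r)
    then obtain w where w: "w \<in> scochains r TX \<O> {{}}" "assemble p \<pi> \<phi> = scoboundary r TX \<O> w"
      using b by auto
    let ?v = "\<lambda>\<alpha>. spullback p TQ {UNIV} \<pi> (\<phi> \<alpha>) - scoboundary r TQ {UNIV} (moebius r w \<alpha>)"
    have "scoboundary r TX \<O> w = scoboundary r TX \<O> (assemble r absz (moebius r w))"
      using w by (simp add: assemble_moebius)
    also have "\<dots> = assemble p absz (\<lambda>\<alpha>. scoboundary r TQ {UNIV} (moebius r w \<alpha>))"
      unfolding Suc using moebius_in_scochains by (intro scoboundary_assemble[OF stratified_absz]) auto
    finally have "assemble p absz ?v = 0"
      using w by (simp add: assemble_diff assemble_\<pi>_eq)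
    moreover have "?v \<alpha> \<in> scochains p TQ {UNIV} (zero_at ` \<alpha>)" if "\<alpha> \<in> Pow {1..m}" for \<alpha>
      using \<pi>\<phi>[OF that] scoboundary_in_scochains[OF moebius_in_scochains[of \<alpha> r w]] that Suc
      by (intro scochains_diff) auto
    ultimately have "?v \<alpha> = 0"
      using \<alpha> by (intro assemble_absz_inj[of ?v]) auto
    then show ?thesis
      using Suc moebius_in_scochains[of \<alpha> r w] \<alpha> by auto
  qed
  then have "spullback p TP {UNIV} s (spullback p TQ {UNIV} \<pi> (\<phi> \<alpha>)) \<in> scoboundaries p TP {UNIV} (F ` \<alpha>)"
    using \<alpha> pullback_s_strata by (intro spullback_in_scoboundaries[OF _ continuous_map_s_TQ]) auto
  from scoboundaries_diff[OF this pullback_s_\<pi>[OF \<phi>[OF \<alpha>]]] \<alpha> show ?thesis by simp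
qed

end

subsection \<open>Excisive families\<close>

lemma srestrict_scup:
  "srestrict (p + q) X \<V> (scup p q X {UNIV} u v) = scup p q X \<V> (srestrict p X \<V> u) (srestrict q X \<V> v)"
proof
  fix \<sigma>
  show "srestrict (p + q) X \<V> (scup p q X {UNIV} u v) \<sigma> = scup p q X \<V> (srestrict p X \<V> u) (srestrict q X \<V> v) \<sigma>"
    by (cases "\<sigma> \<in> small_simplices X \<V> (p + q)")
      (simp_all add: srestrict_def scup_def small_front_face small_back_face small_simplices_simplex)
qed

context stratified_faces
begin

text \<open>The orthants are closed, so a deformation is required that pulls a neighbourhood of each
  into it while preserving every orthant and \<open>X\<close>. Moving each coordinate towards its
  clamped value achieves this.\<close>

lemma excisive_orthants: "excisive TX UNIV \<O>"
proof (rule excisiveI)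
  \<comment> \<open>The odd clamp: coordinates of absolute value at most 1/2 go to 0, while 1 and -1
    stay fixed. Signs and bounds, as in \<open>c_sign\<close>, keep the orthants and the cube;
    fixing 1 and -1 keeps the set of remaining coordinates in \<Sigma>.\<close>
  define c where "c = (\<lambda>z::nat \<Rightarrow> real. \<lambda>i\<in>{1..m}. max (2 * z i - 1) 0 + min (2 * z i + 1) 0)"
  let ?h = "\<lambda>(t::real, z). \<lambda>i\<in>{1..m}. (1 - t) * z i + t * c z i"
  have c_sign: "(0 \<le> r \<longrightarrow> 0 \<le> max (2 * r - 1) 0 + min (2 * r + 1) 0) \<and> (r \<le> 0 \<longrightarrow> max (2 * r - 1) 0 + min (2 * r + 1) 0 \<le> 0)
      \<and> \<bar>max (2 * r - 1) 0 + min (2 * r + 1) 0\<bar> \<le> \<bar>r\<bar>" if "\<bar>r\<bar> \<le> 1" for r :: real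
    using that by (auto simp: max_def min_def abs_if)
  have line: "(\<lambda>i\<in>{1..m}. (1 - t) * z i + t * c z i) \<in> X" if t: "0 \<le> t" "t \<le> 1" and z: "z \<in> X" for t z
  proof -
    define y where "y = (\<lambda>i\<in>{1..m}. (1 - t) * z i + t * c z i)"
    have le: "\<bar>y i\<bar> \<le> 1" and one: "\<bar>z i\<bar> = 1 \<longrightarrow> \<bar>y i\<bar> = 1" if i: "i \<in> {1..m}" for i
    proof -
      have zi: "\<bar>z i\<bar> \<le> 1" using z i by (auto simp: X_iff)
      then have ci: "\<bar>c z i\<bar> \<le> \<bar>z i\<bar>" using i c_sign by (simp add: c_def)
      have "\<bar>y i\<bar> \<le> (1 - t) * \<bar>z i\<bar> + t * \<bar>c z i\<bar>"
        using i t abs_triangle_ineq[of "(1 - t) * z i" "t * c z i"] by (simp add: y_def abs_mult)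
      also have "\<dots> \<le> 1"
        using t zi ci convex_bound_le[of "\<bar>z i\<bar>" 1 "\<bar>c z i\<bar>" "1 - t" t] by simp
      finally show "\<bar>y i\<bar> \<le> 1" .
      have "z i = 1 \<or> z i = -1" if "\<bar>z i\<bar> = 1" using that by auto
      then show "\<bar>z i\<bar> = 1 \<longrightarrow> \<bar>y i\<bar> = 1"
        using i by (auto simp: y_def c_def)
    qed
    have "{i\<in>{1..m}. \<bar>y i\<bar> < 1} \<subseteq> {i\<in>{1..m}. \<bar>z i\<bar> < 1}"
    proof clarify
      fix i assume i: "i \<in> {1..m}" "\<bar>y i\<bar> < 1"
      have "\<bar>z i\<bar> \<le> 1" using z i(1) by (auto simp: X_iff)
      then show "\<bar>z i\<bar> < 1" using one[OF i(1)] i(2) by fastforce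
    qed
    then have "{i\<in>{1..m}. \<bar>y i\<bar> < 1} \<in> \<Sigma>"
      using z Sigma_mono unfolding X_iff by blast
    then have "y \<in> X"
      using le by (auto simp: X_iff y_def)
    then show ?thesis by (simp add: y_def)
  qed
  fix p u assume u: "u \<in> scocycles p (subtopology TX UNIV) {UNIV} \<O>"
  have c1: "(\<lambda>i\<in>{1..m}. (1 - 1) * z i + 1 * c z i) = c z" for z
    by (auto simp: c_def fun_eq_iff)
  have cX: "c z \<in> X" if "z \<in> X" for z
    using line[of 1 z] that unfolding c1 by simp
  have cc: "continuous_map TX TX c"
  proof (rule continuous_map_into_TX)
    fix i assume i: "i \<in> {1..m}"
    then show "continuous_map TX euclideanreal (\<lambda>z. c z i)"
      using continuous_map_TX_component[OF i] unfolding c_def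
      by (auto intro!: continuous_map_add continuous_map_real_max continuous_map_real_min continuous_map_diff
          continuous_map_real_mult)
  qed (simp add: topspace_TX cX)
  have h: "continuous_map (cylinder TX) TX ?h"
    by (rule continuous_map_line_TX) (use cc line in \<open>auto simp: topspace_TX\<close>)
  have "u \<in> scoboundaries p TX {UNIV} \<O>"
  proof (rule small_cochains_acyclic[OF h])
    show "?h (0, z) = z" if "z \<in> topspace TX" for z
      using that by (auto simp: topspace_TX X_iff extensional_def fun_eq_iff)
    fix A assume "A \<in> \<O>"
    then obtain \<beta> where \<beta>: "A = orthant \<beta>" by (auto simp: \<O>_def)
    have zX: "\<bar>z i\<bar> \<le> 1" if "z \<in> X" "i \<in> {1..m}" for z i
      using that by (auto simp: X_iff)
    show "?h ` ({0..1} \<times> (A \<inter> topspace TX)) \<subseteq> A"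
    proof clarify
      fix t z assume t: "t \<in> {0..1::real}" and z: "z \<in> A" "z \<in> topspace TX"
      have "(i \<in> \<beta> \<longrightarrow> 0 \<le> (1 - t) * z i + t * c z i) \<and> (i \<notin> \<beta> \<longrightarrow> (1 - t) * z i + t * c z i \<le> 0)" if i: "i \<in> {1..m}" for i
      proof -
        have "(i \<in> \<beta> \<longrightarrow> 0 \<le> z i \<and> 0 \<le> c z i) \<and> (i \<notin> \<beta> \<longrightarrow> z i \<le> 0 \<and> c z i \<le> 0)"
          using z i c_sign[OF zX[of z i]] by (auto simp: \<beta> orthant_def c_def topspace_TX)
        then show ?thesis
          using t mult_nonneg_nonpos[of "1 - t" "z i"] mult_nonneg_nonpos[of t "c z i"]
          by (auto intro: add_nonneg_nonneg mult_nonneg_nonneg add_nonpos_nonpos)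
      qed
      then show "(\<lambda>i\<in>{1..m}. (1 - t) * z i + t * c z i) \<in> A"
        by (simp add: \<beta> orthant_def)
    qed
    show "\<exists>V. openin TX V \<and> A \<inter> topspace TX \<subseteq> V \<and> (\<forall>z\<in>V. ?h (1, z) \<in> A)"
    proof (intro exI conjI)
      \<comment> \<open>Coordinates may lie on the wrong side of 0 by less than 1/2, which the clamp
        removes. The explicit intersection with the space covers \<open>m = 0\<close>, where the
        indexed intersection is everything.\<close>
      let ?V = "topspace TX \<inter> (\<Inter>i\<in>{1..m}. {z \<in> topspace TX. z i \<in> (if i \<in> \<beta> then {- 1/2 <..} else {..<1/2})})"
      have "openin TX {z \<in> topspace TX. z i \<in> (if i \<in> \<beta> then {- 1/2 <..} else {..<1/2})}" if "i \<in> {1..m}" for i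
        by (rule openin_continuous_map_preimage[OF continuous_map_TX_component[OF that]]) auto
      then show "openin TX ?V"
        by (cases "m = 0") (auto intro!: openin_Int openin_INT2)
      show "A \<inter> topspace TX \<subseteq> ?V"
      proof
        fix z assume z: "z \<in> A \<inter> topspace TX"
        have "z i \<in> (if i \<in> \<beta> then {- 1/2 <..} else {..<1/2})" if i: "i \<in> {1..m}" for i
        proof -
          have "(i \<in> \<beta> \<longrightarrow> 0 \<le> z i) \<and> (i \<notin> \<beta> \<longrightarrow> z i \<le> 0)"
            using z i by (simp add: \<beta> orthant_def)
          then show ?thesis by auto
        qed
        then show "z \<in> ?V" using z by blast
      qed
      show "\<forall>z\<in>?V. ?h (1, z) \<in> A"
      proof
        fix z assume z: "z \<in> ?V"
        have "(i \<in> \<beta> \<longrightarrow> 0 \<le> c z i) \<and> (i \<notin> \<beta> \<longrightarrow> c z i \<le> 0)" if i: "i \<in> {1..m}" for i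
        proof -
          have "z i \<in> (if i \<in> \<beta> then {- 1/2 <..} else {..<1/2})" using z i by auto
          then show ?thesis using i by (auto simp: c_def max_def min_def split: if_splits)
        qed
        then show "?h (1, z) \<in> A"
          by (simp add: \<beta> orthant_def)
      qed
    qed
  next
    show "topspace TX \<subseteq> \<Union>\<O>"
    proof
      fix z assume "z \<in> topspace TX"
      have "z \<in> orthant {i \<in> {1..m}. 0 \<le> z i}" by (auto simp: orthant_def)
      then show "z \<in> \<Union>\<O>" by (auto simp: \<O>_def)
    qed
    show "u \<in> scocycles p TX {UNIV} \<O>" using u by simp
  qed
  then show "u \<in> scoboundaries p (subtopology TX UNIV) {UNIV} \<O>" by simp
qed simp

text \<open>The family \<open>S\<close> of index sets serves two uses: singletons, for passing from
  the separate \<open>F i\<close> to their union, and pairs, for cup products. The deformation moves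
  \<open>x\<close> in a straight line to \<open>k x\<close>, which lies in \<open>F i\<close> as
  soon as \<open>s x i\<close> is at most 1/2.\<close>

lemma excisive_facets:
  assumes S: "S \<subseteq> Pow {1..m}"
  shows "excisive TP (fu (\<Union>S)) (fu ` S)"
proof (rule excisiveI)
  define U where "U = fu (\<Union>S)"
  have UP: "U \<subseteq> P" using S F_subset by (fastforce simp: U_def facet_union_def)
  have sub: "subtopology TP U = top_of_set U"
    using UP by (simp add: subtopology_subtopology inf.absorb2)
  define c where "c = (\<lambda>z::nat \<Rightarrow> real. \<lambda>i\<in>{1..m}. max 0 (2 * z i - 1))"
  have cX: "c z \<in> X" if z: "z \<in> X" "\<And>i. i \<in> {1..m} \<Longrightarrow> 0 \<le> z i" for z
  proof -
    have ci: "0 \<le> c z i \<and> c z i \<le> 1 \<and> (z i = 1 \<longrightarrow> c z i = 1)" if "i \<in> {1..m}" for i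
    proof -
      have "\<bar>z i\<bar> \<le> 1" using z(1) that by (auto simp: X_iff)
      then show ?thesis using that by (auto simp: c_def)
    qed
    have "{i\<in>{1..m}. \<bar>c z i\<bar> < 1} \<subseteq> {i\<in>{1..m}. \<bar>z i\<bar> < 1}"
    proof clarify
      fix i assume i: "i \<in> {1..m}" "\<bar>c z i\<bar> < 1"
      have "\<bar>z i\<bar> \<le> 1" using z(1) i(1) by (auto simp: X_iff)
      then show "\<bar>z i\<bar> < 1" using ci[OF i(1)] i(2) z(2)[OF i(1)] by fastforce
    qed
    then have "{i\<in>{1..m}. \<bar>c z i\<bar> < 1} \<in> \<Sigma>"
      using z(1) Sigma_mono unfolding X_iff by blast
    then show ?thesis
      using ci by (auto simp: X_iff) (simp add: c_def)
  qed
  \<comment> \<open>The clamp is transported to \<open>P\<close>: pass to coordinates by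
    \<open>s\<close>, clamp, return by \<pi>. A zero coordinate returns to the corresponding
    \<open>F i\<close>.\<close>
  define k where "k = (\<lambda>x. \<pi> (c (s x)))"
  have sX: "s x \<in> X" if "x \<in> P" for x
    using cont_s that topspace_TX by (auto simp: continuous_map_def)
  have csX: "c (s x) \<in> X" if "x \<in> P" for x
    by (rule cX[OF sX[OF that] s_nonneg])
  have "continuous_map TP TX (\<lambda>x. c (s x))"
  proof (rule continuous_map_into_TX)
    fix i assume i: "i \<in> {1..m}"
    have "continuous_map TP euclideanreal (\<lambda>x. s x i)"
      using continuous_map_compose[OF cont_s continuous_map_TX_component[OF i]] by (simp add: o_def)
    then have "continuous_map TP euclideanreal (\<lambda>x. max 0 (2 * s x i - 1))"
      by (intro continuous_map_real_max continuous_map_diff continuous_map_real_mult) simp_all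
    then show "continuous_map TP euclideanreal (\<lambda>x. c (s x) i)"
      using i by (simp add: c_def)
  qed (use csX in simp)
  from continuous_map_compose[OF this cont_\<pi>] have k: "continuous_map TP TP k"
    unfolding k_def o_def .
  have kF: "k x \<in> F i" if "x \<in> P" "i \<in> {1..m}" "s x i \<le> 1/2" for x i
    unfolding k_def using that by (intro \<pi>_F csX) (auto simp: c_def)
  \<comment> \<open>A point of \<open>F i\<close> has \<open>s x i = 0\<close>, so
    \<open>k x\<close> is again in \<open>F i\<close>, and convexity keeps the whole segment
    there.\<close>
  have line: "(1 - t) *\<^sub>R x + t *\<^sub>R k x \<in> F i" if "x \<in> F i" "i \<in> {1..m}" "0 \<le> t" "t \<le> 1" for x i and t :: real
  proof -
    have "k x \<in> F i" using that s_F[OF that(2,1)] F_subset by (intro kF) auto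
    then show ?thesis
      using that convexD[OF convex_F[OF that(2)], of x "k x" "1 - t" t] by simp
  qed
  have line_fu: "(1 - t) *\<^sub>R x + t *\<^sub>R k x \<in> fu \<alpha>" if "x \<in> fu \<alpha>" "\<alpha> \<subseteq> {1..m}" "0 \<le> t" "t \<le> 1" for x \<alpha> and t :: real
    using that line by (fastforce simp: facet_union_def)
  have Sm: "\<Union>S \<subseteq> {1..m}" using S by auto
  let ?h = "\<lambda>(t::real, x). (1 - t) *\<^sub>R x + t *\<^sub>R k x"
  have h: "continuous_map (cylinder (top_of_set U)) (top_of_set U) ?h"
  proof (rule continuous_map_line_P[OF _ UP])
    show "continuous_map (top_of_set U) euclidean k"
      using k UP by (auto simp: continuous_map_in_subtopology intro: continuous_on_subset)
    show "(1 - t) *\<^sub>R x + t *\<^sub>R k x \<in> U" if "x \<in> U" "0 \<le> t" "t \<le> 1" for x and t :: real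
      using that line_fu[OF _ Sm] by (simp add: U_def)
  qed
  fix p u assume u: "u \<in> scocycles p (subtopology TP U) {UNIV} (fu ` S)"
  have "u \<in> scoboundaries p (top_of_set U) {UNIV} (fu ` S)"
  proof (rule small_cochains_acyclic[OF h])
    show "?h (0, x) = x" for x by simp
    fix A assume "A \<in> fu ` S"
    then obtain \<alpha> where \<alpha>: "\<alpha> \<in> S" "A = fu \<alpha>" by auto
    then have \<alpha>m: "\<alpha> \<subseteq> {1..m}" using S by auto
    show "?h ` ({0..1} \<times> (A \<inter> topspace (top_of_set U))) \<subseteq> A"
      using line_fu[OF _ \<alpha>m] \<alpha>(2) by auto
    show "\<exists>V. openin (top_of_set U) V \<and> A \<inter> topspace (top_of_set U) \<subseteq> V \<and> (\<forall>x\<in>V. ?h (1, x) \<in> A)"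
    proof (intro exI conjI)
      let ?V = "\<Union>i\<in>\<alpha>. {x \<in> topspace (top_of_set U). s x i \<in> {..<1/2}}"
      have "openin (top_of_set U) {x \<in> topspace (top_of_set U). s x i \<in> {..<1/2}}" if "i \<in> \<alpha>" for i
      proof (rule openin_continuous_map_preimage)
        have "continuous_map TP euclideanreal (\<lambda>x. s x i)"
          using continuous_map_compose[OF cont_s continuous_map_TX_component[of i]] that \<alpha>m by (auto simp: o_def)
        then show "continuous_map (top_of_set U) euclideanreal (\<lambda>x. s x i)"
          using UP by (auto intro: continuous_on_subset)
      qed auto
      then show "openin (top_of_set U) ?V" by blast
      show "A \<inter> topspace (top_of_set U) \<subseteq> ?V"
      proof
        fix x assume x: "x \<in> A \<inter> topspace (top_of_set U)"
        then obtain i where i: "i \<in> \<alpha>" "x \<in> F i" using \<alpha>(2) by (auto simp: facet_union_def)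
        then have "s x i = 0" using s_F \<alpha>m by blast
        then show "x \<in> ?V" using x i(1) by (intro UN_I[OF i(1)]) simp
      qed
      show "\<forall>x\<in>?V. ?h (1, x) \<in> A"
      proof
        fix x assume "x \<in> ?V"
        then obtain i where i: "i \<in> \<alpha>" "x \<in> U" "s x i < 1/2" by auto
        then have "k x \<in> F i" using UP \<alpha>m by (intro kF) auto
        then show "?h (1, x) \<in> A" using i(1) \<alpha>(2) by (auto simp: facet_union_def)
      qed
    qed
  next
    show "topspace (top_of_set U) \<subseteq> \<Union>(fu ` S)"
      by (auto simp: U_def facet_union_def)
  qed (use u sub in simp)
  then show "u \<in> scoboundaries p (subtopology TP U) {UNIV} (fu ` S)" by (simp only: sub)
next
  show "A \<subseteq> fu (\<Union>S)" if "A \<in> fu ` S" for A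
    using that by (auto simp: facet_union_def)
qed

lemma fu_singletons: "F ` \<alpha> = fu ` ((\<lambda>i. {i}) ` \<alpha>)"
  by (auto simp: facet_union_def image_image)

lemma excisive_facet_family:
  assumes "\<alpha> \<subseteq> {1..m}" shows "excisive TP (fu \<alpha>) (F ` \<alpha>)"
proof -
  have "(\<Union>i\<in>\<alpha>. {i}) = \<alpha>" by auto
  then show ?thesis
    using excisive_facets[of "(\<lambda>i. {i}) ` \<alpha>"] assms unfolding fu_singletons by auto
qed

lemma excisive_facet_pair:
  assumes "\<alpha> \<subseteq> {1..m}" "\<beta> \<subseteq> {1..m}" shows "excisive TP (fu (\<alpha> \<union> \<beta>)) {fu \<alpha>, fu \<beta>}"
  using excisive_facets[of "{\<alpha>, \<beta>}"] assms by simp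

lemma scocycles_fu_subset: "scocycles p TP {UNIV} {fu \<alpha>} \<subseteq> scocycles p TP {UNIV} (F ` \<alpha>)"
  by (rule scocycles_antimono) (auto simp: facet_union_def)

lemma scoboundaries_fu_subset: "scoboundaries p TP {UNIV} {fu \<alpha>} \<subseteq> scoboundaries p TP {UNIV} (F ` \<alpha>)"
  by (rule scoboundaries_antimono) (auto simp: facet_union_def)

lemma scoboundaries_fu_pair_subset:
  "scoboundaries p TP {UNIV} {fu \<alpha>, fu \<beta>} \<subseteq> scoboundaries p TP {UNIV} (F ` (\<alpha> \<union> \<beta>))"
  by (rule scoboundaries_antimono) (auto simp: facet_union_def)

subsection \<open>Products\<close>

definition unions_to :: "nat set \<Rightarrow> (nat set \<times> nat set) set" where
  "unions_to \<gamma> = {(\<alpha>, \<beta>). \<alpha> \<subseteq> {1..m} \<and> \<beta> \<subseteq> {1..m} \<and> \<alpha> \<union> \<beta> = \<gamma>}"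

lemma finite_unions_to: "finite (unions_to \<gamma>)"
  by (rule finite_subset[of _ "Pow {1..m} \<times> Pow {1..m}"]) (auto simp: unions_to_def)

lemma scup_scochains_F:
  assumes "u \<in> scochains p TP {UNIV} (F ` \<alpha>)" "v \<in> scochains q TP {UNIV} (F ` \<beta>)" "(\<alpha>, \<beta>) \<in> unions_to \<gamma>"
  shows "scup p q TP {UNIV} u v \<in> scochains (p + q) TP {UNIV} (F ` \<gamma>)"
  using scup_in_scochains[OF assms(1,2)] assms(3) by (auto simp: unions_to_def image_Un)

text \<open>On a simplex in orthant \<open>\<beta>0\<close>, whose front and back faces stay in that
  orthant, both assemblies are sums over subsets of \<open>\<beta>0\<close>. The product is a sum
  over pairs, regrouped by their union; pairs with union inside \<open>\<beta>0\<close> are exactly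
  the pairs of subsets of \<open>\<beta>0\<close>.\<close>

lemma scup_assemble:
  assumes \<phi>: "\<And>\<alpha>. \<alpha> \<in> Pow {1..m} \<Longrightarrow> \<phi> \<alpha> \<in> scochains p TP {UNIV} (F ` \<alpha>)"
    and \<psi>: "\<And>\<alpha>. \<alpha> \<in> Pow {1..m} \<Longrightarrow> \<psi> \<alpha> \<in> scochains q TP {UNIV} (F ` \<alpha>)"
  shows "scup p q TX \<O> (assemble p \<pi> \<phi>) (assemble q \<pi> \<psi>)
       = assemble (p + q) \<pi> (\<lambda>\<gamma>. \<Sum>(\<alpha>, \<beta>)\<in>unions_to \<gamma>. scup p q TP {UNIV} (\<phi> \<alpha>) (\<psi> \<beta>))"
proof
  fix \<sigma>
  let ?\<Phi> = "\<lambda>\<gamma>. \<Sum>(\<alpha>, \<beta>)\<in>unions_to \<gamma>. scup p q TP {UNIV} (\<phi> \<alpha>) (\<psi> \<beta>)"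
  show "scup p q TX \<O> (assemble p \<pi> \<phi>) (assemble q \<pi> \<psi>) \<sigma> = assemble (p + q) \<pi> ?\<Phi> \<sigma>"
  proof (cases "\<sigma> \<in> small_simplices TX \<O> (p + q)")
    case True
    then obtain \<beta>0 where \<beta>0: "\<beta>0 \<subseteq> {1..m}" and sub: "\<sigma> ` standard_simplex (p + q) \<subseteq> orthant \<beta>0"
      and \<sigma>: "singular_simplex (p + q) TX \<sigma>"
      by (rule small_orthantE)
    have \<Phi>: "?\<Phi> \<gamma> \<in> scochains (p + q) TP {UNIV} (F ` \<gamma>)" if "\<gamma> \<in> Pow {1..m}" for \<gamma>
    proof (rule scochains_sum)
      fix x assume "x \<in> unions_to \<gamma>"
      moreover obtain \<alpha> \<beta> where "x = (\<alpha>, \<beta>)" by (cases x)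
      ultimately show "(case x of (\<alpha>, \<beta>) \<Rightarrow> scup p q TP {UNIV} (\<phi> \<alpha>) (\<psi> \<beta>)) \<in> scochains (p + q) TP {UNIV} (F ` \<gamma>)"
        using \<phi> \<psi> scup_scochains_F[of "\<phi> \<alpha>" p \<alpha> "\<psi> \<beta>" q \<beta> \<gamma>] by (auto simp: unions_to_def)
    qed
    define g where "g = (\<lambda>(\<alpha>, \<beta>). \<phi> \<alpha> (simplex_map p \<pi> (front_face p \<sigma>)) * \<psi> \<beta> (simplex_map q \<pi> (back_face p q \<sigma>)))"
    have "assemble p \<pi> \<phi> (front_face p \<sigma>) = (\<Sum>\<alpha>\<in>Pow \<beta>0. \<phi> \<alpha> (simplex_map p \<pi> (front_face p \<sigma>)))"
      using singular_simplex_front_face[OF \<sigma>] subset_trans[OF front_face_image sub]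
      by (intro assemble_orthant[OF stratified_\<pi> \<phi> _ \<beta>0])
    moreover have "assemble q \<pi> \<psi> (back_face p q \<sigma>) = (\<Sum>\<beta>\<in>Pow \<beta>0. \<psi> \<beta> (simplex_map q \<pi> (back_face p q \<sigma>)))"
      using singular_simplex_back_face[OF \<sigma>] subset_trans[OF back_face_image sub]
      by (intro assemble_orthant[OF stratified_\<pi> \<psi> _ \<beta>0])
    ultimately have "scup p q TX \<O> (assemble p \<pi> \<phi>) (assemble q \<pi> \<psi>) \<sigma> = sum g (Pow \<beta>0 \<times> Pow \<beta>0)"
      using True by (simp add: scup_def g_def sum_product sum.cartesian_product)
    also have "\<dots> = (\<Sum>\<gamma>\<in>Pow \<beta>0. sum g {x \<in> Pow \<beta>0 \<times> Pow \<beta>0. fst x \<union> snd x = \<gamma>})"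
      using \<beta>0 finite_subset by (intro sum.group[symmetric]) auto
    also have "\<dots> = (\<Sum>\<gamma>\<in>Pow \<beta>0. sum g (unions_to \<gamma>))"
    proof (rule sum.cong)
      fix \<gamma> assume "\<gamma> \<in> Pow \<beta>0"
      then have "{x \<in> Pow \<beta>0 \<times> Pow \<beta>0. fst x \<union> snd x = \<gamma>} = unions_to \<gamma>"
        using \<beta>0 by (auto simp: unions_to_def)
      then show "sum g {x \<in> Pow \<beta>0 \<times> Pow \<beta>0. fst x \<union> snd x = \<gamma>} = sum g (unions_to \<gamma>)" by simp
    qed simp
    also have "\<dots> = (\<Sum>\<gamma>\<in>Pow \<beta>0. ?\<Phi> \<gamma> (simplex_map (p + q) \<pi> \<sigma>))"
    proof (rule sum.cong)
      fix \<gamma>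
      have s: "singular_simplex (p + q) TP (simplex_map (p + q) \<pi> \<sigma>)"
        using \<sigma> cont_\<pi> by (rule singular_simplex_simplex_map)
      have "(\<Sum>x\<in>D. case x of (\<alpha>, \<beta>) \<Rightarrow> scup p q TP {UNIV} (\<phi> \<alpha>) (\<psi> \<beta>)) (simplex_map (p + q) \<pi> \<sigma>) = sum g D"
        if "finite D" for D
        using that
      proof (induction D rule: finite_induct)
        case (insert x D)
        obtain \<alpha> \<beta> where x: "x = (\<alpha>, \<beta>)" by (cases x)
        have "scup p q TP {UNIV} (\<phi> \<alpha>) (\<psi> \<beta>) (simplex_map (p + q) \<pi> \<sigma>) = g x"
          using s by (simp add: scup_def g_def x front_face_simplex_map back_face_simplex_map)
        then show ?case
          using insert by (simp add: x)
      qed simp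
      then show "sum g (unions_to \<gamma>) = ?\<Phi> \<gamma> (simplex_map (p + q) \<pi> \<sigma>)"
        using finite_unions_to by simp
    qed simp
    also have "\<dots> = assemble (p + q) \<pi> ?\<Phi> \<sigma>"
      using \<Phi> by (intro assemble_orthant[OF stratified_\<pi> _ \<sigma> \<beta>0 sub, symmetric])
    finally show ?thesis .
  qed (simp add: scup_def assemble_def)
qed

text \<open>Restriction from \<open>TX\<close> and assembly from \<open>P\<close> both end in the
  cochains on simplices inside an orthant, and each is inverted only in cohomology. Two elements
  correspond if they have representatives that meet there up to a coboundary. Representatives on the
  \<open>P\<close> side vanish on the union \<open>fu \<alpha>\<close>, as relative cohomology
  demands, whereas assembly asks for vanishing on the separate \<open>F i\<close>.\<close>

definition corresponds ::
    "nat \<Rightarrow> ((nat \<Rightarrow> real) chain \<Rightarrow> int) set \<Rightarrow> (nat set \<Rightarrow> ('a chain \<Rightarrow> int) set) \<Rightarrow> bool" where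
  "corresponds p y x \<longleftrightarrow> (\<exists>\<psi> \<phi>. \<psi> \<in> scocycles p TX {UNIV} {{}} \<and>
     (\<forall>\<alpha>\<in>Pow {1..m}. \<phi> \<alpha> \<in> scocycles p TP {UNIV} {fu \<alpha>}) \<and>
     y = cohomology_class p TX {{}} \<psi> \<and> x = (\<lambda>\<alpha>\<in>Pow {1..m}. cohomology_class p TP {fu \<alpha>} (\<phi> \<alpha>)) \<and>
     srestrict p TX \<O> \<psi> - assemble p \<pi> \<phi> \<in> scoboundaries p TX \<O> {{}})"

lemma correspondsI:
  "\<psi> \<in> scocycles p TX {UNIV} {{}} \<Longrightarrow> (\<And>\<alpha>. \<alpha> \<in> Pow {1..m} \<Longrightarrow> \<phi> \<alpha> \<in> scocycles p TP {UNIV} {fu \<alpha>}) \<Longrightarrow>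
     y = cohomology_class p TX {{}} \<psi> \<Longrightarrow> x = (\<lambda>\<alpha>\<in>Pow {1..m}. cohomology_class p TP {fu \<alpha>} (\<phi> \<alpha>)) \<Longrightarrow>
     srestrict p TX \<O> \<psi> - assemble p \<pi> \<phi> \<in> scoboundaries p TX \<O> {{}} \<Longrightarrow> corresponds p y x"
  unfolding corresponds_def by blast

lemma correspondsE:
  assumes "corresponds p y x"
  obtains \<psi> \<phi> where "\<psi> \<in> scocycles p TX {UNIV} {{}}" "\<forall>\<alpha>\<in>Pow {1..m}. \<phi> \<alpha> \<in> scocycles p TP {UNIV} {fu \<alpha>}"
     "y = cohomology_class p TX {{}} \<psi>" "x = (\<lambda>\<alpha>\<in>Pow {1..m}. cohomology_class p TP {fu \<alpha>} (\<phi> \<alpha>))"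
     "srestrict p TX \<O> \<psi> - assemble p \<pi> \<phi> \<in> scoboundaries p TX \<O> {{}}"
  using assms unfolding corresponds_def by blast

lemma group_cohomology: "group (cohomology_group p Y \<A>)"
  using comm_group_cohomology_group comm_group.axioms(2) by blast

lemma carrier_facet_sum_group:
  "carrier (facet_sum_group P m F p) = (\<Pi>\<^sub>E \<alpha>\<in>Pow {1..m}. cohomology_class p TP {fu \<alpha>} ` scocycles p TP {UNIV} {fu \<alpha>})"
proof -
  have "finite {\<alpha> \<in> Pow {1..m}. x \<alpha> \<noteq> \<one>\<^bsub>relative_cohomology_group p TP (fu \<alpha>)\<^esub>}" for x
    by (rule finite_subset[of _ "Pow {1..m}"]) auto
  then show ?thesis
    unfolding facet_sum_group_def by (subst carrier_sum_group) (auto simp: group_cohomology carrier_cohomology_group)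
qed

lemma comm_group_facet_sum_group: "comm_group (facet_sum_group P m F p)"
proof (rule group.group_comm_groupI)
  show "group (facet_sum_group P m F p)"
    unfolding facet_sum_group_def by (rule sum_group) (rule group_cohomology)
  fix x y assume xy: "x \<in> carrier (facet_sum_group P m F p)" "y \<in> carrier (facet_sum_group P m F p)"
  have "x \<alpha> \<otimes>\<^bsub>relative_cohomology_group p TP (fu \<alpha>)\<^esub> y \<alpha> = y \<alpha> \<otimes>\<^bsub>relative_cohomology_group p TP (fu \<alpha>)\<^esub> x \<alpha>"
    if "\<alpha> \<in> Pow {1..m}" for \<alpha>
    using PiE_mem[OF xy(1)[unfolded carrier_facet_sum_group] that] PiE_mem[OF xy(2)[unfolded carrier_facet_sum_group] that]
    by (intro comm_monoid.m_comm[OF comm_group.axioms(1)[OF comm_group_cohomology_group]])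
       (simp_all only: carrier_cohomology_group)
  then show "x \<otimes>\<^bsub>facet_sum_group P m F p\<^esub> y = y \<otimes>\<^bsub>facet_sum_group P m F p\<^esub> x"
    unfolding facet_sum_group_def mult_sum_group by (rule restrict_ext)
qed

lemma assemble_scocycles_fu:
  assumes "\<And>\<alpha>. \<alpha> \<in> Pow {1..m} \<Longrightarrow> \<phi> \<alpha> \<in> scocycles p TP {UNIV} {fu \<alpha>}"
  shows "assemble p \<pi> \<phi> \<in> scocycles p TX \<O> {{}}"
  by (intro assemble_in_scocycles[OF stratified_\<pi>] subsetD[OF scocycles_fu_subset] assms)

lemma corresponds_carrier:
  assumes "corresponds p y x"
  shows "y \<in> carrier (relative_cohomology_group p TX {})" "x \<in> carrier (facet_sum_group P m F p)"
proof -
  obtain \<psi> \<phi> where \<psi>: "\<psi> \<in> scocycles p TX {UNIV} {{}}"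
    and \<phi>0: "\<forall>\<alpha>\<in>Pow {1..m}. \<phi> \<alpha> \<in> scocycles p TP {UNIV} {fu \<alpha>}"
    and y: "y = cohomology_class p TX {{}} \<psi>" and x: "x = (\<lambda>\<alpha>\<in>Pow {1..m}. cohomology_class p TP {fu \<alpha>} (\<phi> \<alpha>))"
    and "srestrict p TX \<O> \<psi> - assemble p \<pi> \<phi> \<in> scoboundaries p TX \<O> {{}}"
    using correspondsE[OF assms] .
  note \<phi> = bspec[OF \<phi>0]
  show "y \<in> carrier (relative_cohomology_group p TX {})"
    unfolding y carrier_cohomology_group using \<psi> by (rule imageI)
  show "x \<in> carrier (facet_sum_group P m F p)"
    unfolding x carrier_facet_sum_group by (intro restrict_PiE_iff[THEN iffD2] ballI imageI \<phi>)
qed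

text \<open>The restricted cocycle is taken apart by \<open>assemble_surj\<close> into cocycles that
  vanish on each \<open>F i\<close> separately. Excision replaces them by cohomologous ones that
  vanish on the unions, and the differences assemble to a coboundary.\<close>

lemma corresponds_left:
  assumes "y \<in> carrier (relative_cohomology_group p TX {})"
  shows "\<exists>x. corresponds p y x"
proof -
  obtain \<psi> where \<psi>: "\<psi> \<in> scocycles p TX {UNIV} {{}}" "y = cohomology_class p TX {{}} \<psi>"
    using assms by (auto simp: carrier_cohomology_group)
  obtain \<phi> where \<phi>: "\<And>\<alpha>. \<alpha> \<in> Pow {1..m} \<Longrightarrow> \<phi> \<alpha> \<in> scocycles p TP {UNIV} (F ` \<alpha>)"
    "assemble p \<pi> \<phi> - srestrict p TX \<O> \<psi> \<in> scoboundaries p TX \<O> {{}}"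
    using assemble_surj[OF srestrict_in_scocycles[OF \<psi>(1)]] by blast
  have "\<exists>u. u \<in> scocycles p TP {UNIV} {fu \<alpha>} \<and> \<phi> \<alpha> - u \<in> scoboundaries p TP {UNIV} (F ` \<alpha>)" if "\<alpha> \<in> Pow {1..m}" for \<alpha>
    using excision_surj[OF excisive_facet_family \<phi>(1)[OF that]] that by auto
  then obtain \<phi>' where \<phi>': "\<And>\<alpha>. \<alpha> \<in> Pow {1..m} \<Longrightarrow> \<phi>' \<alpha> \<in> scocycles p TP {UNIV} {fu \<alpha>}"
    "\<And>\<alpha>. \<alpha> \<in> Pow {1..m} \<Longrightarrow> \<phi> \<alpha> - \<phi>' \<alpha> \<in> scoboundaries p TP {UNIV} (F ` \<alpha>)"
    by metis
  have "assemble p \<pi> (\<lambda>\<alpha>. \<phi> \<alpha> - \<phi>' \<alpha>) \<in> scoboundaries p TX \<O> {{}}"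
    by (rule assemble_in_scoboundaries[OF stratified_\<pi> \<phi>'(2)])
  from scoboundaries_diff[OF this \<phi>(2)]
  have "srestrict p TX \<O> \<psi> - assemble p \<pi> \<phi>' \<in> scoboundaries p TX \<O> {{}}"
    by (simp add: assemble_diff)
  then show ?thesis
    using correspondsI[OF \<psi>(1) \<phi>'(1) \<psi>(2) refl] by blast
qed

text \<open>Assembly produces a cocycle on the simplices inside orthants, and excision for the
  orthant cover extends it to a cocycle on all simplices of \<open>TX\<close>.\<close>

lemma corresponds_right:
  assumes "x \<in> carrier (facet_sum_group P m F p)"
  shows "\<exists>y. corresponds p y x"
proof -
  have "\<forall>\<alpha>\<in>Pow {1..m}. \<exists>u. u \<in> scocycles p TP {UNIV} {fu \<alpha>} \<and> x \<alpha> = cohomology_class p TP {fu \<alpha>} u"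
    using assms by (auto simp: carrier_facet_sum_group PiE_iff image_iff)
  then obtain \<phi> where \<phi>: "\<And>\<alpha>. \<alpha> \<in> Pow {1..m} \<Longrightarrow> \<phi> \<alpha> \<in> scocycles p TP {UNIV} {fu \<alpha>}"
    "\<And>\<alpha>. \<alpha> \<in> Pow {1..m} \<Longrightarrow> x \<alpha> = cohomology_class p TP {fu \<alpha>} (\<phi> \<alpha>)"
    by metis
  obtain \<psi> where \<psi>: "\<psi> \<in> scocycles p TX {UNIV} {{}}" "srestrict p TX \<O> \<psi> = assemble p \<pi> \<phi>"
    using small_cochains_surj[OF excisive_orthants assemble_scocycles_fu[OF \<phi>(1)]] by blast
  have "x = (\<lambda>\<alpha>\<in>Pow {1..m}. cohomology_class p TP {fu \<alpha>} (\<phi> \<alpha>))"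
    using assms \<phi>(2) by (auto simp: carrier_facet_sum_group PiE_iff extensional_def fun_eq_iff)
  then show ?thesis
    using correspondsI[OF \<psi>(1) \<phi>(1) refl] \<psi>(2) by auto
qed

text \<open>A chain of equivalences, one for each map of the zigzag: restriction to small simplices,
  assembly, excision. Each says that the map preserves and reflects coboundaries; with additivity
  this makes the relation one-to-one.\<close>

lemma corresponds_one:
  assumes "corresponds p y x"
  shows "y = \<one>\<^bsub>relative_cohomology_group p TX {}\<^esub> \<longleftrightarrow> x = \<one>\<^bsub>facet_sum_group P m F p\<^esub>"
proof -
  obtain \<psi> \<phi> where \<psi>: "\<psi> \<in> scocycles p TX {UNIV} {{}}"
    and \<phi>0: "\<forall>\<alpha>\<in>Pow {1..m}. \<phi> \<alpha> \<in> scocycles p TP {UNIV} {fu \<alpha>}"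
    and y: "y = cohomology_class p TX {{}} \<psi>" and x: "x = (\<lambda>\<alpha>\<in>Pow {1..m}. cohomology_class p TP {fu \<alpha>} (\<phi> \<alpha>))"
    and d: "srestrict p TX \<O> \<psi> - assemble p \<pi> \<phi> \<in> scoboundaries p TX \<O> {{}}"
    using correspondsE[OF assms] .
  note \<phi> = bspec[OF \<phi>0]
  have \<phi>F: "\<phi> \<alpha> \<in> scocycles p TP {UNIV} (F ` \<alpha>)" if "\<alpha> \<in> Pow {1..m}" for \<alpha>
    using \<phi>[OF that] scocycles_fu_subset by blast
  have "y = \<one>\<^bsub>relative_cohomology_group p TX {}\<^esub> \<longleftrightarrow> \<psi> \<in> scoboundaries p TX {UNIV} {{}}"
    using cohomology_class_eq_iff[OF \<psi> scocycles_0] by (simp add: y one_cohomology_group)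
  also have "\<dots> \<longleftrightarrow> srestrict p TX \<O> \<psi> \<in> scoboundaries p TX \<O> {{}}"
    using small_cochains_inj[OF excisive_orthants \<psi>] srestrict_in_scoboundaries by blast
  also have "\<dots> \<longleftrightarrow> assemble p \<pi> \<phi> \<in> scoboundaries p TX \<O> {{}}"
    using scoboundaries_add[OF d, of "assemble p \<pi> \<phi>"] scoboundaries_diff[OF _ d, of "srestrict p TX \<O> \<psi>"] by auto
  also have "\<dots> \<longleftrightarrow> (\<forall>\<alpha>\<in>Pow {1..m}. \<phi> \<alpha> \<in> scoboundaries p TP {UNIV} (F ` \<alpha>))"
    using assemble_inj[of \<phi> p, OF \<phi>F] assemble_in_scoboundaries[OF stratified_\<pi>, of \<phi> p] by blast
  also have "\<dots> \<longleftrightarrow> (\<forall>\<alpha>\<in>Pow {1..m}. \<phi> \<alpha> \<in> scoboundaries p TP {UNIV} {fu \<alpha>})"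
    using excision_inj[OF excisive_facet_family \<phi>] scoboundaries_fu_subset by blast
  also have "\<dots> \<longleftrightarrow> (\<forall>\<alpha>\<in>Pow {1..m}. cohomology_class p TP {fu \<alpha>} (\<phi> \<alpha>) = cohomology_class p TP {fu \<alpha>} 0)"
    using cohomology_class_eq_iff[OF \<phi> scocycles_0] by simp
  also have "\<dots> \<longleftrightarrow> x = \<one>\<^bsub>facet_sum_group P m F p\<^esub>"
    by (auto simp: x facet_sum_group_def one_cohomology_group fun_eq_iff)
  finally show ?thesis .
qed

lemma corresponds_mult:
  assumes "corresponds p y x" "corresponds p y' x'"
  shows "corresponds p (y \<otimes>\<^bsub>relative_cohomology_group p TX {}\<^esub> y') (x \<otimes>\<^bsub>facet_sum_group P m F p\<^esub> x')"
proof -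
  obtain \<psi> \<phi> where \<psi>: "\<psi> \<in> scocycles p TX {UNIV} {{}}"
    and \<phi>0: "\<forall>\<alpha>\<in>Pow {1..m}. \<phi> \<alpha> \<in> scocycles p TP {UNIV} {fu \<alpha>}"
    and y: "y = cohomology_class p TX {{}} \<psi>" and x: "x = (\<lambda>\<alpha>\<in>Pow {1..m}. cohomology_class p TP {fu \<alpha>} (\<phi> \<alpha>))"
    and d: "srestrict p TX \<O> \<psi> - assemble p \<pi> \<phi> \<in> scoboundaries p TX \<O> {{}}"
    using correspondsE[OF assms(1)] .
  note \<phi> = bspec[OF \<phi>0]
  obtain \<psi>' \<phi>' where \<psi>': "\<psi>' \<in> scocycles p TX {UNIV} {{}}"
    and \<phi>10: "\<forall>\<alpha>\<in>Pow {1..m}. \<phi>' \<alpha> \<in> scocycles p TP {UNIV} {fu \<alpha>}"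
    and y': "y' = cohomology_class p TX {{}} \<psi>'" and x': "x' = (\<lambda>\<alpha>\<in>Pow {1..m}. cohomology_class p TP {fu \<alpha>} (\<phi>' \<alpha>))"
    and d': "srestrict p TX \<O> \<psi>' - assemble p \<pi> \<phi>' \<in> scoboundaries p TX \<O> {{}}"
    using correspondsE[OF assms(2)] .
  note \<phi>' = bspec[OF \<phi>10]
  show ?thesis
  proof (rule correspondsI)
    show "\<psi> + \<psi>' \<in> scocycles p TX {UNIV} {{}}" using \<psi> \<psi>' by (rule scocycles_add)
    show "\<phi> \<alpha> + \<phi>' \<alpha> \<in> scocycles p TP {UNIV} {fu \<alpha>}" if "\<alpha> \<in> Pow {1..m}" for \<alpha>
      using \<phi>[OF that] \<phi>'[OF that] by (rule scocycles_add)
    show "y \<otimes>\<^bsub>relative_cohomology_group p TX {}\<^esub> y' = cohomology_class p TX {{}} (\<psi> + \<psi>')"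
      by (simp add: y y' mult_cohomology_class)
    show "x \<otimes>\<^bsub>facet_sum_group P m F p\<^esub> x' = (\<lambda>\<alpha>\<in>Pow {1..m}. cohomology_class p TP {fu \<alpha>} (\<phi> \<alpha> + \<phi>' \<alpha>))"
      by (auto simp: x x' facet_sum_group_def mult_cohomology_class fun_eq_iff)
    show "srestrict p TX \<O> (\<psi> + \<psi>') - assemble p \<pi> (\<lambda>\<alpha>. \<phi> \<alpha> + \<phi>' \<alpha>) \<in> scoboundaries p TX \<O> {{}}"
      using scoboundaries_add[OF d d'] by (simp add: srestrict_add assemble_add algebra_simps)
  qed
qed

text \<open>The products are compared on small simplices, where restriction and assembly are
  multiplicative. On the \<open>P\<close> side the cup of two representatives vanishes only on
  simplices inside \<open>fu \<alpha>\<close> or inside \<open>fu \<beta>\<close>; a cohomologous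
  \<xi> that vanishes on the union has to replace it before it represents the product class.\<close>

lemma corresponds_prod:
  assumes "corresponds p y x" "corresponds q y' x'"
  shows "corresponds (p + q) (cup_product p q TX {} {} y y') (facet_sum_product P m F p q x x')"
proof -
  obtain \<psi> \<phi> where \<psi>: "\<psi> \<in> scocycles p TX {UNIV} {{}}"
    and \<phi>0: "\<forall>\<alpha>\<in>Pow {1..m}. \<phi> \<alpha> \<in> scocycles p TP {UNIV} {fu \<alpha>}"
    and y: "y = cohomology_class p TX {{}} \<psi>" and x: "x = (\<lambda>\<alpha>\<in>Pow {1..m}. cohomology_class p TP {fu \<alpha>} (\<phi> \<alpha>))"
    and d: "srestrict p TX \<O> \<psi> - assemble p \<pi> \<phi> \<in> scoboundaries p TX \<O> {{}}"
    using correspondsE[OF assms(1)] .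
  note \<phi> = bspec[OF \<phi>0]
  obtain \<psi>' \<phi>' where \<psi>': "\<psi>' \<in> scocycles q TX {UNIV} {{}}"
    and \<phi>10: "\<forall>\<alpha>\<in>Pow {1..m}. \<phi>' \<alpha> \<in> scocycles q TP {UNIV} {fu \<alpha>}"
    and y': "y' = cohomology_class q TX {{}} \<psi>'" and x': "x' = (\<lambda>\<alpha>\<in>Pow {1..m}. cohomology_class q TP {fu \<alpha>} (\<phi>' \<alpha>))"
    and d': "srestrict q TX \<O> \<psi>' - assemble q \<pi> \<phi>' \<in> scoboundaries q TX \<O> {{}}"
    using correspondsE[OF assms(2)] .
  note \<phi>' = bspec[OF \<phi>10]
  let ?cup = "\<lambda>\<alpha> \<beta>. scup p q TP {UNIV} (\<phi> \<alpha>) (\<phi>' \<beta>)"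
  have "\<exists>\<xi>. \<xi> \<in> scocycles (p + q) TP {UNIV} {fu (\<alpha> \<union> \<beta>)} \<and> ?cup \<alpha> \<beta> - \<xi> \<in> scoboundaries (p + q) TP {UNIV} {fu \<alpha>, fu \<beta>}"
    if "\<alpha> \<in> Pow {1..m}" "\<beta> \<in> Pow {1..m}" for \<alpha> \<beta>
  proof -
    have c: "?cup \<alpha> \<beta> \<in> scocycles (p + q) TP {UNIV} {fu \<alpha>, fu \<beta>}"
      using scup_in_scocycles[OF \<phi>[OF that(1)] \<phi>'[OF that(2)]] by (simp add: insert_commute)
    have e: "excisive TP (fu (\<alpha> \<union> \<beta>)) {fu \<alpha>, fu \<beta>}"
      using that by (intro excisive_facet_pair) auto
    obtain u where "u \<in> scocycles (p + q) TP {UNIV} {fu (\<alpha> \<union> \<beta>)}"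
      "?cup \<alpha> \<beta> - u \<in> scoboundaries (p + q) TP {UNIV} {fu \<alpha>, fu \<beta>}"
      using excision_surj[OF e c] .
    then show ?thesis by blast
  qed
  then obtain \<xi> where \<xi>: "\<And>\<alpha> \<beta>. \<alpha> \<in> Pow {1..m} \<Longrightarrow> \<beta> \<in> Pow {1..m} \<Longrightarrow> \<xi> \<alpha> \<beta> \<in> scocycles (p + q) TP {UNIV} {fu (\<alpha> \<union> \<beta>)}"
    "\<And>\<alpha> \<beta>. \<alpha> \<in> Pow {1..m} \<Longrightarrow> \<beta> \<in> Pow {1..m} \<Longrightarrow> ?cup \<alpha> \<beta> - \<xi> \<alpha> \<beta> \<in> scoboundaries (p + q) TP {UNIV} {fu \<alpha>, fu \<beta>}"
    by metis
  have fu_Un: "fu \<alpha> \<union> fu \<beta> = fu (\<alpha> \<union> \<beta>)" for \<alpha> \<beta>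
    by (auto simp: facet_union_def)
  have cup: "cup_product p q TP (fu \<alpha>) (fu \<beta>) (x \<alpha>) (x' \<beta>) = cohomology_class (p + q) TP {fu (\<alpha> \<union> \<beta>)} (\<xi> \<alpha> \<beta>)"
    if ab: "\<alpha> \<in> Pow {1..m}" "\<beta> \<in> Pow {1..m}" for \<alpha> \<beta>
  proof -
    have "cup_product p q TP (fu \<alpha>) (fu \<beta>) (cohomology_class p TP {fu \<alpha>} (\<phi> \<alpha>)) (cohomology_class q TP {fu \<beta>} (\<phi>' \<beta>))
        = cohomology_class (p + q) TP {fu \<alpha> \<union> fu \<beta>} (\<xi> \<alpha> \<beta>)"
    proof (rule cup_product_cohomology_class[OF \<phi>[OF ab(1)] \<phi>'[OF ab(2)]])
      show "\<xi> \<alpha> \<beta> - ?cup \<alpha> \<beta> \<in> scoboundaries (p + q) TP {UNIV} {fu \<alpha>, fu \<beta>}"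
        using scoboundaries_uminus[OF \<xi>(2)[OF ab]] by simp
      show "z \<in> scoboundaries (p + q) TP {UNIV} {fu \<alpha> \<union> fu \<beta>}"
        if "z \<in> scocycles (p + q) TP {UNIV} {fu \<alpha> \<union> fu \<beta>}" "z \<in> scoboundaries (p + q) TP {UNIV} {fu \<alpha>, fu \<beta>}" for z
        using that ab unfolding fu_Un by (intro excision_inj[OF excisive_facet_pair]) auto
    qed (use \<xi>(1)[OF ab] fu_Un in simp)
    then show ?thesis using ab by (simp add: x x' fu_Un)
  qed
  define \<Xi> where "\<Xi> = (\<lambda>\<gamma>. \<Sum>(\<alpha>, \<beta>)\<in>unions_to \<gamma>. \<xi> \<alpha> \<beta>)"
  have un: "\<alpha> \<in> Pow {1..m}" "\<beta> \<in> Pow {1..m}" "\<alpha> \<union> \<beta> = \<gamma>" if "(\<alpha>, \<beta>) \<in> unions_to \<gamma>" for \<alpha> \<beta> \<gamma>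
    using that by (auto simp: unions_to_def)
  have \<xi>\<gamma>: "(case ab of (\<alpha>, \<beta>) \<Rightarrow> \<xi> \<alpha> \<beta>) \<in> scocycles (p + q) TP {UNIV} {fu \<gamma>}" if "ab \<in> unions_to \<gamma>" for ab \<gamma>
  proof (cases ab)
    case (Pair \<alpha> \<beta>)
    with that have ab: "(\<alpha>, \<beta>) \<in> unions_to \<gamma>" by simp
    from \<xi>(1)[OF un(1)[OF ab] un(2)[OF ab]] show ?thesis by (simp only: Pair prod.case un(3)[OF ab])
  qed
  show ?thesis
  proof (rule correspondsI)
    show "scup p q TX {UNIV} \<psi> \<psi>' \<in> scocycles (p + q) TX {UNIV} {{}}"
      using scup_in_scocycles[OF \<psi> \<psi>'] by simp
    show "\<Xi> \<gamma> \<in> scocycles (p + q) TP {UNIV} {fu \<gamma>}" for \<gamma>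
      unfolding \<Xi>_def by (rule scocycles_sum) (rule \<xi>\<gamma>)
    show "cup_product p q TX {} {} y y' = cohomology_class (p + q) TX {{}} (scup p q TX {UNIV} \<psi> \<psi>')"
      unfolding y y' by (rule cup_product_class_empty[OF \<psi> \<psi>'])
    have "finprod (relative_cohomology_group (p + q) TP (fu \<gamma>))
        (\<lambda>(\<alpha>, \<beta>). cup_product p q TP (fu \<alpha>) (fu \<beta>) (x \<alpha>) (x' \<beta>)) (unions_to \<gamma>)
        = cohomology_class (p + q) TP {fu \<gamma>} (\<Xi> \<gamma>)" for \<gamma>
    proof -
      interpret C: comm_group "relative_cohomology_group (p + q) TP (fu \<gamma>)"
        by (rule comm_group_cohomology_group)
      have "finprod (relative_cohomology_group (p + q) TP (fu \<gamma>))
          (\<lambda>(\<alpha>, \<beta>). cup_product p q TP (fu \<alpha>) (fu \<beta>) (x \<alpha>) (x' \<beta>)) (unions_to \<gamma>)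
        = finprod (relative_cohomology_group (p + q) TP (fu \<gamma>))
          (\<lambda>ab. cohomology_class (p + q) TP {fu \<gamma>} (case ab of (\<alpha>, \<beta>) \<Rightarrow> \<xi> \<alpha> \<beta>)) (unions_to \<gamma>)"
      proof (rule C.finprod_cong')
        show "(\<lambda>ab. cohomology_class (p + q) TP {fu \<gamma>} (case ab of (\<alpha>, \<beta>) \<Rightarrow> \<xi> \<alpha> \<beta>))
            \<in> unions_to \<gamma> \<rightarrow> carrier (relative_cohomology_group (p + q) TP (fu \<gamma>))"
          using \<xi>\<gamma> by (auto simp: carrier_cohomology_group)
        fix ab assume "ab \<in> unions_to \<gamma>"
        then show "(case ab of (\<alpha>, \<beta>) \<Rightarrow> cup_product p q TP (fu \<alpha>) (fu \<beta>) (x \<alpha>) (x' \<beta>))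
            = cohomology_class (p + q) TP {fu \<gamma>} (case ab of (\<alpha>, \<beta>) \<Rightarrow> \<xi> \<alpha> \<beta>)"
        proof (cases ab)
          case (Pair \<alpha> \<beta>)
          with \<open>ab \<in> unions_to \<gamma>\<close> have ab: "(\<alpha>, \<beta>) \<in> unions_to \<gamma>" by simp
          from cup[OF un(1)[OF ab] un(2)[OF ab]] show ?thesis by (simp only: Pair prod.case un(3)[OF ab])
        qed
      qed simp
      also have "\<dots> = cohomology_class (p + q) TP {fu \<gamma>} (\<Xi> \<gamma>)"
        unfolding \<Xi>_def by (rule finprod_cohomology_class[OF finite_unions_to \<xi>\<gamma>])
      finally show ?thesis .
    qed
    then show "facet_sum_product P m F p q x x' = (\<lambda>\<gamma>\<in>Pow {1..m}. cohomology_class (p + q) TP {fu \<gamma>} (\<Xi> \<gamma>))"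
      by (simp add: facet_sum_product_def unions_to_def)
    let ?S = "\<lambda>\<gamma>. \<Sum>(\<alpha>, \<beta>)\<in>unions_to \<gamma>. ?cup \<alpha> \<beta>"
    have \<phi>c: "\<phi> \<alpha> \<in> scochains p TP {UNIV} (F ` \<alpha>)" "\<phi>' \<alpha> \<in> scochains q TP {UNIV} (F ` \<alpha>)" if "\<alpha> \<in> Pow {1..m}" for \<alpha>
      using subsetD[OF scocycles_fu_subset \<phi>[OF that]] subsetD[OF scocycles_fu_subset \<phi>'[OF that]]
      by (auto simp: scocycles_def)
    have cup_assemble: "scup p q TX \<O> (assemble p \<pi> \<phi>) (assemble q \<pi> \<phi>') = assemble (p + q) \<pi> ?S"
      by (rule scup_assemble) (fact \<phi>c)+
    have 1: "srestrict (p + q) TX \<O> (scup p q TX {UNIV} \<psi> \<psi>') - assemble (p + q) \<pi> ?S \<in> scoboundaries (p + q) TX \<O> {{}}"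
      using scup_cohomologous[OF assemble_scocycles_fu[OF \<phi>] d assemble_scocycles_fu[OF \<phi>'] d']
      by (simp only: srestrict_scup cup_assemble Un_absorb True_implies_equals triv_forall_equality implies_True_equals)
    \<comment> \<open>The correction is a coboundary relative to
      \<open>{fu \<alpha>, fu \<beta>}\<close>, hence also relative to the \<open>F i\<close> with
      \<open>i\<close> in \<gamma>, which is what assembling needs.\<close>
    have "?S \<gamma> - \<Xi> \<gamma> \<in> scoboundaries (p + q) TP {UNIV} (F ` \<gamma>)" for \<gamma>
    proof -
      have "(\<Sum>ab\<in>unions_to \<gamma>. case ab of (\<alpha>, \<beta>) \<Rightarrow> ?cup \<alpha> \<beta> - \<xi> \<alpha> \<beta>) \<in> scoboundaries (p + q) TP {UNIV} (F ` \<gamma>)"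
      proof (rule scoboundaries_sum)
        fix ab assume ab: "ab \<in> unions_to \<gamma>"
        obtain \<alpha> \<beta> where eq: "ab = (\<alpha>, \<beta>)" by (cases ab)
        show "(case ab of (\<alpha>, \<beta>) \<Rightarrow> ?cup \<alpha> \<beta> - \<xi> \<alpha> \<beta>) \<in> scoboundaries (p + q) TP {UNIV} (F ` \<gamma>)"
          using subsetD[OF scoboundaries_fu_pair_subset \<xi>(2)[of \<alpha> \<beta>]] un[of \<alpha> \<beta> \<gamma>] ab eq by auto
      qed
      moreover have "(\<Sum>ab\<in>unions_to \<gamma>. case ab of (\<alpha>, \<beta>) \<Rightarrow> ?cup \<alpha> \<beta> - \<xi> \<alpha> \<beta>) = ?S \<gamma> - \<Xi> \<gamma>"
        unfolding \<Xi>_def sum_subtractf[symmetric] by (rule sum.cong) auto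
      ultimately show ?thesis by simp
    qed
    then have "assemble (p + q) \<pi> (\<lambda>\<gamma>. ?S \<gamma> - \<Xi> \<gamma>) \<in> scoboundaries (p + q) TX \<O> {{}}"
      by (intro assemble_in_scoboundaries[OF stratified_\<pi>])
    then have 2: "assemble (p + q) \<pi> ?S - assemble (p + q) \<pi> \<Xi> \<in> scoboundaries (p + q) TX \<O> {{}}"
      by (simp only: assemble_diff)
    show "srestrict (p + q) TX \<O> (scup p q TX {UNIV} \<psi> \<psi>') - assemble (p + q) \<pi> \<Xi> \<in> scoboundaries (p + q) TX \<O> {{}}"
      using scoboundaries_add[OF 1 2] by simp
  qed
qed

text \<open>The unit has only the component \<alpha> = \<open>{}\<close>. That component is
  assembled without any sign condition, so it gives the constant 1 on all small simplices of degree
  0.\<close>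

lemma corresponds_unit: "corresponds 0 (cohomology_unit TX) (facet_sum_unit P m F)"
proof (rule correspondsI)
  define \<phi> where "\<phi> = (\<lambda>\<alpha>::nat set. if \<alpha> = {} then sunit TP {UNIV} else 0)"
  have fu0: "fu {} = {}" by (simp add: facet_union_def)
  show "sunit TX {UNIV} \<in> scocycles 0 TX {UNIV} {{}}" by (rule sunit_in_scocycles)
  show \<phi>: "\<phi> \<alpha> \<in> scocycles 0 TP {UNIV} {fu \<alpha>}" for \<alpha>
    by (simp add: \<phi>_def fu0 sunit_in_scocycles)
  show "cohomology_unit TX = cohomology_class 0 TX {{}} (sunit TX {UNIV})" by (rule cohomology_unit_eq)
  show "facet_sum_unit P m F = (\<lambda>\<alpha>\<in>Pow {1..m}. cohomology_class 0 TP {fu \<alpha>} (\<phi> \<alpha>))"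
    by (auto simp: facet_sum_unit_def \<phi>_def cohomology_unit_eq one_cohomology_group fu0 fun_eq_iff)
  have "srestrict 0 TX \<O> (sunit TX {UNIV}) \<sigma> = assemble 0 \<pi> \<phi> \<sigma>" for \<sigma>
  proof (cases "\<sigma> \<in> small_simplices TX \<O> 0")
    case True
    then obtain \<beta> where \<beta>: "\<beta> \<subseteq> {1..m}" and sub: "\<sigma> ` standard_simplex 0 \<subseteq> orthant \<beta>"
      and \<sigma>: "singular_simplex 0 TX \<sigma>"
      by (rule small_orthantE)
    have "assemble 0 \<pi> \<phi> \<sigma> = (\<Sum>\<alpha>\<in>Pow \<beta>. \<phi> \<alpha> (simplex_map 0 \<pi> \<sigma>))"
      using subsetD[OF scocycles_fu_subset \<phi>]
      by (intro assemble_orthant[OF stratified_\<pi> _ \<sigma> \<beta> sub]) (auto simp: scocycles_def)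
    also have "\<dots> = (\<Sum>\<alpha>\<in>{{}}. \<phi> \<alpha> (simplex_map 0 \<pi> \<sigma>))"
      using \<beta> finite_subset by (intro sum.mono_neutral_right) (auto simp: \<phi>_def)
    also have "\<dots> = 1"
      using singular_simplex_simplex_map[OF \<sigma> cont_\<pi>] by (simp add: \<phi>_def sunit_def)
    finally show ?thesis using True \<sigma> by (simp add: srestrict_def sunit_def)
  qed (simp add: srestrict_def assemble_def)
  then have "srestrict 0 TX \<O> (sunit TX {UNIV}) = assemble 0 \<pi> \<phi>" by blast
  then show "srestrict 0 TX \<O> (sunit TX {UNIV}) - assemble 0 \<pi> \<phi> \<in> scoboundaries 0 TX \<O> {{}}" by simp
qed

end

section \<open>The isomorphism of graded rings\<close>

lemma graded_ring_data_cohomology: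
  "graded_ring_data (\<lambda>p. relative_cohomology_group p X {}) (\<lambda>p q. cup_product p q X {} {}) (cohomology_unit X)"
proof (rule graded_ring_data.intro)
  note cup = cup_product_class_empty
  have cl: "scup p q X {UNIV} u v \<in> scocycles (p + q) X {UNIV} {{}}"
    if "u \<in> scocycles p X {UNIV} {{}}" "v \<in> scocycles q X {UNIV} {{}}" for p q u v
    using scup_in_scocycles[OF that] by simp
  fix p q r x x' y y' z
  show "comm_group (relative_cohomology_group p X {})" by (rule comm_group_cohomology_group)
  show "cohomology_unit X \<in> carrier (relative_cohomology_group 0 X {})"
    by (simp add: cohomology_unit_eq carrier_cohomology_group sunit_in_scocycles)
  assume "x \<in> carrier (relative_cohomology_group p X {})"
  then obtain u where u: "u \<in> scocycles p X {UNIV} {{}}" "x = cohomology_class p X {{}} u"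
    by (auto simp: carrier_cohomology_group)
  then have uc: "u \<in> scochains p X {UNIV} {{}}" by (simp add: scocycles_def)
  show "cup_product 0 p X {} {} (cohomology_unit X) x = x"
    by (simp add: u cohomology_unit_eq cup[OF sunit_in_scocycles u(1)] scup_unit_left[OF uc])
  show "cup_product p 0 X {} {} x (cohomology_unit X) = x"
    using cup[OF u(1) sunit_in_scocycles] by (simp add: u cohomology_unit_eq scup_unit_right[OF uc])
  assume "y \<in> carrier (relative_cohomology_group q X {})"
  then obtain v where v: "v \<in> scocycles q X {UNIV} {{}}" "y = cohomology_class q X {{}} v"
    by (auto simp: carrier_cohomology_group)
  show "cup_product p q X {} {} x y \<in> carrier (relative_cohomology_group (p + q) X {})"
    by (simp add: u v cup cl carrier_cohomology_group)
  show "cup_product p q X {} {} x (y \<otimes>\<^bsub>relative_cohomology_group q X {}\<^esub> y')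
     = cup_product p q X {} {} x y \<otimes>\<^bsub>relative_cohomology_group (p + q) X {}\<^esub> cup_product p q X {} {} x y'"
    if "y' \<in> carrier (relative_cohomology_group q X {})"
    using that u v by (auto simp: carrier_cohomology_group cup mult_cohomology_class scocycles_add scup_add_right)
  show "cup_product p q X {} {} (x \<otimes>\<^bsub>relative_cohomology_group p X {}\<^esub> x') y
     = cup_product p q X {} {} x y \<otimes>\<^bsub>relative_cohomology_group (p + q) X {}\<^esub> cup_product p q X {} {} x' y"
    if "x' \<in> carrier (relative_cohomology_group p X {})"
    using that u v by (auto simp: carrier_cohomology_group cup mult_cohomology_class scocycles_add scup_add_left)
  show "cup_product (p + q) r X {} {} (cup_product p q X {} {} x y) z
      = cup_product p (q + r) X {} {} x (cup_product q r X {} {} y z)"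
    if "z \<in> carrier (relative_cohomology_group r X {})"
    using that u v by (auto simp: carrier_cohomology_group cup cl scup_assoc add.assoc)
qed

text \<open>The ring axioms are verified for the cohomology of \<open>TX\<close>, where no vanishing
  condition intervenes and identities of cochains suffice; those for the sum over \<alpha> follow
  from the correspondence.\<close>

theorem (in stratified_faces) graded_ring_isomorphic_facets:
  "graded_ring_isomorphic (cohomology_ring TX) (facet_sum_ring P m F)"
proof -
  interpret graded_ring_correspondence "\<lambda>p. relative_cohomology_group p TX {}" "\<lambda>p q. cup_product p q TX {} {}"
    "cohomology_unit TX" "facet_sum_group P m F" "facet_sum_product P m F" "facet_sum_unit P m F" corresponds
  proof (intro graded_ring_correspondence.intro graded_ring_data_cohomology graded_ring_correspondence_axioms.intro)
  qed (simp_all add: comm_group_facet_sum_group corresponds_carrier corresponds_left corresponds_right corresponds_mult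
      corresponds_one corresponds_prod corresponds_unit)
  show ?thesis
    using graded_ring_isomorphic by (simp add: cohomology_ring_def facet_sum_ring_def)
qed

lemma (in faces) exists_stratified_faces: "\<exists>\<pi> s. stratified_faces P m F \<pi> s"
proof -
  have "\<exists>\<pi> s. stratified_faces_axioms P m F \<pi> s"
  proof (rule stratified_retraction)
    fix \<pi> s
    assume *: "continuous_map TX (top_of_set P) \<pi>"
      "\<And>z i. z \<in> X \<Longrightarrow> i \<in> {1..m} \<Longrightarrow> z i = 0 \<Longrightarrow> \<pi> z \<in> F i"
      "\<And>z. \<pi> (\<lambda>i\<in>{1..m}. \<bar>z i\<bar>) = \<pi> z" "continuous_map (top_of_set P) TX s"
      "\<And>x i. i \<in> {1..m} \<Longrightarrow> 0 \<le> s x i" "\<And>x i. i \<in> {1..m} \<Longrightarrow> x \<in> F i \<Longrightarrow> s x i = 0"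
      "\<And>z t. z \<in> X \<Longrightarrow> (\<And>i. i \<in> {1..m} \<Longrightarrow> 0 \<le> z i) \<Longrightarrow> 0 \<le> t \<Longrightarrow> t \<le> 1 \<Longrightarrow>
         (\<lambda>i\<in>{1..m}. (1 - t) * z i + t * s (\<pi> z) i) \<in> X"
    have "stratified_faces_axioms P m F \<pi> s"
      by (rule stratified_faces_axioms.intro) (rule *; assumption)+
    then show "\<exists>\<pi> s. stratified_faces_axioms P m F \<pi> s" by blast
  qed
  then show ?thesis
    using faces_axioms by (auto simp: stratified_faces_def)
qed

theorem mainTheorem3:
  fixes P :: "'a::euclidean_space set" and m :: nat and F :: "nat \<Rightarrow> 'a set"
  assumes "simple_polytope P"
    and "bij_betw F {1..m} {F. F facet_of P}"
  shows "graded_ring_isomorphic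
           (cohomology_ring (real_moment_angle_complex m (dual_boundary_complex m F)))
           (facet_sum_ring P m F)"
proof -
  have facet: "F i facet_of P" if "i \<in> {1..m}" for i
    using assms(2) that by (auto simp: bij_betw_def)
  interpret faces P m F
  proof
    show "convex P" "compact P" "P \<noteq> {}"
      using assms(1) by (auto simp: simple_polytope_def polytope_imp_convex polytope_imp_compact)
  qed (use facet in \<open>auto simp: facet_of_def\<close>)
  obtain \<pi> s where "stratified_faces P m F \<pi> s"
    using exists_stratified_faces by blast
  then interpret stratified_faces P m F \<pi> s .
  show ?thesis
    using graded_ring_isomorphic_facets by (simp only: TX_def \<Sigma>_def)
qed

end
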